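(* Consider the system $$dX(t)=\left(A_1X(t)+A_2\mathbb{E}[X(t)]+B_2\mathbb{E}[u(t)]\right)dt+\left(C\,\mathbb{E}[X(t)]+D_2\mathbb{E}[u(t)]\right)dW(t),\ t\in[0,T],\quad X(0)=X_0\in\mathbb{R}^d.$$ 1) If $\mathrm{Range}(C)\subset\mathrm{Range}(D_2)$ and the system is exactly terminal controllable to normal laws, then $$\mathrm{Rank}\left(\left[D_2\ \vdots\ A_1D_2\ \vdots\ \cdots\ \vdots\ A_1^{d-1}D_2\right]\right)=d.$$ 2) If $\mathrm{Rank}(D_2)=d$, then the system is exactly terminal controllable to normal laws.
   Context: Let $T>0$ be fixed, $W$ a scalar standard Brownian motion on a probability space $(\Omega,\mathcal{F},\mathbb{P})$, and $\mathbb{F}=\{\mathcal{F}_t\}_{t\ge0}$ the augmented Brownian filtration enriched with an initial $\sigma$-field $\mathcal{F}_0$, independent of $W$ and large enough to support all laws in the 2-Wasserstein space $\mathcal{P}_2(\mathbb{R}^d)$. Let $d,n\ge1$ be integers, $A_1,A_2,C\in\mathbb{R}^{d\times d}$ and $B_2,D_2\in\mathbb{R}^{d\times n}$ constant matrices. Controls $u$ belong to $\mathbb{L}^2_{\mathbb{F}}(\Omega\times[0,T];\mathbb{R}^n)$, the space of square-integrable $\mathbb{F}$-progressively measurable $\mathbb{R}^n$-valued processes; $X^{x,u}$ is the solution with deterministic initial value $X_0=x\in\mathbb{R}^d$ and control $u$, and $\mathbb{P}_\xi$ denotes the law of $\xi$. $[D_2\ \vdots\ A_1D_2\ \vdots\cdots]$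 denotes horizontal concatenation of matrices. Let $\mathcal{R}each^{\mathbb{P}}_T(x):=\{\mathbb{P}_{X^{x,u}(T)}: u\in\mathbb{L}^2_{\mathbb{F}}(\Omega\times[0,T];\mathbb{R}^n)\}$ and $\mathcal{G}auss:=\{\mathcal{N}(\alpha,\Sigma):\alpha\in\mathbb{R}^d,\ \Sigma\in\mathcal{S}^d_+\}$, where $\mathcal{S}^d_+$ is the set of positive semidefinite symmetric $d\times d$ matrices (degenerate Gaussian laws included). The system is exactly terminal controllable to normal laws (ETCNL) if $\bigcup_{x\in\mathbb{R}^d}\mathcal{R}each^{\mathbb{P}}_T(x)=\mathcal{G}auss$. *)

theory Defs
  imports "HOL-Probability.Probability"
begin

section \<open>Brownian motion and its enriched filtration\<close>

definition brownian_motion :: "'a measure \<Rightarrow> (real \<Rightarrow> 'a \<Rightarrow> real) \<Rightarrow> bool" where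
  "brownian_motion M W \<longleftrightarrow>
     prob_space M \<and>
     (\<forall>t\<ge>0. W t \<in> borel_measurable M) \<and>
     (AE \<omega> in M. W 0 \<omega> = 0) \<and>
     (AE \<omega> in M. continuous_on {0..} (\<lambda>t. W t \<omega>)) \<and>
     (\<forall>s t. 0 \<le> s \<and> s < t \<longrightarrow>
        distributed M lborel (\<lambda>\<omega>. W t \<omega> - W s \<omega>) (normal_density 0 (sqrt (t - s))) \<and>
        prob_space.indep_set M
          (sigma_sets (space M) {(\<lambda>\<omega>. W t \<omega> - W s \<omega>) -` B \<inter> space M | B. B \<in> sets borel})
          (sigma_sets (space M) {W r -` B \<inter> space M | r B. 0 \<le> r \<and> r \<le> s \<and> B \<in> sets borel}))"

text \<open>The initial \<open>\<sigma>\<close>-field is a measure \<open>F0\<close> of which only the \<open>\<sigma>\<close>-algebra matters.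
  The augmentation adds the null events of the given probability space, which is not
  assumed to be complete; if it is, these are all subsets of null events.\<close>

definition brownian_filtration ::
    "'a measure \<Rightarrow> 'a measure \<Rightarrow> (real \<Rightarrow> 'a \<Rightarrow> real) \<Rightarrow> real \<Rightarrow> 'a measure" where
  "brownian_filtration M F0 W t =
     sigma (space M)
       (sets F0 \<union> {W s -` B \<inter> space M | s B. 0 \<le> s \<and> s \<le> t \<and> B \<in> sets borel} \<union> null_sets M)"

definition independent_of_process ::
    "'a measure \<Rightarrow> 'a measure \<Rightarrow> (real \<Rightarrow> 'a \<Rightarrow> real) \<Rightarrow> bool" where
  "independent_of_process M F0 W \<longleftrightarrow>
     prob_space.indep_set M (sets F0)
       (sigma_sets (space M) {W s -` B \<inter> space M | s B. 0 \<le> s \<and> B \<in> sets borel})"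

definition wasserstein_space_2 :: "'b::euclidean_space measure set" where
  "wasserstein_space_2 =
     {\<mu>. prob_space \<mu> \<and> sets \<mu> = sets borel \<and> (\<integral>\<^sup>+x. ennreal ((norm x)\<^sup>2) \<partial>\<mu>) < \<infinity>}"

definition supports_law :: "'a measure \<Rightarrow> 'a measure \<Rightarrow> 'b::euclidean_space measure \<Rightarrow> bool" where
  "supports_law M F0 \<mu> \<longleftrightarrow> (\<exists>\<xi>\<in>borel_measurable F0. distr M borel \<xi> = \<mu>)"

section \<open>Square-integrable progressive processes\<close>

definition progressively_measurable ::
    "(real \<Rightarrow> 'a measure) \<Rightarrow> real \<Rightarrow> (real \<Rightarrow> 'a \<Rightarrow> 'b::euclidean_space) \<Rightarrow> bool" where
  "progressively_measurable F T u \<longleftrightarrow>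
     (\<forall>t\<in>{0..T}. (\<lambda>(s, \<omega>). u s \<omega>) \<in> borel_measurable (restrict_space borel {0..t} \<Otimes>\<^sub>M F t))"

definition L2_prog ::
    "'a measure \<Rightarrow> (real \<Rightarrow> 'a measure) \<Rightarrow> real \<Rightarrow> (real \<Rightarrow> 'a \<Rightarrow> 'b::euclidean_space) set" where
  "L2_prog M F T =
     {u. progressively_measurable F T u \<and>
         (\<integral>\<^sup>+\<omega>. (\<integral>\<^sup>+s\<in>{0..T}. ennreal ((norm (u s \<omega>))\<^sup>2) \<partial>lborel) \<partial>M) < \<infinity>}"

section \<open>The Ito integral\<close>

text \<open>A simple process is given by a partition \<open>p 0 \<le> \<dots> \<le> p N\<close> of a part of \<open>[0, T]\<close> and bounded
  \<open>\<F>\<^sub>p\<^sub>i\<close>-measurable values \<open>\<xi> i\<close>, attained on \<open>(p i, p (i + 1)]\<close>.\<close>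

definition simple_process ::
    "'a measure \<Rightarrow> (real \<Rightarrow> 'a measure) \<Rightarrow> real \<Rightarrow> nat \<Rightarrow> (nat \<Rightarrow> real) \<Rightarrow>
      (nat \<Rightarrow> 'a \<Rightarrow> 'b::euclidean_space) \<Rightarrow> bool" where
  "simple_process M F T N p \<xi> \<longleftrightarrow>
     0 \<le> p 0 \<and> p N \<le> T \<and>
     (\<forall>i<N. p i \<le> p (Suc i) \<and> \<xi> i \<in> borel_measurable (F (p i)) \<and>
        (\<exists>K. \<forall>\<omega>\<in>space M. norm (\<xi> i \<omega>) \<le> K))"

definition simple_value ::
    "nat \<Rightarrow> (nat \<Rightarrow> real) \<Rightarrow> (nat \<Rightarrow> 'a \<Rightarrow> 'b::euclidean_space) \<Rightarrow> real \<Rightarrow> 'a \<Rightarrow> 'b" where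
  "simple_value N p \<xi> s \<omega> = (\<Sum>i<N. indicat_real {p i<..p (Suc i)} s *\<^sub>R \<xi> i \<omega>)"

definition simple_integral ::
    "(real \<Rightarrow> 'a \<Rightarrow> real) \<Rightarrow> nat \<Rightarrow> (nat \<Rightarrow> real) \<Rightarrow> (nat \<Rightarrow> 'a \<Rightarrow> 'b::euclidean_space) \<Rightarrow>
      real \<Rightarrow> 'a \<Rightarrow> 'b" where
  "simple_integral W N p \<xi> t \<omega> =
     (\<Sum>i<N. (W (min t (p (Suc i))) \<omega> - W (min t (p i)) \<omega>) *\<^sub>R \<xi> i \<omega>)"

text \<open>\<open>ito_integral M F W T \<phi> I\<close> says that \<open>I\<close> is a version with almost surely continuous paths
  of the process \<open>t \<mapsto> \<integral>\<^sub>0\<^sup>t \<phi> dW\<close> on \<open>[0, T]\<close>.\<close>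

definition ito_integral ::
    "'a measure \<Rightarrow> (real \<Rightarrow> 'a measure) \<Rightarrow> (real \<Rightarrow> 'a \<Rightarrow> real) \<Rightarrow> real \<Rightarrow>
      (real \<Rightarrow> 'a \<Rightarrow> 'b::euclidean_space) \<Rightarrow> (real \<Rightarrow> 'a \<Rightarrow> 'b) \<Rightarrow> bool" where
  "ito_integral M F W T \<phi> I \<longleftrightarrow>
     \<phi> \<in> L2_prog M F T \<and>
     (\<forall>t\<in>{0..T}. I t \<in> borel_measurable (F t)) \<and>
     (AE \<omega> in M. continuous_on {0..T} (\<lambda>t. I t \<omega>)) \<and>
     (\<exists>N p \<xi>.
        (\<forall>k. simple_process M F T (N k) (p k) (\<xi> k)) \<and>
        (\<lambda>k. \<integral>\<^sup>+\<omega>. (\<integral>\<^sup>+s\<in>{0..T}.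
               ennreal ((norm (simple_value (N k) (p k) (\<xi> k) s \<omega> - \<phi> s \<omega>))\<^sup>2) \<partial>lborel) \<partial>M)
          \<longlonglongrightarrow> 0 \<and>
        (\<forall>t\<in>{0..T}.
          (\<lambda>k. \<integral>\<^sup>+\<omega>. ennreal ((norm (simple_integral W (N k) (p k) (\<xi> k) t \<omega> - I t \<omega>))\<^sup>2) \<partial>M)
            \<longlonglongrightarrow> 0))"

section \<open>The controlled mean-field equation\<close>

text \<open>\<open>X\<close> solves
  \<open>dX = (A\<^sub>1 X + A\<^sub>2 E[X] + B\<^sub>2 E[u]) dt + (C E[X] + D\<^sub>2 E[u]) dW\<close>, \<open>X(0) = x\<close>, on \<open>[0, T]\<close> in the
  usual class of adapted continuous processes with \<open>E[sup |X|\<^sup>2] < \<infinity>\<close>. For a square-integrable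
  control, \<open>E[u(t)]\<close> exists for almost every \<open>t\<close> only; on the exceptional null set of times the
  library integral has the irrelevant value \<open>0\<close>.\<close>

definition mf_solution ::
    "'a measure \<Rightarrow> (real \<Rightarrow> 'a measure) \<Rightarrow> (real \<Rightarrow> 'a \<Rightarrow> real) \<Rightarrow> real \<Rightarrow>
      real^'d^'d \<Rightarrow> real^'d^'d \<Rightarrow> real^'n^'d \<Rightarrow> real^'d^'d \<Rightarrow> real^'n^'d \<Rightarrow>
      real^'d \<Rightarrow> (real \<Rightarrow> 'a \<Rightarrow> real^'n) \<Rightarrow> (real \<Rightarrow> 'a \<Rightarrow> real^'d) \<Rightarrow> bool" where
  "mf_solution M F W T A1 A2 B2 C D2 x u X \<longleftrightarrow>
     (\<forall>t\<in>{0..T}. X t \<in> borel_measurable (F t)) \<and>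
     (AE \<omega> in M. continuous_on {0..T} (\<lambda>t. X t \<omega>)) \<and>
     (\<integral>\<^sup>+\<omega>. (SUP t\<in>{0..T}. ennreal ((norm (X t \<omega>))\<^sup>2)) \<partial>M) < \<infinity> \<and>
     (\<exists>I. ito_integral M F W T
            (\<lambda>s \<omega>. C *v (\<integral>\<omega>'. X s \<omega>' \<partial>M) + D2 *v (\<integral>\<omega>'. u s \<omega>' \<partial>M)) I \<and>
          (AE \<omega> in M. \<forall>t\<in>{0..T}.
             X t \<omega> = x +
               (LBINT s:{0..t}. A1 *v X s \<omega> + A2 *v (\<integral>\<omega>'. X s \<omega>' \<partial>M) + B2 *v (\<integral>\<omega>'. u s \<omega>' \<partial>M))
               + I t \<omega>))"

text \<open>Solutions are unique up to indistinguishability, so ranging over all solutions \<open>X\<close> below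
  contributes exactly one law for every control \<open>u\<close>.\<close>

definition reach_laws ::
    "'a measure \<Rightarrow> (real \<Rightarrow> 'a measure) \<Rightarrow> (real \<Rightarrow> 'a \<Rightarrow> real) \<Rightarrow> real \<Rightarrow>
      real^'d^'d \<Rightarrow> real^'d^'d \<Rightarrow> real^'n^'d \<Rightarrow> real^'d^'d \<Rightarrow> real^'n^'d \<Rightarrow>
      real^'d \<Rightarrow> (real^'d) measure set" where
  "reach_laws M F W T A1 A2 B2 C D2 x =
     {distr M borel (X T) | u X.
        u \<in> L2_prog M F T \<and> mf_solution M F W T A1 A2 B2 C D2 x u X}"

section \<open>Gaussian laws and controllability\<close>

definition pos_semidef :: "real^'d^'d \<Rightarrow> bool" where
  "pos_semidef S \<longleftrightarrow> transpose S = S \<and> (\<forall>v. 0 \<le> v \<bullet> (S *v v))"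

text \<open>The law \<open>\<N>(\<alpha>, S)\<close> is given by its characteristic function, so that singular \<open>S\<close> is covered.\<close>

definition normal_law :: "real^'d \<Rightarrow> real^'d^'d \<Rightarrow> (real^'d) measure \<Rightarrow> bool" where
  "normal_law \<alpha> S \<mu> \<longleftrightarrow>
     prob_space \<mu> \<and> sets \<mu> = sets borel \<and>
     (\<forall>v. (\<integral>y. exp (\<i> * complex_of_real (v \<bullet> y)) \<partial>\<mu>) =
          exp (\<i> * complex_of_real (v \<bullet> \<alpha>) - complex_of_real (v \<bullet> (S *v v) / 2)))"

definition gauss_laws :: "(real^'d) measure set" where
  "gauss_laws = {\<mu>. \<exists>\<alpha> S. pos_semidef S \<and> normal_law \<alpha> S \<mu>}"

definition ETCNL ::
    "'a measure \<Rightarrow> (real \<Rightarrow> 'a measure) \<Rightarrow> (real \<Rightarrow> 'a \<Rightarrow> real) \<Rightarrow> real \<Rightarrow>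
      real^'d^'d \<Rightarrow> real^'d^'d \<Rightarrow> real^'n^'d \<Rightarrow> real^'d^'d \<Rightarrow> real^'n^'d \<Rightarrow> bool" where
  "ETCNL M F W T A1 A2 B2 C D2 \<longleftrightarrow>
     (\<Union>x. reach_laws M F W T A1 A2 B2 C D2 x) = gauss_laws"

text \<open>The \<open>d \<times> (d n)\<close> matrix \<open>[D, A D, \<dots>, A\<^bsup>d-1\<^esup> D]\<close>. Its columns are indexed by pairs \<open>(k, j)\<close>:
  column \<open>j\<close> of the block number \<open>to_nat_on UNIV k\<close>, where \<open>to_nat_on UNIV\<close> is a bijection from the
  index type \<open>'d\<close> onto \<open>{..<d}\<close>. The iteration is of matrix multiplication, as the power
  operation on \<open>real^'d^'d\<close> is componentwise.\<close>

definition kalman_matrix :: "real^'d^'d \<Rightarrow> real^'n^'d \<Rightarrow> real^('d \<times> 'n)^'d" where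
  "kalman_matrix A D =
     (\<chi> i kj. ((((**) A) ^^ to_nat_on (UNIV :: 'd set) (fst kj)) D) $ i $ snd kj)"

end

theory Submission
  imports Defs
begin

text \<open>
  The diffusion coefficient \<open>\<phi> = C E[X] + D\<^sub>2 E[u]\<close> of a solution is deterministic. Hence, by variation of
  constants, \<open>X(T)\<close> is a constant plus the Wiener integral of \<open>e\<^bsup>A\<^sub>1(T - s)\<^esup> \<phi>(s)\<close>, and its
  characteristic function at \<open>w\<close> has modulus \<open>exp (- 1/2 \<integral> (w \<bullet> e\<^bsup>A\<^sub>1(T - s)\<^esup> \<phi>(s))\<^sup>2 ds)\<close>; in particular
  every reachable law is Gaussian. If the Kalman matrix has rank less than \<open>d\<close>, some \<open>w \<noteq> 0\<close> is orthogonal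
  to all \<open>A\<^sub>1\<^bsup>k\<^esup> D\<^sub>2\<close>, so that \<open>w \<bullet> X(T)\<close> is deterministic for every control when
  \<open>Range C \<subseteq> Range D\<^sub>2\<close>, and a Gaussian law with positive variance in direction \<open>w\<close> is not reached.
  If \<open>D\<^sub>2\<close> has rank \<open>d\<close>, the coefficient can be prescribed: writing the target covariance as \<open>\<Sum> \<tau>\<^sub>i \<tau>\<^sub>i\<^sup>T\<close> and
  choosing orthonormal cosines \<open>e\<^sub>i\<close> on \<open>[0, T]\<close>, take \<open>\<phi>(s) = e\<^bsup>A\<^sub>1(s - T)\<^esup> \<Sum> e\<^sub>i(s) \<tau>\<^sub>i\<close> and solve the linear
  equation for the mean backwards from the target mean. The controls may be taken deterministic.
\<close>

section \<open>The matrix exponential\<close>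

text \<open>The stochastic analysis is kept pathwise wherever possible. \<open>ito_integral\<close>
  is only a mean square limit of simple integrals, whose approximating values may be random even for
  a deterministic integrand, so the Gaussian character has to be recovered by averaging those
  values. Variation of constants then uses no Ito calculus: integration by parts replaces the
  stochastic convolution by \<open>I T\<close> plus an ordinary time integral of the continuous path
  of \<open>I\<close>. Its Riemann sums involve finitely many \<open>I t\<close>, which is why joint
  characteristic functions at several times are computed. \<open>A2\<close> and \<open>B2\<close>
  multiply means only, so for a given diffusion coefficient they enter just the deterministic shift
  of \<open>X T\<close>. In the converse, the cosine profile is continuously differentiable, which
  makes the stochastic integral available path by path; a Doob bound for \<open>W\<close> supplies
  the supremum moment demanded of a solution. Normal laws are specified by characteristic functions,
  so hitting a target law exactly rests on uniqueness of these on \<open>real^'d\<close>.\<close>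

lemma bounded_bilinear_matrix_matrix_mult:
  "bounded_bilinear ((**) :: real^'m^'n \<Rightarrow> real^'k^'m \<Rightarrow> real^'k^'n)"
  by (simp add: bilinear_conv_bounded_bilinear [symmetric] bilinear_def linear_iff vec_eq_iff
      matrix_matrix_mult_def sum.distrib sum_distrib_left algebra_simps)

lemma bounded_bilinear_matrix_vector_mult:
  "bounded_bilinear ((*v) :: real^'m^'n \<Rightarrow> real^'m \<Rightarrow> real^'n)"
  by (simp add: bilinear_conv_bounded_bilinear [symmetric] bilinear_def linear_iff vec_eq_iff
      matrix_vector_mult_def sum.distrib sum_distrib_left algebra_simps)

lemma has_vector_derivative_vec:
  fixes f :: "real \<Rightarrow> ('b::euclidean_space)^'n"
  assumes "\<And>i. ((\<lambda>t. f t $ i) has_vector_derivative f' $ i) (at x within S)"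
  shows "(f has_vector_derivative f') (at x within S)"
  unfolding has_vector_derivative_def
proof (subst has_derivative_componentwise_within, intro ballI)
  fix b :: "'b^'n" assume "b \<in> Basis"
  then obtain i u where b: "b = axis i u" by (auto simp: Basis_vec_def)
  show "((\<lambda>t. f t \<bullet> b) has_derivative (\<lambda>h. (h *\<^sub>R f') \<bullet> b)) (at x within S)"
    using has_derivative_inner_left[OF assms[of i, unfolded has_vector_derivative_def], of u]
    by (simp add: b inner_axis)
qed

definition matpow :: "real^'d^'d \<Rightarrow> nat \<Rightarrow> real^'d^'d" where
  "matpow A k = (((**) A) ^^ k) (mat 1)"

lemma matpow_0 [simp]: "matpow A 0 = mat 1"
  and matpow_Suc: "matpow A (Suc k) = A ** matpow A k"
  by (simp_all add: matpow_def)

lemma matpow_Suc_right: "matpow A (Suc k) = matpow A k ** A"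
  by (induction k) (simp_all add: matpow_Suc matrix_mul_assoc)

lemma funpow_matrix_mult: "(((**) A) ^^ k) B = matpow A k ** B"
  by (induction k) (simp_all add: matpow_Suc matrix_mul_assoc)

text \<open>The exponential series of \<open>t A\<close>, taken entry by entry so that convergence
  and differentiation are those of real power series in \<open>t\<close>.\<close>

definition mexp :: "real^'d^'d \<Rightarrow> real \<Rightarrow> real^'d^'d" where
  "mexp A t = (\<chi> i j. \<Sum>k. matpow A k $ i $ j / fact k * t ^ k)"

text \<open>The sum of the moduli of all entries dominates every row sum, so the induction closes
  without a submultiplicative norm, and the powers of the bound are summable against
  \<open>fact k\<close>.\<close>

lemma abs_matpow_le: "\<bar>matpow A k $ i $ j\<bar> \<le> (\<Sum>a\<in>UNIV. \<Sum>b\<in>UNIV. \<bar>A $ a $ b\<bar>) ^ k"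
proof (induction k arbitrary: i)
  case 0
  then show ?case by (simp add: mat_def)
next
  case (Suc k)
  let ?K = "\<Sum>a\<in>UNIV. \<Sum>b\<in>UNIV. \<bar>A $ a $ b\<bar>"
  have K0: "0 \<le> ?K" by (intro sum_nonneg) auto
  have "\<bar>matpow A (Suc k) $ i $ j\<bar> \<le> (\<Sum>l\<in>UNIV. \<bar>A $ i $ l * matpow A k $ l $ j\<bar>)"
    by (simp add: matpow_Suc matrix_matrix_mult_def sum_abs)
  also have "\<dots> \<le> (\<Sum>l\<in>UNIV. \<bar>A $ i $ l\<bar> * ?K ^ k)"
    by (intro sum_mono) (simp add: abs_mult mult_left_mono Suc.IH)
  also have "\<dots> = (\<Sum>l\<in>UNIV. \<bar>A $ i $ l\<bar>) * ?K ^ k"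
    by (simp add: sum_distrib_right)
  also have "\<dots> \<le> ?K * ?K ^ k"
    using member_le_sum[of i UNIV "\<lambda>a. \<Sum>b\<in>UNIV. \<bar>A $ a $ b\<bar>"] K0
    by (intro mult_right_mono) (auto simp: sum_nonneg)
  finally show ?case by simp
qed

lemma summable_mexp: "summable (\<lambda>k. matpow A k $ i $ j / fact k * (t::real) ^ k)"
proof (rule summable_comparison_test')
  let ?K = "\<Sum>a\<in>UNIV. \<Sum>b\<in>UNIV. \<bar>A $ a $ b\<bar>"
  show "summable (\<lambda>k. (?K * \<bar>t\<bar>) ^ k /\<^sub>R fact k)" by (rule summable_exp_generic)
  show "norm (matpow A k $ i $ j / fact k * t ^ k) \<le> (?K * \<bar>t\<bar>) ^ k /\<^sub>R fact k" if "k \<ge> 0" for k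
    using mult_right_mono[OF abs_matpow_le[of A k i j], of "\<bar>t\<bar> ^ k / fact k"]
    by (simp add: abs_mult power_abs power_mult_distrib field_simps)
qed

lemma mexp_0 [simp]: "mexp A 0 = mat 1"
proof -
  have "(\<Sum>k. matpow A k $ i $ j / fact k * 0 ^ k) = mat 1 $ i $ j" for i j
    using powser_zero[of "\<lambda>k. matpow A k $ i $ j / fact k"] by simp
  then show ?thesis by (simp add: mexp_def vec_eq_iff)
qed

text \<open>The finite sum and the series are interchanged. The shifted series is also that of the
  product in the other order and that of the derivative.\<close>

lemma mexp_mult_left:
  "(A ** mexp A t) $ i $ j = (\<Sum>k. matpow A (Suc k) $ i $ j / fact k * t ^ k)"
proof -
  have "(A ** mexp A t) $ i $ j
      = (\<Sum>l\<in>UNIV. \<Sum>k. A $ i $ l * (matpow A k $ l $ j / fact k * t ^ k))"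
    unfolding matrix_matrix_mult_def mexp_def vec_lambda_beta
    by (intro sum.cong refl suminf_mult [symmetric] summable_mexp)
  also have "\<dots> = (\<Sum>k. \<Sum>l\<in>UNIV. A $ i $ l * (matpow A k $ l $ j / fact k * t ^ k))"
    by (intro suminf_sum [symmetric] summable_mult summable_mexp)
  also have "\<dots> = (\<Sum>k. matpow A (Suc k) $ i $ j / fact k * t ^ k)"
    by (simp add: matpow_Suc matrix_matrix_mult_def sum_distrib_right sum_divide_distrib mult.assoc)
  finally show ?thesis .
qed

lemma mexp_mult_right:
  "(mexp A t ** A) $ i $ j = (\<Sum>k. matpow A (Suc k) $ i $ j / fact k * t ^ k)"
proof -
  have "(mexp A t ** A) $ i $ j
      = (\<Sum>l\<in>UNIV. \<Sum>k. (matpow A k $ i $ l / fact k * t ^ k) * A $ l $ j)"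
    unfolding matrix_matrix_mult_def mexp_def vec_lambda_beta
    by (intro sum.cong refl suminf_mult2 summable_mexp)
  also have "\<dots> = (\<Sum>k. \<Sum>l\<in>UNIV. (matpow A k $ i $ l / fact k * t ^ k) * A $ l $ j)"
    by (intro suminf_sum [symmetric] summable_mult2 summable_mexp)
  also have "\<dots> = (\<Sum>k. matpow A (Suc k) $ i $ j / fact k * t ^ k)"
    by (simp add: matpow_Suc_right matrix_matrix_mult_def sum_distrib_left sum_divide_distrib
        mult.commute mult.left_commute)
  finally show ?thesis .
qed

lemma mexp_commute: "A ** mexp A t = mexp A t ** A"
  by (simp add: vec_eq_iff mexp_mult_left mexp_mult_right)

lemma has_vector_derivative_mexp [derivative_intros]:
  "(mexp A has_vector_derivative A ** mexp A t) (at t within S)"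
proof -
  have "((\<lambda>t. mexp A t $ i $ j) has_vector_derivative (A ** mexp A t) $ i $ j) (at t)" for i j
  proof -
    have "((\<lambda>t. \<Sum>k. matpow A k $ i $ j / fact k * t ^ k) has_field_derivative
        (\<Sum>k. diffs (\<lambda>k. matpow A k $ i $ j / fact k) k * t ^ k)) (at t)"
      by (rule termdiffs_strong_converges_everywhere[OF summable_mexp])
    \<comment> \<open>The factor \<open>k + 1\<close> from differentiation cancels against the
      factorial, leaving the shifted series.\<close>
    also have "diffs (\<lambda>k. matpow A k $ i $ j / fact k) = (\<lambda>k. matpow A (Suc k) $ i $ j / fact k)"
      by (simp add: diffs_def fun_eq_iff field_simps del: of_nat_Suc)
    finally show ?thesis
      unfolding mexp_mult_left by (simp add: mexp_def has_real_derivative_iff_has_vector_derivative)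
  qed
  then have "(mexp A has_vector_derivative A ** mexp A t) (at t)"
    by (intro has_vector_derivative_vec)
  then show ?thesis by (rule has_vector_derivative_at_within)
qed

text \<open>The product has derivative zero, because \<open>A\<close> commutes with
  \<open>mexp A t\<close>, and so keeps its value at time 0.\<close>

lemma mexp_inverse: "mexp A t ** mexp A (- t) = mat 1"
proof -
  have neg: "((\<lambda>t. mexp A (- t)) has_vector_derivative - (A ** mexp A (- t))) (at t)" for t
    using vector_diff_chain_at[of uminus "-1" t "mexp A" "A ** mexp A (- t)"]
      has_vector_derivative_mexp[of A "- t" UNIV]
      has_vector_derivative_minus[OF has_vector_derivative_id, of "at t"]
    by (simp add: o_def)
  have "((\<lambda>t. mexp A t ** mexp A (- t)) has_vector_derivative 0) (at t within UNIV)" for t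
    using bounded_bilinear.has_vector_derivative[OF bounded_bilinear_matrix_matrix_mult
        has_vector_derivative_mexp[of A t UNIV] neg[of t]]
    by (simp add: bounded_bilinear.minus_right[OF bounded_bilinear_matrix_matrix_mult]
        mexp_commute [of A t] matrix_mul_assoc)
  then obtain c where "\<And>t. mexp A t ** mexp A (- t) = c"
    using has_vector_derivative_zero_constant[of UNIV "\<lambda>t. mexp A t ** mexp A (- t)"] by auto
  from this[of t] this[of 0] show ?thesis by simp
qed

lemma continuous_on_mexp [continuous_intros]:
  assumes "continuous_on S f"
  shows "continuous_on S (\<lambda>x. mexp A (f x))"
proof -
  have "continuous_on UNIV (mexp A)"
    using has_vector_derivative_mexp has_vector_derivative_continuous
    by (metis continuous_at_imp_continuous_on)
  from continuous_on_compose2[OF this assms] show ?thesis by simp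
qed

lemmas continuous_on_matrix_vector_mult [continuous_intros] =
  bounded_bilinear.continuous_on[OF bounded_bilinear_matrix_vector_mult]

text \<open>Termwise: the pairing is a scalar series whose coefficients are the pairings with the
  powers. This carries the Kalman orthogonality from powers to the exponential.\<close>

lemma inner_mexp_eq_0:
  assumes "\<And>k. w \<bullet> (matpow A k *v y) = 0"
  shows "w \<bullet> (mexp A t *v y) = 0"
proof -
  have "w \<bullet> (mexp A t *v y)
      = (\<Sum>i\<in>UNIV. \<Sum>j\<in>UNIV. \<Sum>k. w $ i * (matpow A k $ i $ j / fact k * t ^ k) * y $ j)"
    unfolding inner_vec_def matrix_vector_mult_def mexp_def vec_lambda_beta inner_real_def
      sum_distrib_left
  proof (intro sum.cong refl)
    fix i j
    have "(\<Sum>k. w $ i * (matpow A k $ i $ j / fact k * t ^ k) * y $ j)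
        = (\<Sum>k. w $ i * (matpow A k $ i $ j / fact k * t ^ k)) * y $ j"
      by (intro suminf_mult2 [symmetric] summable_mult summable_mexp)
    then show "w $ i * ((\<Sum>k. matpow A k $ i $ j / fact k * t ^ k) * y $ j)
        = (\<Sum>k. w $ i * (matpow A k $ i $ j / fact k * t ^ k) * y $ j)"
      by (simp only: suminf_mult summable_mexp mult.assoc)
  qed
  also have "\<dots> = (\<Sum>k. \<Sum>i\<in>UNIV. \<Sum>j\<in>UNIV. w $ i * (matpow A k $ i $ j / fact k * t ^ k) * y $ j)"
    by (subst suminf_sum, intro summable_sum summable_mult2 summable_mult summable_mexp,
        intro sum.cong refl suminf_sum [symmetric] summable_mult2 summable_mult summable_mexp)
  also have "\<dots> = (\<Sum>k. w \<bullet> (matpow A k *v y) * (t ^ k / fact k))"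
    by (simp add: inner_vec_def matrix_vector_mult_def sum_distrib_left sum_distrib_right
        sum_divide_distrib field_simps)
  finally show ?thesis using assms by simp
qed

section \<open>The Kalman matrix\<close>

text \<open>Takes the role of the Cayley-Hamilton theorem. At most \<open>CARD('d)\<close> vectors
  are independent, so some iterate lies in the span of the preceding ones, and that span is then
  invariant under \<open>B\<close>.\<close>

lemma Krylov_span:
  fixes w :: "real^'d" and B :: "real^'d^'d"
  shows "matpow B m *v w \<in> span ((\<lambda>j. matpow B j *v w) ` {..<CARD('d)})"
proof -
  let ?S = "\<lambda>k. (\<lambda>j. matpow B j *v w) ` {..<k}"
  have ex: "\<exists>k\<le>CARD('d). matpow B k *v w \<in> span (?S k)"
  proof (rule ccontr)
    assume neg: "\<not> ?thesis"
    have "independent (?S k) \<and> card (?S k) = k" if "k \<le> Suc (CARD('d))" for k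
      using that
    proof (induction k)
      case (Suc k)
      then have "matpow B k *v w \<notin> span (?S k)" using neg by auto
      with Suc span_base[of "matpow B k *v w" "?S k"] show ?case
        by (auto simp: lessThan_Suc independent_insert)
    qed (simp add: independent_empty)
    from this[of "Suc (CARD('d))"] independent_bound[of "?S (Suc (CARD('d)))"]
    show False by simp
  qed
  then obtain k where k: "k \<le> CARD('d)" "matpow B k *v w \<in> span (?S k)" by blast
  have step: "B *v y \<in> span (?S k)" if "y \<in> span (?S k)" for y
    using that
  proof (induction rule: span_induct_alt)
    case base
    then show ?case by (simp add: span_zero)
  next
    case (step c x y)
    then obtain j where j: "j < k" "x = matpow B j *v w" by auto
    have "B *v x = matpow B (Suc j) *v w"
      by (simp add: j matpow_Suc matrix_vector_mul_assoc)
    \<comment> \<open>Only the last generator is mapped outside the list of generators, namely to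
      iterate \<open>k\<close>, which is known to lie in the span.\<close>
    then have "B *v x \<in> span (?S k)"
      using j(1) k(2) by (cases "Suc j = k") (auto intro!: span_base)
    then show ?case using step
      by (auto simp: matrix_vector_right_distrib matrix_vector_mult_scaleR intro!: span_add span_scale)
  qed
  have "matpow B m *v w \<in> span (?S k)"
  proof (induction m)
    case 0
    \<comment> \<open>For \<open>k = 0\<close> the span is trivial and \<open>k(2)\<close> says that
      \<open>w\<close> itself belongs to it.\<close>
    then show ?case using k(2) by (cases "k = 0") (auto intro!: span_base image_eqI[of _ _ 0])
  next
    case (Suc m)
    then show ?case using step[OF Suc] by (simp add: matpow_Suc matrix_vector_mul_assoc)
  qed
  then show ?thesis
    using span_mono[of "?S k" "?S (CARD('d))"] k(1) by (meson image_mono lessThan_subset_iff subsetD)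
qed

lemma transpose_matpow: "transpose (matpow A k) = matpow (transpose A) k"
  by (induction k) (simp_all add: matpow_Suc_right matrix_transpose_mul flip: matpow_Suc)

text \<open>The vector is taken orthogonal to the column space, which is proper. The columns cover
  only exponents below \<open>CARD('d)\<close>; after moving the powers onto \<open>w\<close> by
  transposition, the Krylov span of \<open>w\<close> under \<open>transpose A\<close> covers all
  others.\<close>

lemma rank_kalman_less:
  fixes A :: "real^'d^'d" and D :: "real^'n^'d"
  assumes "rank (kalman_matrix A D) \<noteq> CARD('d)"
  obtains w where "w \<noteq> 0" "\<And>k v. w \<bullet> (matpow A k *v (D *v v)) = 0"
proof -
  let ?K = "kalman_matrix A D"
  have ne: "range ((*v) ?K) \<noteq> UNIV"
    using assms by (simp add: full_rank_surjective)
  have sp: "span (range ((*v) ?K)) = range ((*v) ?K)"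
    by (simp add: linear_subspace_image span_eq_iff)
  have "span (range ((*v) ?K)) \<subset> span UNIV"
    unfolding sp span_UNIV by (rule psubsetI[OF subset_UNIV ne])
  from orthogonal_to_subspace_exists_gen[OF this] obtain w where
    w: "w \<noteq> 0" "\<And>y. y \<in> span (range ((*v) ?K)) \<Longrightarrow> orthogonal w y" by blast
  have low: "w \<bullet> (matpow A k *v (D *v v)) = 0" if k: "k < CARD('d)" for k v
  proof -
    have "to_nat_on (UNIV :: 'd set) ` UNIV = {..<CARD('d)}"
      by (rule bij_betw_imp_surj_on, rule to_nat_on_finite) simp
    with k have "k \<in> to_nat_on (UNIV :: 'd set) ` UNIV" by simp
    then obtain a :: 'd where a: "to_nat_on UNIV a = k" by (auto simp only:)
    \<comment> \<open>With \<open>v\<close> in the block of columns numbered \<open>k\<close> and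
      zero elsewhere, the Kalman matrix acts as \<open>matpow A k ** D\<close>.\<close>
    define y :: "real^('d \<times> 'n)" where "y = (\<chi> kj. if fst kj = a then v $ snd kj else 0)"
    have "(?K *v y) $ i = (matpow A k *v (D *v v)) $ i" for i
    proof -
      have "(?K *v y) $ i = (\<Sum>b\<in>UNIV. \<Sum>j\<in>UNIV.
          (matpow A (to_nat_on UNIV b) ** D) $ i $ j * (if b = a then v $ j else 0))"
        unfolding sum.cartesian_product UNIV_Times_UNIV
        unfolding matrix_vector_mult_def vec_lambda_beta
        by (intro sum.cong refl) (simp add: kalman_matrix_def y_def funpow_matrix_mult case_prod_unfold)
      also have "\<dots> = (\<Sum>b\<in>UNIV. if b = a then
          (\<Sum>j\<in>UNIV. (matpow A (to_nat_on UNIV b) ** D) $ i $ j * v $ j) else 0)"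
        by (intro sum.cong) auto
      also have "\<dots> = ((matpow A k ** D) *v v) $ i"
        by (simp add: a matrix_vector_mult_def)
      finally show ?thesis by (simp add: matrix_vector_mul_assoc)
    qed
    then have "?K *v y = matpow A k *v (D *v v)" by (simp add: vec_eq_iff)
    moreover have "orthogonal w (?K *v y)" by (intro w(2) span_base) simp
    ultimately show ?thesis by (simp only: orthogonal_def)
  qed
  have tr: "w \<bullet> (matpow A k *v z) = (matpow (transpose A) k *v w) \<bullet> z" for k z
    by (metis dot_lmul_matrix transpose_matpow transpose_matrix_vector)
  have "w \<bullet> (matpow A k *v (D *v v)) = 0" for k v
  proof -
    have "z \<bullet> (D *v v) = 0"
      if "z \<in> span ((\<lambda>j. matpow (transpose A) j *v w) ` {..<CARD('d)})" for z
      using that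
    proof (induction rule: span_induct_alt)
      case (step c x y)
      then obtain j where j: "j < CARD('d)" "x = matpow (transpose A) j *v w" by auto
      have "x \<bullet> (D *v v) = 0" unfolding j(2) tr [symmetric] by (rule low[OF j(1)])
      with step show ?case by (simp add: inner_add_left)
    qed simp
    from this[OF Krylov_span] show ?thesis by (simp add: tr)
  qed
  with w(1) show thesis by (rule that)
qed

section \<open>Positive semidefinite matrices\<close>

lemma pos_semidef_sym:
  assumes "pos_semidef S"
  shows "v \<bullet> (S *v w) = w \<bullet> (S *v v)"
  using assms dot_lmul_matrix[of v S w]
  by (metis inner_commute pos_semidef_def transpose_matrix_vector)

lemma pos_semidef_Cauchy_Schwarz:
  assumes S: "pos_semidef S"
  shows "(v \<bullet> (S *v w))\<^sup>2 \<le> (v \<bullet> (S *v v)) * (w \<bullet> (S *v w))"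
proof -
  have q: "0 \<le> v \<bullet> (S *v v) + 2 * c * (v \<bullet> (S *v w)) + c\<^sup>2 * (w \<bullet> (S *v w))" for c
  proof -
    have "0 \<le> (v + c *\<^sub>R w) \<bullet> (S *v (v + c *\<^sub>R w))" using S by (simp add: pos_semidef_def)
    then show ?thesis
      by (simp add: matrix_vector_right_distrib matrix_vector_mult_scaleR inner_add_left
          inner_add_right pos_semidef_sym[OF S, of w v] power2_eq_square algebra_simps)
  qed
  have w0: "0 \<le> w \<bullet> (S *v w)" using S by (simp add: pos_semidef_def)
  show ?thesis
  proof (cases "w \<bullet> (S *v w) = 0")
    case True
    have "v \<bullet> (S *v w) = 0"
    proof (rule ccontr)
      assume nz: "v \<bullet> (S *v w) \<noteq> 0"
      \<comment> \<open>Without quadratic term the polynomial is affine in \<open>c\<close>, and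
        this \<open>c\<close> gives it the value -1.\<close>
      from q[of "- (v \<bullet> (S *v v) + 1) / (2 * (v \<bullet> (S *v w)))"] True nz show False
        by (simp add: field_simps)
    qed
    with True show ?thesis by simp
  next
    case False
    with w0 have pos: "w \<bullet> (S *v w) > 0" by simp
    \<comment> \<open>The minimiser of the quadratic polynomial.\<close>
    from q[of "- (v \<bullet> (S *v w)) / (w \<bullet> (S *v w))"] pos
    have "0 \<le> v \<bullet> (S *v v) - (v \<bullet> (S *v w))\<^sup>2 / (w \<bullet> (S *v w))"
      by (simp add: power2_eq_square)
    with pos show ?thesis by (simp add: field_simps)
  qed
qed

text \<open>Rank-one deflation as in a Cholesky factorisation: a direction \<open>u\<close> of
  positive energy is removed by subtracting the scaled square of \<open>S *v u\<close>, whereupon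
  \<open>u\<close> joins the kernel. Hence the induction on the codimension of the kernel.\<close>

lemma pos_semidef_decompose:
  fixes S :: "real^'d^'d"
  assumes "pos_semidef S"
  shows "\<exists>(n::nat) \<sigma>. \<forall>v. v \<bullet> (S *v v) = (\<Sum>i<n. (v \<bullet> \<sigma> i)\<^sup>2)"
  using assms
proof (induction "CARD('d) - dim {v. S *v v = 0}" arbitrary: S rule: less_induct)
  case less
  note S = less.prems
  show ?case
  proof (cases "\<forall>v. v \<bullet> (S *v v) = 0")
    case True
    then show ?thesis by (intro exI[of _ 0]) simp
  next
    case False
    then obtain u where "u \<bullet> (S *v u) \<noteq> 0" by blast
    moreover have "0 \<le> u \<bullet> (S *v u)" using S by (simp add: pos_semidef_def)
    ultimately have pos: "u \<bullet> (S *v u) > 0" by simp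
    define r where "r = u \<bullet> (S *v u)"
    define a where "a = S *v u"
    define S' where "S' = (\<chi> i j. S $ i $ j - a $ i * a $ j / r)"
    have S'v: "S' *v v = S *v v - ((v \<bullet> a) / r) *\<^sub>R a" for v
      by (simp add: S'_def matrix_vector_mult_def vec_eq_iff inner_vec_def left_diff_distrib
          sum_subtractf sum_distrib_left sum_divide_distrib field_simps)
    have va: "v \<bullet> a = u \<bullet> (S *v v)" for v
      by (simp add: a_def pos_semidef_sym[OF S, of u v])
    have q: "v \<bullet> (S' *v v) = v \<bullet> (S *v v) - (v \<bullet> a)\<^sup>2 / r" for v
      by (simp add: S'v inner_diff_right power2_eq_square)
    have "transpose S' = S'"
      using S by (simp add: S'_def transpose_def vec_eq_iff pos_semidef_def mult.commute)
    \<comment> \<open>The Cauchy-Schwarz inequality for \<open>S\<close> says exactly that the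
      subtracted square does not exceed the energy.\<close>
    moreover have "0 \<le> v \<bullet> (S' *v v)" for v
      using pos_semidef_Cauchy_Schwarz[OF S, of v u] pos
      by (simp add: q a_def r_def field_simps)
    ultimately have S': "pos_semidef S'" by (simp add: pos_semidef_def)
    have sub: "subspace {v. B *v v = 0}" for B :: "real^'d^'d"
      by (simp add: subspace_def matrix_vector_right_distrib matrix_vector_mult_scaleR)
    have "{v. S *v v = 0} \<subset> {v. S' *v v = 0}"
    proof
      show "{v. S *v v = 0} \<subseteq> {v. S' *v v = 0}" by (auto simp: S'v va)
      have "S' *v u = 0" using pos by (simp add: S'v) (simp add: a_def r_def)
      moreover have "S *v u \<noteq> 0" using pos by auto
      ultimately show "{v. S *v v = 0} \<noteq> {v. S' *v v = 0}" by blast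
    qed
    then have "dim {v. S *v v = 0} < dim {v. S' *v v = 0}"
      by (intro dim_psubset) (simp add: span_eq_iff[THEN iffD2, OF sub])
    moreover have "dim {v. S' *v v = 0} \<le> CARD('d)"
      using dim_subset_UNIV[of "{v. S' *v v = 0}"] by simp
    ultimately have "CARD('d) - dim {v. S' *v v = 0} < CARD('d) - dim {v. S *v v = 0}" by simp
    from less.hyps[OF this S'] obtain n :: nat and \<sigma> where
      IH: "\<forall>v. v \<bullet> (S' *v v) = (\<Sum>i<n. (v \<bullet> \<sigma> i)\<^sup>2)" by (elim exE)
    have "v \<bullet> (S *v v) = (\<Sum>i<Suc n. (v \<bullet> (\<sigma>(n := a /\<^sub>R sqrt r)) i)\<^sup>2)" for v
    proof -
      have "(\<Sum>i<Suc n. (v \<bullet> (\<sigma>(n := a /\<^sub>R sqrt r)) i)\<^sup>2)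
          = (\<Sum>i<n. (v \<bullet> \<sigma> i)\<^sup>2) + (v \<bullet> a)\<^sup>2 / r"
        using pos by (simp add: power_divide power_mult_distrib r_def field_simps)
      also have "\<dots> = v \<bullet> (S *v v)" by (simp add: IH [rule_format, symmetric] q)
      finally show ?thesis by simp
    qed
    then show ?thesis by (intro exI[of _ "Suc n"] exI allI)
  qed
qed

section \<open>Uniqueness of characteristic functions on \<open>real^'d\<close>\<close>

text \<open>The coordinates are treated one at a time: exponential factors are replaced by indicators, the
  measure with density \<open>1 + Re F\<close> being positive, so that the one-dimensional uniqueness theorem
  applies to its image under a coordinate.\<close>

lemma indicator_char_eq_step:
  fixes M :: "'a measure" and N :: "'a measure" and X :: "'a \<Rightarrow> real" and F :: "'a \<Rightarrow> real"
  assumes M: "finite_measure M" and N: "finite_measure N" and sets: "sets M = sets N"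
    and X: "X \<in> borel_measurable M" and F: "F \<in> borel_measurable M" "\<And>x. \<bar>F x\<bar> \<le> 1"
    and eq1: "\<And>t. (CLINT x|M. iexp (t * X x)) = (CLINT x|N. iexp (t * X x))"
    and eqF: "\<And>t. (CLINT x|M. iexp (t * X x) * F x) = (CLINT x|N. iexp (t * X x) * F x)"
    and B: "B \<in> sets borel"
  shows "(LINT x|M. indicat_real B (X x) * F x) = (LINT x|N. indicat_real B (X x) * F x)"
proof -
  have X' [measurable]: "X \<in> borel_measurable M" "X \<in> borel_measurable N"
    and F' [measurable]: "F \<in> borel_measurable M" "F \<in> borel_measurable N"
    using X F(1) sets by (auto simp: measurable_cong_sets[OF sets refl])
  note B [measurable]
  \<comment> \<open>\<open>F\<close> may be negative and is therefore shifted: \<open>c = 1\<close>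
    gives the nonnegative density 1 + \<open>F\<close>, and \<open>c = 0\<close> the bare indicator
    that is subtracted at the end.\<close>
  have gen: "(LINT x|M. indicat_real B (X x) * (1 + c * F x)) = (LINT x|N. indicat_real B (X x) * (1 + c * F x))"
    if c: "c = 0 \<or> c = 1" for c
  proof -
    define G where "G x = 1 + c * F x" for x
    have G0: "0 \<le> G x" "G x \<le> 2" for x using F(2)[of x] c by (auto simp: G_def)
    have [measurable]: "G \<in> borel_measurable M" "G \<in> borel_measurable N"
      by (simp_all add: G_def [abs_def])
    have bdd: "integrable K (\<lambda>x. f x * G x)" if "finite_measure K" "f \<in> borel_measurable K"
      "G \<in> borel_measurable K" "\<And>x. norm (f x) \<le> 1" for K :: "'a measure" and f :: "'a \<Rightarrow> real"
      using that G0 mult_mono[of "\<bar>f _\<bar>" 1 "G _" 2]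
      by (intro finite_measure.integrable_const_bound[where B = 2]) (auto simp: abs_mult)
    have cint: "integrable K (\<lambda>x. iexp (t * X x) * F x)" "integrable K (\<lambda>x. iexp (t * X x))"
      if "finite_measure K" "X \<in> borel_measurable K" "F \<in> borel_measurable K" for K t
      using that F(2)
      by (auto intro!: finite_measure.integrable_const_bound[where B = 1] simp: norm_mult)
    have eqG: "(CLINT x|M. iexp (t * X x) * G x) = (CLINT x|N. iexp (t * X x) * G x)" for t
    proof -
      have "(CLINT x|K. iexp (t * X x) * G x) = (CLINT x|K. iexp (t * X x)) + c * (CLINT x|K. iexp (t * X x) * F x)"
        if "finite_measure K" "X \<in> borel_measurable K" "F \<in> borel_measurable K" for K
        using cint[OF that] by (simp add: G_def distrib_left algebra_simps)
      from this[OF M X'(1) F'(1)] this[OF N X'(2) F'(2)] show ?thesis by (simp only: eq1 eqF)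
    qed
    define m where "m = (LINT x|M. G x)"
    have iG: "integrable M G" "integrable N G"
      using bdd[of M "\<lambda>_. 1"] bdd[of N "\<lambda>_. 1"] M N by auto
    have m: "m = (LINT x|N. G x)"
    proof -
      have "complex_of_real m = complex_of_real (LINT x|N. G x)"
        using eqG[of 0] by (simp add: m_def integral_complex_of_real)
      then show ?thesis by (simp only: of_real_eq_iff)
    qed
    show ?thesis
    proof (cases "m = 0")
      \<comment> \<open>A density of total mass zero cannot be normalised, but it vanishes almost
        everywhere and both sides are 0.\<close>
      case True
      have "(LINT x|K. indicat_real B (X x) * G x) = 0"
        if K: "finite_measure K" "X \<in> borel_measurable K" "G \<in> borel_measurable K"
          and i: "integrable K G" and z: "(LINT x|K. G x) = 0" for K
      proof -
        have "AE x in K. G x = 0"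
          using integral_nonneg_eq_0_iff_AE[OF i] G0 z by simp
        then show ?thesis by (intro integral_eq_zero_AE) auto
      qed
      then show ?thesis using M N iG True m m_def by (simp flip: G_def)
    next
      case False
      moreover have "0 \<le> m" using G0 by (simp add: m_def)
      ultimately have mpos: "m > 0" by simp
      \<comment> \<open>The law of \<open>X\<close> under the normalised density. By
        \<open>eqG\<close> the characteristic functions for \<open>M\<close> and \<open>N\<close>
        agree, and Levy's uniqueness theorem on the line applies.\<close>
      define R where "R K = distr (density K (\<lambda>x. ennreal (G x / m))) borel X" for K
      have pr: "prob_space (density K (\<lambda>x. ennreal (G x / m)))"
        and rd: "real_distribution (R K)"
        and ch: "char (R K) t = (CLINT x|K. iexp (t * X x) * G x) / m"
        and me: "measure (R K) B = (LINT x|K. indicat_real B (X x) * G x) / m"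
        if K: "finite_measure K" "X \<in> borel_measurable K" "G \<in> borel_measurable K"
          and i: "integrable K G" and z: "(LINT x|K. G x) = m" for K t
      proof -
        note K(2,3) [measurable]
        have "emeasure (density K (\<lambda>x. ennreal (G x / m))) (space K) = (\<integral>\<^sup>+x. ennreal (G x / m) \<partial>K)"
          by (subst emeasure_density) (auto intro!: nn_integral_cong)
        also have "\<dots> = ennreal (LINT x|K. G x / m)"
          using i G0 mpos by (intro nn_integral_eq_integral) auto
        finally show pr: "prob_space (density K (\<lambda>x. ennreal (G x / m)))"
          using z mpos by (intro prob_spaceI) simp
        then show "real_distribution (R K)"
          unfolding R_def by (intro prob_space.real_distribution_distr) simp_all
        have "char (R K) t = (CLINT x|density K (\<lambda>x. ennreal (G x / m)). iexp (t * X x))"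
          by (simp add: char_def R_def integral_distr)
        also have "\<dots> = (CLINT x|K. (G x / m) *\<^sub>R iexp (t * X x))"
          using G0 mpos by (intro integral_density) auto
        also have "\<dots> = (CLINT x|K. (iexp (t * X x) * G x) / m)"
          by (intro Bochner_Integration.integral_cong refl) (simp add: scaleR_conv_of_real)
        finally show "char (R K) t = (CLINT x|K. iexp (t * X x) * G x) / m" by simp
        have "measure (R K) B = (LINT x|R K. indicator B x)"
          by (simp add: R_def)
        also have "\<dots> = (LINT x|density K (\<lambda>x. ennreal (G x / m)). indicator B (X x))"
          unfolding R_def by (intro integral_distr) auto
        also have "\<dots> = (LINT x|K. (G x / m) *\<^sub>R indicator B (X x))"
          using G0 mpos by (intro integral_density) auto
        also have "\<dots> = (LINT x|K. (indicat_real B (X x) * G x) / m)"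
          by (intro Bochner_Integration.integral_cong refl) simp
        finally show "measure (R K) B = (LINT x|K. indicat_real B (X x) * G x) / m" by simp
      qed
      have "R M = R N"
        using M N iG m m_def eqG by (intro Levy_uniqueness rd ext) (simp_all add: ch)
      then have "measure (R M) B = measure (R N) B" by simp
      then show ?thesis
        using M N iG m m_def mpos by (simp add: me flip: G_def)
    qed
  qed
  have int: "integrable K (\<lambda>x. indicat_real B (X x) * F x)" "integrable K (\<lambda>x. indicat_real B (X x))"
      if "finite_measure K" "X \<in> borel_measurable K" "F \<in> borel_measurable K" for K
      using that F(2)
      by (auto intro!: finite_measure.integrable_const_bound[where B = 1] simp: abs_mult
          split: split_indicator)
  have "(LINT x|K. indicat_real B (X x) * (1 + 1 * F x))
      = (LINT x|K. indicat_real B (X x) * (1 + 0 * F x)) + (LINT x|K. indicat_real B (X x) * F x)"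
    if "finite_measure K" "X \<in> borel_measurable K" "F \<in> borel_measurable K" for K
    using int[OF that] by (simp add: distrib_left)
  from this[of M] this[of N] gen[of 0] gen[of 1] M N show ?thesis by simp
qed

lemma char_unique_vec:
  fixes \<mu> \<nu> :: "(real^'d) measure"
  assumes \<mu>: "prob_space \<mu>" "sets \<mu> = sets borel" and \<nu>: "prob_space \<nu>" "sets \<nu> = sets borel"
    and char: "\<And>v. (CLINT y|\<mu>. iexp (v \<bullet> y)) = (CLINT y|\<nu>. iexp (v \<bullet> y))"
  shows "\<mu> = \<nu>"
proof -
  have fin: "finite_measure \<mu>" "finite_measure \<nu>"
    using \<mu>(1) \<nu>(1) by (simp_all add: prob_space_def)
  have [measurable_cong]: "sets \<mu> = sets borel" "sets \<nu> = sets borel" by fact+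
  \<comment> \<open>All frequencies \<open>v\<close> are treated together, since adjoining a
    coordinate uses the induction hypothesis at shifted frequencies.\<close>
  have step: "(CLINT y|\<mu>. (\<Prod>j\<in>J. indicat_real (A j) (y $ j)) * iexp (v \<bullet> y))
      = (CLINT y|\<nu>. (\<Prod>j\<in>J. indicat_real (A j) (y $ j)) * iexp (v \<bullet> y))"
    if "finite J" "\<And>j. A j \<in> sets borel" for J :: "'d set" and A v
    using that
  proof (induction J arbitrary: v)
    case empty
    then show ?case by (simp add: char)
  next
    case (insert j J)
    note insert.prems [measurable]
    define P where "P y = (\<Prod>j\<in>J. indicat_real (A j) (y $ j))" for y
    have P: "P y = 0 \<or> P y = 1" for y :: "real^'d"
      unfolding P_def using insert.hyps(1) by (induction J) (auto split: split_indicator)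
    have Pm [measurable]: "P \<in> borel_measurable borel"
      unfolding P_def by measurable
    have IH: "(CLINT y|\<mu>. P y * iexp (v \<bullet> y)) = (CLINT y|\<nu>. P y * iexp (v \<bullet> y))" for v
      unfolding P_def by (rule insert.IH) (simp add: insert.prems)
    have ci: "integrable K (\<lambda>y. P y * iexp (v \<bullet> y) * iexp (w \<bullet> y))" "integrable K (\<lambda>y. P y * iexp (v \<bullet> y))"
      if "finite_measure K" "sets K = sets borel" for K v w
      using that P[of _]
      by (auto intro!: finite_measure.integrable_const_bound[where B = 1] AE_I2 simp: norm_mult
          measurable_cong_sets[of K borel]) (metis abs_1 abs_zero order_refl zero_le_one)+
    \<comment> \<open>The one-dimensional step needs a real factor: \<open>c = 1\<close> yields the
      real part and \<open>c = - \<i>\<close> the imaginary part of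
      \<open>P y * iexp (v \<bullet> y)\<close>.\<close>
    define F where "F c y = Re (c * P y * iexp (v \<bullet> y))" for c :: complex and y
    have F: "\<bar>F c y\<bar> \<le> 1" if "norm c = 1" for c y
      using abs_Re_le_cmod[of "c * P y * iexp (v \<bullet> y)"] P[of y] that
      by (auto simp: F_def norm_mult)
    have Fm [measurable]: "F c \<in> borel_measurable borel" for c
      unfolding F_def by measurable
    \<comment> \<open>A real part is half the sum of a number and its conjugate, so the product
      splits into exponentials at the frequencies \<open>v + t *\<^sub>R axis j 1\<close> and
      \<open>- v + t *\<^sub>R axis j 1\<close>.\<close>
    have eqF: "(CLINT y|\<mu>. iexp (t * (y $ j)) * F c y) = (CLINT y|\<nu>. iexp (t * (y $ j)) * F c y)" for c t
    proof -
      have "(CLINT y|K. iexp (t * (y $ j)) * F c y)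
        = (c * (CLINT y|K. P y * iexp ((v + t *\<^sub>R axis j 1) \<bullet> y))
           + cnj c * (CLINT y|K. P y * iexp ((- v + t *\<^sub>R axis j 1) \<bullet> y))) / 2"
        if K: "finite_measure K" "sets K = sets borel" for K
      proof -
        have pt: "iexp (t * (y $ j)) * F c y
          = (c * (P y * iexp ((v + t *\<^sub>R axis j 1) \<bullet> y)) + cnj c * (P y * iexp ((- v + t *\<^sub>R axis j 1) \<bullet> y))) / 2" for y
        proof -
          have "complex_of_real (F c y) = (c * P y * iexp (v \<bullet> y) + cnj (c * P y * iexp (v \<bullet> y))) / 2"
            unfolding F_def complex_add_cnj by simp
          also have "cnj (c * P y * iexp (v \<bullet> y)) = cnj c * P y * iexp (- (v \<bullet> y))"
            by (simp add: exp_cnj)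
          finally have F: "complex_of_real (F c y)
              = (c * P y * iexp (v \<bullet> y) + cnj c * P y * iexp (- (v \<bullet> y))) / 2" .
          have e: "iexp ((v + t *\<^sub>R axis j 1) \<bullet> y) = iexp (v \<bullet> y) * iexp (t * (y $ j))"
            "iexp ((- v + t *\<^sub>R axis j 1) \<bullet> y) = iexp (- (v \<bullet> y)) * iexp (t * (y $ j))"
            unfolding inner_add_left inner_scaleR_left inner_minus_left
            by (simp_all add: inner_axis' exp_add exp_diff exp_minus field_simps)
          show ?thesis unfolding F e by (simp add: algebra_simps add_divide_distrib)
        qed
        have i: "integrable K (\<lambda>y. a * (P y * iexp (u \<bullet> y)))" for a :: complex and u
          by (intro integrable_mult_right ci(2)[OF K])
        show ?thesis
          unfolding pt integral_divide_zero Bochner_Integration.integral_add[OF i i]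
            integral_mult_right_zero ..
      qed
      from this[OF fin(1) \<mu>(2)] this[OF fin(2) \<nu>(2)] show ?thesis by (simp only: IH)
    qed
    have eq1: "(CLINT y|\<mu>. iexp (t * (y $ j))) = (CLINT y|\<nu>. iexp (t * (y $ j)))" for t
      using char[of "t *\<^sub>R axis j 1"] by (simp add: inner_axis')
    have eqR: "(LINT y|\<mu>. indicat_real (A j) (y $ j) * F c y) = (LINT y|\<nu>. indicat_real (A j) (y $ j) * F c y)"
      if "norm c = 1" for c
      using \<mu> \<nu> fin F[OF that] insert.prems
      by (intro indicator_char_eq_step eq1 eqF) (auto simp: measurable_cong_sets[of \<mu> borel])
    have "(CLINT y|K. indicat_real (A j) (y $ j) * (P y * iexp (v \<bullet> y)))
       = Complex (LINT y|K. indicat_real (A j) (y $ j) * F 1 y) (LINT y|K. indicat_real (A j) (y $ j) * F (- \<i>) y)"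
      if K: "finite_measure K" "sets K = sets borel" for K
    proof -
      have i: "integrable K (\<lambda>y. indicat_real (A j) (y $ j) * (P y * iexp (v \<bullet> y)))"
        using K P[of _]
        by (auto intro!: finite_measure.integrable_const_bound[where B = 1] AE_I2 simp: norm_mult
          measurable_cong_sets[of K borel] split: split_indicator) (metis abs_1 abs_zero order_refl zero_le_one)+
      show ?thesis
        using integral_Re[OF i] integral_Im[OF i]
        by (intro complex_eqI) (simp_all add: F_def)
    qed
    then have "(CLINT y|\<mu>. indicat_real (A j) (y $ j) * (P y * iexp (v \<bullet> y)))
      = (CLINT y|\<nu>. indicat_real (A j) (y $ j) * (P y * iexp (v \<bullet> y)))"
      using fin \<mu> \<nu> by (simp add: eqR)
    then show ?case using insert.hyps by (simp add: P_def mult.assoc)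
  qed
  \<comment> \<open>With every coordinate restricted by an indicator and frequency 0, the identity
    compares box probabilities.\<close>
  have box: "emeasure \<mu> (box a b) = emeasure \<nu> (box a b)" for a b
  proof -
    have "measure K (box a b) = Re (CLINT y|K. (\<Prod>j\<in>UNIV. indicat_real {a $ j<..<b $ j} (y $ j)) * iexp (0 \<bullet> y))"
      if K: "sets K = sets borel" for K :: "(real^'d) measure"
    proof -
      have ind: "(\<Prod>j\<in>UNIV. indicat_real {a $ j<..<b $ j} (y $ j)) = indicat_real (box a b) y" for y
        by (auto simp: mem_box_cart split: split_indicator)
      have "(CLINT y|K. (\<Prod>j\<in>UNIV. indicat_real {a $ j<..<b $ j} (y $ j)) * iexp (0 \<bullet> y))
         = complex_of_real (LINT y|K. indicat_real (box a b) y)"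
        unfolding ind by (simp add: integral_complex_of_real)
      then show ?thesis using K sets_eq_imp_space_eq[OF K] by simp
    qed
    from this[of \<mu>] this[of \<nu>] step[of UNIV "\<lambda>j. {a $ j<..<b $ j}" 0] show ?thesis
      using fin by (simp add: \<mu> \<nu> finite_measure.emeasure_eq_measure)
  qed
  show ?thesis
  proof (rule measure_eqI_generator_eq[where E = "range (\<lambda>(a, b). box a b)" and \<Omega> = UNIV
        and A = "\<lambda>n. box (- real n *\<^sub>R One) (real n *\<^sub>R One)"])
    show "Int_stable (range (\<lambda>(a, b). box a b :: (real^'d) set))"
      by (auto simp: Int_stable_def Int_interval box_Int_box)
    have "sets borel = sigma_sets UNIV (range (\<lambda>(a, b). box a b :: (real^'d) set))"
      by (subst borel_eq_box) simp
    then show "sets \<mu> = sigma_sets UNIV (range (\<lambda>(a, b). box a b))"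
      "sets \<nu> = sigma_sets UNIV (range (\<lambda>(a, b). box a b))"
      using \<mu> \<nu> by auto
    show "emeasure \<mu> (box (- real n *\<^sub>R One) (real n *\<^sub>R One)) \<noteq> \<infinity>" for n
      using fin(1) by (simp add: finite_measure.emeasure_finite)
    show "(\<Union>n. box (- real n *\<^sub>R One) (real n *\<^sub>R One)) = (UNIV :: (real^'d) set)"
      using UN_box_eq_UNIV by simp
  qed (auto simp: box)
qed

section \<open>Square integrable functions\<close>

definition sq_integrable :: "'a measure \<Rightarrow> ('a \<Rightarrow> 'b::euclidean_space) \<Rightarrow> bool" where
  "sq_integrable M f \<longleftrightarrow> f \<in> borel_measurable M \<and> integrable M (\<lambda>x. (norm (f x))\<^sup>2)"

lemma norm_add_square_le:
  fixes a b :: "'b::real_normed_vector"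
  shows "(norm (a + b))\<^sup>2 \<le> 2 * (norm a)\<^sup>2 + 2 * (norm b)\<^sup>2"
proof -
  have "(norm (a + b))\<^sup>2 \<le> (norm a + norm b)\<^sup>2"
    by (simp add: norm_triangle_ineq power_mono)
  also have "\<dots> \<le> 2 * (norm a)\<^sup>2 + 2 * (norm b)\<^sup>2"
    using zero_le_power2[of "norm a - norm b"] by (simp add: power2_eq_square algebra_simps)
  finally show ?thesis .
qed

lemma sq_integrable_add:
  assumes "sq_integrable M f" "sq_integrable M g"
  shows "sq_integrable M (\<lambda>x. f x + g x)"
  unfolding sq_integrable_def
proof
  have [measurable]: "f \<in> borel_measurable M" "g \<in> borel_measurable M"
    using assms by (auto simp: sq_integrable_def)
  show "(\<lambda>x. f x + g x) \<in> borel_measurable M" by measurable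
  show "integrable M (\<lambda>x. (norm (f x + g x))\<^sup>2)"
  proof (rule Bochner_Integration.integrable_bound)
    show "integrable M (\<lambda>x. 2 * (norm (f x))\<^sup>2 + 2 * (norm (g x))\<^sup>2)"
      using assms by (auto simp: sq_integrable_def)
  qed (use norm_add_square_le in auto)
qed

lemma sq_integrable_0 [simp]: "sq_integrable M (\<lambda>x. 0)"
  by (simp add: sq_integrable_def)

lemma sq_integrable_sum:
  "(\<And>i. i \<in> I \<Longrightarrow> sq_integrable M (f i)) \<Longrightarrow> sq_integrable M (\<lambda>x. \<Sum>i\<in>I. f i x)"
  by (induction I rule: infinite_finite_induct) (auto intro: sq_integrable_add)

lemma sq_integrable_scaleR: "sq_integrable M f \<Longrightarrow> sq_integrable M (\<lambda>x. c *\<^sub>R f x)"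
  by (auto simp: sq_integrable_def power_mult_distrib)

lemma sq_integrable_minus: "sq_integrable M f \<Longrightarrow> sq_integrable M (\<lambda>x. - f x)"
  by (auto simp: sq_integrable_def)

lemma sq_integrable_diff:
  "sq_integrable M f \<Longrightarrow> sq_integrable M g \<Longrightarrow> sq_integrable M (\<lambda>x. f x - g x)"
  using sq_integrable_add[of M f "\<lambda>x. - g x"] by (simp add: sq_integrable_minus)

lemma sq_integrable_inner:
  assumes "sq_integrable M f" "sq_integrable M g"
  shows "integrable M (\<lambda>x. f x \<bullet> g x)"
proof (rule Bochner_Integration.integrable_bound)
  have [measurable]: "f \<in> borel_measurable M" "g \<in> borel_measurable M"
    using assms by (auto simp: sq_integrable_def)
  show "integrable M (\<lambda>x. (norm (f x))\<^sup>2 + (norm (g x))\<^sup>2)"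
    using assms by (auto simp: sq_integrable_def)
  show "(\<lambda>x. f x \<bullet> g x) \<in> borel_measurable M" by measurable
  have "\<bar>f x \<bullet> g x\<bar> \<le> (norm (f x))\<^sup>2 + (norm (g x))\<^sup>2" for x
  proof -
    have "\<bar>f x \<bullet> g x\<bar> \<le> norm (f x) * norm (g x)" by (rule Cauchy_Schwarz_ineq2)
    moreover have "2 * (norm (f x) * norm (g x)) \<le> (norm (f x))\<^sup>2 + (norm (g x))\<^sup>2"
      using zero_le_power2[of "norm (f x) - norm (g x)"] by (simp add: power2_eq_square algebra_simps)
    moreover have "0 \<le> norm (f x) * norm (g x)" by simp
    ultimately show ?thesis by linarith
  qed
  then show "AE x in M. norm (f x \<bullet> g x) \<le> norm ((norm (f x))\<^sup>2 + (norm (g x))\<^sup>2)" by simp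
qed

lemma (in finite_measure) sq_integrable_bounded:
  assumes "f \<in> borel_measurable M" "\<And>x. x \<in> space M \<Longrightarrow> norm (f x) \<le> K"
  shows "sq_integrable M f"
proof -
  have "AE x in M. norm ((norm (f x))\<^sup>2) \<le> K\<^sup>2"
    using assms(2) by (intro AE_I2) (simp add: power_mono)
  then show ?thesis
    using assms(1) integrable_const_bound[of "\<lambda>x. (norm (f x))\<^sup>2" "K\<^sup>2"]
    by (simp add: sq_integrable_def)
qed

lemma (in finite_measure) sq_integrable_integrable:
  assumes "sq_integrable M f"
  shows "integrable M f"
proof (rule Bochner_Integration.integrable_bound)
  show "integrable M (\<lambda>x. 1 + (norm (f x))\<^sup>2)"
    using assms by (auto simp: sq_integrable_def)
  have "norm (f x) \<le> 1 + (norm (f x))\<^sup>2" for x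
    using zero_le_power2[of "norm (f x) - 1 / 2"] by (simp add: power2_eq_square algebra_simps)
  then show "AE x in M. norm (f x) \<le> norm (1 + (norm (f x))\<^sup>2)" by simp
qed (use assms in \<open>auto simp: sq_integrable_def\<close>)

lemma sq_integrable_indicator:
  "A \<in> sets M \<Longrightarrow> emeasure M A < \<infinity> \<Longrightarrow> sq_integrable M (indicat_real A)"
  by (auto simp: sq_integrable_def power2_eq_square indicator_inter_arith [symmetric])

section \<open>Brownian motion\<close>

locale brownian = prob_space M for M :: "'a measure" +
  fixes F0 :: "'a measure" and W :: "real \<Rightarrow> 'a \<Rightarrow> real"
  assumes bm: "brownian_motion M W" and F0: "subalgebra M F0"
    and F0_indep: "independent_of_process M F0 W"
begin

abbreviation Filt :: "real \<Rightarrow> 'a measure" where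
  "Filt \<equiv> brownian_filtration M F0 W"

lemma measurable_W [measurable]: "0 \<le> t \<Longrightarrow> W t \<in> borel_measurable M"
  using bm by (simp add: brownian_motion_def)

lemma W_0: "AE \<omega> in M. W 0 \<omega> = 0"
  using bm by (simp add: brownian_motion_def)

lemma continuous_W: "AE \<omega> in M. continuous_on {0..} (\<lambda>t. W t \<omega>)"
  using bm by (simp add: brownian_motion_def)

lemma preimage_W: "0 \<le> t \<Longrightarrow> B \<in> sets borel \<Longrightarrow> W t -` B \<inter> space M \<in> sets M"
  by (rule measurable_sets[OF measurable_W])

lemma Filt_generator:
  "sets F0 \<union> {W s -` B \<inter> space M | s B. 0 \<le> s \<and> s \<le> t \<and> B \<in> sets borel} \<union> null_sets M \<subseteq> sets M"
  using F0 preimage_W by (auto simp: subalgebra_def)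

lemma space_Filt [simp]: "space (Filt t) = space M"
  by (simp add: brownian_filtration_def space_measure_of_conv)

lemma sets_Filt: "sets (Filt t) = sigma_sets (space M)
    (sets F0 \<union> {W s -` B \<inter> space M | s B. 0 \<le> s \<and> s \<le> t \<and> B \<in> sets borel} \<union> null_sets M)"
  unfolding brownian_filtration_def
  using Filt_generator sets.space_closed by (intro sets_measure_of) blast

lemma subalgebra_Filt: "subalgebra M (Filt t)"
  unfolding subalgebra_def sets_Filt using Filt_generator
  by (auto intro!: sets.sigma_sets_subset)

lemma measurable_Filt: "f \<in> measurable (Filt t) N \<Longrightarrow> f \<in> measurable M N"
  by (rule measurable_from_subalg[OF subalgebra_Filt])

lemma sets_Filt_mono: "s \<le> t \<Longrightarrow> sets (Filt s) \<subseteq> sets (Filt t)"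
  unfolding sets_Filt by (intro sigma_sets_mono') (auto intro: order_trans)

lemma measurable_Filt_mono: "f \<in> measurable (Filt s) N \<Longrightarrow> s \<le> t \<Longrightarrow> f \<in> measurable (Filt t) N"
  using sets_Filt_mono[of s t] by (auto simp: measurable_def)

lemma measurable_W_Filt: "0 \<le> s \<Longrightarrow> s \<le> t \<Longrightarrow> W s \<in> borel_measurable (Filt t)"
  by (intro measurableI) (auto simp: sets_Filt intro!: sigma_sets.Basic)

lemma null_sets_Filt: "N \<in> null_sets M \<Longrightarrow> N \<in> sets (Filt t)"
  by (auto simp: sets_Filt)

section \<open>Independence of increments from the enriched filtration\<close>

lemma sigma_sets_increment_subset:
  assumes "0 \<le> s" "0 \<le> t"
  shows "sigma_sets (space M) {(\<lambda>\<omega>. W t \<omega> - W s \<omega>) -` B \<inter> space M | B. B \<in> sets borel}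
    \<subseteq> sigma_sets (space M) {W s -` B \<inter> space M | s B. 0 \<le> s \<and> B \<in> sets borel}"
proof -
  define N where "N = sigma (space M) {W s -` B \<inter> space M | s B. 0 \<le> s \<and> B \<in> sets borel}"
  have N: "sets N = sigma_sets (space M) {W s -` B \<inter> space M | s B. 0 \<le> s \<and> B \<in> sets borel}"
    "space N = space M"
    unfolding N_def by (auto simp: space_measure_of_conv intro!: sets_measure_of)
  have [measurable]: "W r \<in> borel_measurable N" if "0 \<le> r" for r
    using that by (intro measurableI) (auto simp: N intro!: sigma_sets.Basic)
  have "(\<lambda>\<omega>. W t \<omega> - W s \<omega>) \<in> borel_measurable N" using assms by measurable
  from measurable_sets[OF this] have "sigma_sets (space N)
      {(\<lambda>\<omega>. W t \<omega> - W s \<omega>) -` B \<inter> space N | B. B \<in> sets borel} \<subseteq> sets N"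
    by (intro sets.sigma_sets_subset) auto
  then show ?thesis by (simp only: N)
qed

text \<open>Independence is checked on \<open>E\<close>, a generator of \<open>Filt s\<close> stable
  under intersection: rectangles of \<open>F0\<close> with the past of \<open>W\<close>, and the
  null sets, which are independent of everything.\<close>

lemma indep_increment:
  assumes st: "0 \<le> s" "s < t"
  shows "indep_set (sets (Filt s))
    (sigma_sets (space M) {(\<lambda>\<omega>. W t \<omega> - W s \<omega>) -` B \<inter> space M | B. B \<in> sets borel})"
proof -
  let ?P = "sigma_sets (space M) {W r -` B \<inter> space M | r B. 0 \<le> r \<and> r \<le> s \<and> B \<in> sets borel}"
  let ?All = "sigma_sets (space M) {W r -` B \<inter> space M | r B. 0 \<le> r \<and> B \<in> sets borel}"
  let ?I0 = "{(\<lambda>\<omega>. W t \<omega> - W s \<omega>) -` B \<inter> space M | B. B \<in> sets borel}"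
  let ?I = "sigma_sets (space M) ?I0"
  define E where "E = {a \<inter> b | a b. a \<in> sets F0 \<and> b \<in> ?P} \<union> null_sets M"
  have PI: "indep_set ?I ?P"
    using bm st by (simp add: brownian_motion_def)
  have FA: "indep_set (sets F0) ?All"
    using F0_indep by (simp add: independent_of_process_def)
  have P_All: "?P \<subseteq> ?All" by (intro sigma_sets_mono') auto
  have I_All: "?I \<subseteq> ?All" using st by (intro sigma_sets_increment_subset) auto
  have F0M: "sets F0 \<subseteq> sets M" "space F0 = space M" using F0 by (auto simp: subalgebra_def)
  have PM: "?P \<subseteq> sets M" and IM: "?I \<subseteq> sets M" using PI by (auto simp: indep_sets2_eq)
  have AllInt: "b \<inter> c \<in> ?All" if "b \<in> ?All" "c \<in> ?All" for b c
  proof -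
    interpret A: sigma_algebra "space M" ?All
      by (rule sigma_algebra_sigma_sets) auto
    show ?thesis using that by (rule A.Int)
  qed
  have PInt: "b \<inter> c \<in> ?P" if "b \<in> ?P" "c \<in> ?P" for b c
  proof -
    interpret A: sigma_algebra "space M" ?P
      by (rule sigma_algebra_sigma_sets) auto
    show ?thesis using that by (rule A.Int)
  qed
  have EM: "E \<subseteq> sets M" using F0M PM by (auto simp: E_def)
  have "indep_set E ?I"
    unfolding indep_sets2_eq
  proof (intro conjI ballI EM IM)
    fix e c assume e: "e \<in> E" and c: "c \<in> ?I"
    show "prob (e \<inter> c) = prob e * prob c"
    proof (cases "e \<in> null_sets M")
      case True
      then have "e \<inter> c \<in> null_sets M"
        using c IM by (intro null_set_Int2) auto
      with True show ?thesis by (simp add: measure_eq_0_null_sets)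
    next
      case False
      with e obtain a b where ab: "e = a \<inter> b" "a \<in> sets F0" "b \<in> ?P" by (auto simp: E_def)
      \<comment> \<open>\<open>F0\<close> is split off first, being independent of the whole path;
        only then are past and increment separated.\<close>
      have "b \<in> ?All" "c \<in> ?All" using ab(3) c P_All I_All by blast+
      then have "prob (a \<inter> (b \<inter> c)) = prob a * prob (b \<inter> c)"
        by (intro indep_setD[OF FA ab(2)] AllInt)
      also have "prob (b \<inter> c) = prob b * prob c"
        using indep_setD[OF PI c ab(3)] by (simp only: Int_commute mult.commute)
      also have "prob a * (prob b * prob c) = prob (a \<inter> b) * prob c"
        unfolding indep_setD[OF FA ab(2) \<open>b \<in> ?All\<close>] by simp
      finally show ?thesis by (simp add: ab Int_assoc)
    qed
  qed
  moreover have "Int_stable E"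
  proof (rule Int_stableI)
    fix e f assume ef: "e \<in> E" "f \<in> E"
    then have efM: "e \<in> sets M" "f \<in> sets M" using EM by auto
    show "e \<inter> f \<in> E"
    proof (cases "e \<in> null_sets M \<or> f \<in> null_sets M")
      case True
      then have "e \<inter> f \<in> null_sets M" using efM by (auto intro: null_set_Int1 null_set_Int2)
      then show ?thesis by (simp add: E_def)
    next
      case False
      with ef obtain a b a' b' where "e = a \<inter> b" "a \<in> sets F0" "b \<in> ?P"
        "f = a' \<inter> b'" "a' \<in> sets F0" "b' \<in> ?P" by (auto simp: E_def)
      then have "e \<inter> f = (a \<inter> a') \<inter> (b \<inter> b')" "a \<inter> a' \<in> sets F0" "b \<inter> b' \<in> ?P"
        using PInt by auto
      then show ?thesis unfolding E_def by blast
    qed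
  qed
  moreover have "Int_stable ?I"
  proof -
    interpret A: sigma_algebra "space M" ?I
      by (rule sigma_algebra_sigma_sets) auto
    show ?thesis by (intro Int_stableI A.Int)
  qed
  ultimately have "indep_set (sigma_sets (space M) E) (sigma_sets (space M) ?I)"
    by (rule indep_set_sigma_sets)
  moreover have "sets (Filt s) \<subseteq> sigma_sets (space M) E"
    unfolding sets_Filt
  proof (intro sigma_sets_mono Un_least subsetI)
    fix a assume a: "a \<in> sets F0"
    then have "a = a \<inter> space M" using F0M sets.sets_into_space by blast
    moreover have "space M \<in> ?P" by (rule sigma_sets_top)
    ultimately have "a \<in> E" using a unfolding E_def by blast
    then show "a \<in> sigma_sets (space M) E" by (rule sigma_sets.Basic)

  next
    fix b assume "b \<in> {W r -` B \<inter> space M | r B. 0 \<le> r \<and> r \<le> s \<and> B \<in> sets borel}"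
    then have b: "b \<in> ?P" by (rule sigma_sets.Basic)
    then have "b = space M \<inter> b" using PM sets.sets_into_space by blast
    moreover have "space M \<in> sets F0" using F0M(2) sets.top[of F0] by simp
    ultimately have "b \<in> E" using b unfolding E_def by blast
    then show "b \<in> sigma_sets (space M) E" by (rule sigma_sets.Basic)
  next
    fix a assume "a \<in> null_sets M"
    then show "a \<in> sigma_sets (space M) E" by (auto simp: E_def)
  qed
  ultimately show ?thesis
    using sigma_sets.Basic[of _ ?I "space M"] unfolding indep_sets2_eq by (meson subset_iff)
qed

lemma indep_var_increment:
  assumes st: "0 \<le> s" "s < t" and Y: "Y \<in> borel_measurable (Filt s)"
    and g [measurable]: "g \<in> borel_measurable borel"
  shows "indep_var borel Y borel (\<lambda>\<omega>. g (W t \<omega> - W s \<omega>))"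
proof -
  let ?I0 = "{(\<lambda>\<omega>. W t \<omega> - W s \<omega>) -` B \<inter> space M | B. B \<in> sets borel}"
  have [measurable]: "W s \<in> borel_measurable M" "W t \<in> borel_measurable M" using st by auto
  have 1: "sigma_sets (space M) {Y -` A \<inter> space M |A. A \<in> sets borel} \<subseteq> sets (Filt s)"
    using measurable_sets[OF Y] by (intro sets.sigma_sets_subset[of _ "Filt s", simplified]) auto
  have 2: "sigma_sets (space M) {(\<lambda>\<omega>. g (W t \<omega> - W s \<omega>)) -` A \<inter> space M |A. A \<in> sets borel}
      \<subseteq> sigma_sets (space M) ?I0"
  proof (intro sigma_sets_mono' subsetI)
    fix x assume "x \<in> {(\<lambda>\<omega>. g (W t \<omega> - W s \<omega>)) -` A \<inter> space M |A. A \<in> sets borel}"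
    then obtain A where A: "A \<in> sets borel" "x = (\<lambda>\<omega>. g (W t \<omega> - W s \<omega>)) -` A \<inter> space M" by blast
    then have "x = (\<lambda>\<omega>. W t \<omega> - W s \<omega>) -` (g -` A) \<inter> space M" by auto
    moreover have "g -` A \<in> sets borel" using measurable_sets[OF g A(1)] by simp
    ultimately show "x \<in> ?I0" by blast
  qed
  have Ym [measurable]: "Y \<in> borel_measurable M" using Y by (rule measurable_Filt)
  show ?thesis
    unfolding indep_var_eq
  proof (intro conjI)
    show "random_variable borel (\<lambda>\<omega>. g (W t \<omega> - W s \<omega>))" by measurable
    show "indep_set (sigma_sets (space M) {Y -` A \<inter> space M |A. A \<in> sets borel})
     (sigma_sets (space M) {(\<lambda>\<omega>. g (W t \<omega> - W s \<omega>)) -` A \<inter> space M |A. A \<in> sets borel})"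
      using indep_increment[OF st] 1 2 unfolding indep_sets2_eq by blast
  qed fact
qed

section \<open>Moments and joint characteristic functions of Brownian motion\<close>

lemma increment:
  assumes st: "0 \<le> s" "s < t"
  shows increment_sq_integrable: "sq_integrable M (\<lambda>\<omega>. W t \<omega> - W s \<omega>)"
    and increment_mean: "expectation (\<lambda>\<omega>. W t \<omega> - W s \<omega>) = 0"
    and increment_square: "expectation (\<lambda>\<omega>. (W t \<omega> - W s \<omega>)\<^sup>2) = t - s"
    and increment_char: "(CLINT \<omega>|M. iexp (c * (W t \<omega> - W s \<omega>))) = exp (- (c\<^sup>2 * (t - s)) / 2)"
proof -
  have [measurable]: "W s \<in> borel_measurable M" "W t \<in> borel_measurable M" using st by auto
  let ?\<sigma> = "sqrt (t - s)"
  have \<sigma>: "0 < ?\<sigma>" using st by simp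
  have D: "distributed M lborel (\<lambda>\<omega>. W t \<omega> - W s \<omega>) (normal_density 0 ?\<sigma>)"
    using bm st by (simp add: brownian_motion_def)
  show mean: "expectation (\<lambda>\<omega>. W t \<omega> - W s \<omega>) = 0"
    using normal_distributed_expectation[OF \<sigma> D] .
  have "variance (\<lambda>\<omega>. W t \<omega> - W s \<omega>) = ?\<sigma>\<^sup>2"
    by (rule normal_distributed_variance[OF \<sigma> D])
  then show "expectation (\<lambda>\<omega>. (W t \<omega> - W s \<omega>)\<^sup>2) = t - s"
    using st by (simp add: mean)
  have "integrable M (\<lambda>\<omega>. (W t \<omega> - W s \<omega>)\<^sup>2)"
    using distributed_integrable[OF D, of "\<lambda>x. x\<^sup>2"] integrable_normal_moment[OF \<sigma>, of 0 2] by simp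
  then show "sq_integrable M (\<lambda>\<omega>. W t \<omega> - W s \<omega>)"
    by (simp add: sq_integrable_def)
  have D1: "distributed M lborel (\<lambda>\<omega>. (W t \<omega> - W s \<omega> - 0) / ?\<sigma>) std_normal_density"
    by (subst normal_standard_normal_convert[OF \<sigma>, symmetric]) (rule D)
  have "distr M lborel (\<lambda>\<omega>. (W t \<omega> - W s \<omega> - 0) / ?\<sigma>) = std_normal_distribution"
    using D1 by (simp add: distributed_def)
  then have "(CLINT x|distr M lborel (\<lambda>\<omega>. (W t \<omega> - W s \<omega> - 0) / ?\<sigma>). iexp ((c * ?\<sigma>) * x))
      = exp (- ((c * ?\<sigma>)\<^sup>2) / 2)"
    using fun_cong[OF char_std_normal_distribution, of "c * ?\<sigma>"] by (simp add: char_def)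
  then show "(CLINT \<omega>|M. iexp (c * (W t \<omega> - W s \<omega>))) = exp (- (c\<^sup>2 * (t - s)) / 2)"
    using st \<sigma> by (subst (asm) integral_distr) (simp_all add: power_mult_distrib)
qed

lemma sq_integrable_W: "0 \<le> t \<Longrightarrow> sq_integrable M (W t)"
  and W_mean: "0 \<le> t \<Longrightarrow> expectation (W t) = 0"
  and W_square: "0 \<le> t \<Longrightarrow> expectation (\<lambda>\<omega>. (W t \<omega>)\<^sup>2) = t"
proof -
  assume t: "0 \<le> t"
  note [measurable] = measurable_W[OF t] measurable_W[of 0]
  \<comment> \<open>\<open>W 0\<close> vanishes only almost surely, so \<open>W t\<close> is treated
    through its increment from 0; time 0 has no increment of positive length and is a separate
    case.\<close>
  have ae: "AE \<omega> in M. W t \<omega> = W t \<omega> - W 0 \<omega>" using W_0 by eventually_elim simp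
  have "sq_integrable M (W t) \<and> expectation (W t) = 0 \<and> expectation (\<lambda>\<omega>. (W t \<omega>)\<^sup>2) = t"
  proof (cases "t = 0")
    case True
    have "AE \<omega> in M. W t \<omega> = 0" "AE \<omega> in M. (W t \<omega>)\<^sup>2 = 0" using W_0 True by auto
    then show ?thesis
      using integrable_cong_AE[of "\<lambda>\<omega>. (W t \<omega>)\<^sup>2" M "\<lambda>_. 0"] integral_cong_AE[of "W t" M "\<lambda>_. 0"]
        integral_cong_AE[of "\<lambda>\<omega>. (W t \<omega>)\<^sup>2" M "\<lambda>_. 0"] True by (simp add: sq_integrable_def)
  next
    case False
    with t have t0: "0 < t" by simp
    have "AE \<omega> in M. (W t \<omega>)\<^sup>2 = (W t \<omega> - W 0 \<omega>)\<^sup>2" using ae by eventually_elim simp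
    then show ?thesis
      using increment[OF order_refl t0] ae
        integrable_cong_AE[of "\<lambda>\<omega>. (W t \<omega>)\<^sup>2" M "\<lambda>\<omega>. (W t \<omega> - W 0 \<omega>)\<^sup>2"]
        integral_cong_AE[of "W t" M "\<lambda>\<omega>. W t \<omega> - W 0 \<omega>"]
        integral_cong_AE[of "\<lambda>\<omega>. (W t \<omega>)\<^sup>2" M "\<lambda>\<omega>. (W t \<omega> - W 0 \<omega>)\<^sup>2"]
      by (simp add: sq_integrable_def)
  qed
  then show "sq_integrable M (W t)" "expectation (W t) = 0" "expectation (\<lambda>\<omega>. (W t \<omega>)\<^sup>2) = t" by auto
qed

text \<open>Induction on the largest time \<open>b\<close>. With \<open>p\<close> the next largest,
  \<open>W b\<close> is \<open>W p\<close> plus an increment independent of \<open>Filt p\<close>,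
  so the coefficient of \<open>b\<close> is added to that of \<open>p\<close>. The step function on
  the right is the integrand whose Wiener integral is the combination. Time 0 is always included so
  that \<open>p\<close> exists.\<close>

lemma char_combination_set:
  assumes "finite S" "S \<subseteq> {0<..}"
  shows "(CLINT \<omega>|M. iexp (\<Sum>t\<in>insert 0 S. a t * W t \<omega>))
    = exp (- (LBINT s. (\<Sum>t\<in>insert 0 S. a t * indicat_real {0<..t} s)\<^sup>2) / 2)"
  using assms
proof (induction S arbitrary: a rule: finite_linorder_max_induct)
  case empty
  have "(CLINT \<omega>|M. iexp (a 0 * W 0 \<omega>)) = (CLINT \<omega>|M. 1)"
    using W_0 by (intro integral_cong_AE) (auto simp: measurable_W)
  then show ?case by (simp add: prob_space)
next
  case (insert b S)
  define U where "U = insert 0 S"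
  define p where "p = Max U"
  have U: "finite U" "p \<in> U" "b \<notin> U" "insert 0 (insert b S) = insert b U"
    and p: "0 \<le> p" "p < b" and Up: "\<And>t. t \<in> U \<Longrightarrow> 0 \<le> t \<and> t \<le> p"
    using insert Max_in[of "insert 0 S"] by (auto simp: U_def p_def less_imp_le)
  define a' where "a' = a(p := a p + a b)"
  have split: "(\<Sum>t\<in>insert b U. a t * f t) = (\<Sum>t\<in>U. a' t * f t) + a b * (f b - f p)" for f :: "real \<Rightarrow> real"
  proof -
    have "(\<Sum>t\<in>U. a' t * f t) = (\<Sum>t\<in>U. a t * f t + (if t = p then a b * f p else 0))"
      by (intro sum.cong) (auto simp: a'_def distrib_right)
    also have "\<dots> = (\<Sum>t\<in>U. a t * f t) + a b * f p"
      using U by (simp add: sum.distrib)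
    finally show ?thesis using U by (simp add: right_diff_distrib)
  qed
  have meas [measurable]: "(\<lambda>\<omega>. \<Sum>t\<in>U. a' t * W t \<omega>) \<in> borel_measurable (Filt p)"
    using Up by (intro borel_measurable_sum borel_measurable_times borel_measurable_const measurable_W_Filt) auto
  have "(CLINT \<omega>|M. iexp (\<Sum>t\<in>insert b U. a t * W t \<omega>))
      = (CLINT \<omega>|M. iexp (\<Sum>t\<in>U. a' t * W t \<omega>) * iexp (a b * (W b \<omega> - W p \<omega>)))"
    unfolding split by (simp add: distrib_left exp_add)
  also have "\<dots> = (CLINT \<omega>|M. iexp (\<Sum>t\<in>U. a' t * W t \<omega>)) * (CLINT \<omega>|M. iexp (a b * (W b \<omega> - W p \<omega>)))"
  proof (rule indep_var_lebesgue_integral)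
    show "indep_var borel (\<lambda>\<omega>. iexp (\<Sum>t\<in>U. a' t * W t \<omega>)) borel (\<lambda>\<omega>. iexp (a b * (W b \<omega> - W p \<omega>)))"
      using p by (intro indep_var_increment[where g = "\<lambda>x. iexp (a b * x)"]
          measurable_compose[OF meas, of iexp]) auto
    show "complex_integrable M (\<lambda>\<omega>. iexp (\<Sum>t\<in>U. a' t * W t \<omega>))"
    proof (rule integrable_iexp)
      show "(\<lambda>\<omega>. complex_of_real (\<Sum>t\<in>U. a' t * W t \<omega>)) \<in> borel_measurable M"
        by (rule measurable_compose[OF measurable_Filt[OF meas]]) simp
    qed (rule Im_complex_of_real)
    show "complex_integrable M (\<lambda>\<omega>. iexp (a b * (W b \<omega> - W p \<omega>)))"
      using p by (intro integrable_iexp) auto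
  qed
  also have "(CLINT \<omega>|M. iexp (\<Sum>t\<in>U. a' t * W t \<omega>))
      = exp (- (LBINT s. (\<Sum>t\<in>U. a' t * indicat_real {0<..t} s)\<^sup>2) / 2)"
    using insert unfolding U_def by simp
  also have "(CLINT \<omega>|M. iexp (a b * (W b \<omega> - W p \<omega>))) = exp (- ((a b)\<^sup>2 * (b - p)) / 2)"
    by (rule increment_char[OF p])
  also have "complex_of_real (exp (- (LBINT s. (\<Sum>t\<in>U. a' t * indicat_real {0<..t} s)\<^sup>2) / 2))
      * complex_of_real (exp (- ((a b)\<^sup>2 * (b - p)) / 2))
    = exp (- ((LBINT s. (\<Sum>t\<in>U. a' t * indicat_real {0<..t} s)\<^sup>2) + (a b)\<^sup>2 * (b - p)) / 2)"
    by (simp only: of_real_mult [symmetric] exp_add [symmetric]) (simp add: field_simps)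
  also have "(LBINT s. (\<Sum>t\<in>U. a' t * indicat_real {0<..t} s)\<^sup>2) + (a b)\<^sup>2 * (b - p)
      = (LBINT s. (\<Sum>t\<in>U. a' t * indicat_real {0<..t} s)\<^sup>2 + (a b)\<^sup>2 * indicat_real {p<..b} s)"
  proof -
    have "sq_integrable lborel (\<lambda>s. \<Sum>t\<in>U. a' t *\<^sub>R indicat_real {0<..t} s)"
      using Up by (intro sq_integrable_sum sq_integrable_scaleR sq_integrable_indicator) auto
    then show ?thesis using p by (simp add: sq_integrable_def)
  qed
  \<comment> \<open>The squares add up because the new piece lives on \<open>{p<..b}\<close>, where
    all earlier indicators vanish.\<close>
  also have "\<dots> = (LBINT s. (\<Sum>t\<in>insert b U. a t * indicat_real {0<..t} s)\<^sup>2)"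
  proof (intro Bochner_Integration.integral_cong refl)
    fix s
    have "indicat_real {0<..b} s - indicat_real {0<..p} s = indicat_real {p<..b} s"
      using p by (auto split: split_indicator)
    moreover have "(\<Sum>t\<in>U. a' t * indicat_real {0<..t} s) = 0" if "s \<in> {p<..b}"
    proof (rule sum.neutral, rule ballI)
      fix t assume "t \<in> U"
      from Up[OF this] that show "a' t * indicat_real {0<..t} s = 0" by simp
    qed
    ultimately show "(\<Sum>t\<in>U. a' t * indicat_real {0<..t} s)\<^sup>2 + (a b)\<^sup>2 * indicat_real {p<..b} s
        = (\<Sum>t\<in>insert b U. a t * indicat_real {0<..t} s)\<^sup>2"
      unfolding split by (auto split: split_indicator simp: power_mult_distrib)
  qed
  finally show ?case unfolding U .
qed

text \<open>Several indices may carry the same time; their coefficients are pooled first.\<close>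

lemma char_combination:
  assumes L: "finite L" "\<And>l. l \<in> L \<Longrightarrow> 0 \<le> \<tau> l"
  shows "(CLINT \<omega>|M. iexp (\<Sum>l\<in>L. a l * W (\<tau> l) \<omega>))
    = exp (- (LBINT s. (\<Sum>l\<in>L. a l * indicat_real {0<..\<tau> l} s)\<^sup>2) / 2)"
proof -
  define S where "S = \<tau> ` L - {0}"
  have S: "finite S" "S \<subseteq> {0<..}" using L by (auto simp: S_def) (metis order_le_less)
  define A where "A t = (\<Sum>l\<in>{l\<in>L. \<tau> l = t}. a l)" for t
  have eq: "(\<Sum>l\<in>L. a l * f (\<tau> l)) = (\<Sum>t\<in>insert 0 S. A t * f t)" for f :: "real \<Rightarrow> real"
  proof -
    have "(\<Sum>t\<in>insert 0 S. A t * f t) = (\<Sum>t\<in>insert 0 S. \<Sum>l\<in>{l\<in>L. \<tau> l = t}. a l * f (\<tau> l))"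
      unfolding A_def sum_distrib_right by (intro sum.cong) auto
    also have "\<dots> = (\<Sum>l\<in>L. a l * f (\<tau> l))"
      using L S by (intro sum.group) (auto simp: S_def)
    finally show ?thesis ..
  qed
  have "(\<Sum>l\<in>L. a l * W (\<tau> l) \<omega>) = (\<Sum>t\<in>insert 0 S. A t * W t \<omega>)"
    and "(\<Sum>l\<in>L. a l * indicat_real {0<..\<tau> l} s) = (\<Sum>t\<in>insert 0 S. A t * indicat_real {0<..t} s)"
    for \<omega> s
    using eq[of "\<lambda>t. W t \<omega>"] eq[of "\<lambda>t. indicat_real {0<..t} s"] .
  then show ?thesis using char_combination_set[OF S, of A] by (simp only:)
qed

end

section \<open>Mean square convergence\<close>

lemma norm_add_scaleR_square:
  fixes a b :: "'b::real_inner"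
  shows "(norm (a + c *\<^sub>R b))\<^sup>2 = (norm a)\<^sup>2 + 2 * ((a \<bullet> b) * c) + (norm b)\<^sup>2 * c\<^sup>2"
  unfolding power2_norm_eq_inner
  by (simp add: inner_add_left inner_add_right inner_commute power2_eq_square algebra_simps)

lemma nn_integral_sq: "sq_integrable M f \<Longrightarrow> (\<integral>\<^sup>+x. ennreal ((norm (f x))\<^sup>2) \<partial>M) = ennreal (LINT x|M. (norm (f x))\<^sup>2)"
  by (intro nn_integral_eq_integral) (auto simp: sq_integrable_def)

lemma sq_integrableI:
  "f \<in> borel_measurable M \<Longrightarrow> (\<integral>\<^sup>+x. ennreal ((norm (f x))\<^sup>2) \<partial>M) < \<infinity> \<Longrightarrow> sq_integrable M f"
  unfolding sq_integrable_def integrable_iff_bounded by simp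

text \<open>A weighted Young inequality replaces the triangle inequality for L2 norms: the squared
  difference gets the factor 1 + 1 / \<epsilon>, the limit the small factor \<epsilon>.\<close>

lemma tendsto_integral_square:
  fixes h :: "'a \<Rightarrow> real"
  assumes h: "sq_integrable M h" "\<And>k. sq_integrable M (hk k)"
    and lim: "(\<lambda>k. LINT x|M. (hk k x - h x)\<^sup>2) \<longlonglongrightarrow> 0"
  shows "(\<lambda>k. LINT x|M. (hk k x)\<^sup>2) \<longlonglongrightarrow> (LINT x|M. (h x)\<^sup>2)"
proof (rule LIMSEQ_I)
  fix e :: real assume e: "0 < e"
  let ?H = "LINT x|M. (h x)\<^sup>2"
  have H0: "0 \<le> ?H" by simp
  \<comment> \<open>Keeps \<epsilon> times the second moment of \<open>h\<close> below
    \<open>e / 2\<close>; the added 1 avoids a zero denominator.\<close>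
  define \<epsilon> where "\<epsilon> = e / (2 * (?H + 1))"
  have H1: "0 < ?H + 1" using H0 by (rule add_nonneg_pos) simp
  then have \<epsilon>: "0 < \<epsilon>" unfolding \<epsilon>_def using e by (intro divide_pos_pos mult_pos_pos) auto
  have "e / (2 * a) * a = e / 2" if "0 < a" for a :: real using that by simp
  from this[OF H1] have "\<epsilon> * (?H + 1) = e / 2" by (simp only: \<epsilon>_def)
  with \<epsilon> have \<epsilon>H: "\<epsilon> * ?H < e / 2" by (simp add: distrib_left)
  have i: "integrable M (\<lambda>x. (h x)\<^sup>2)" "integrable M (\<lambda>x. (hk k x)\<^sup>2)" "integrable M (\<lambda>x. (hk k x - h x)\<^sup>2)" for k
    using h sq_integrable_diff[OF h(2)[of k] h(1)] by (auto simp: sq_integrable_def)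
  have bd: "\<bar>(LINT x|M. (hk k x)\<^sup>2) - ?H\<bar> \<le> (1 + 1 / \<epsilon>) * (LINT x|M. (hk k x - h x)\<^sup>2) + \<epsilon> * ?H" for k
  proof -
    have pt: "\<bar>a\<^sup>2 - b\<^sup>2\<bar> \<le> (1 + 1 / \<epsilon>) * (a - b)\<^sup>2 + \<epsilon> * b\<^sup>2" for a b :: real
    proof -
      have "0 \<le> (\<bar>a - b\<bar> - \<epsilon> * \<bar>b\<bar>)\<^sup>2 / \<epsilon>" using \<epsilon> by simp
      also have "\<dots> = (a - b)\<^sup>2 / \<epsilon> - 2 * \<bar>a - b\<bar> * \<bar>b\<bar> + \<epsilon> * b\<^sup>2"
        using \<epsilon> by (simp add: power2_diff power_mult_distrib field_simps power2_eq_square)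
      finally have "2 * (\<bar>a - b\<bar> * \<bar>b\<bar>) \<le> (a - b)\<^sup>2 / \<epsilon> + \<epsilon> * b\<^sup>2" by simp
      moreover have "\<bar>a\<^sup>2 - b\<^sup>2\<bar> \<le> (a - b)\<^sup>2 + 2 * (\<bar>a - b\<bar> * \<bar>b\<bar>)"
      proof -
        have "a\<^sup>2 - b\<^sup>2 = (a - b)\<^sup>2 + 2 * ((a - b) * b)" by (simp add: power2_eq_square algebra_simps)
        then have "\<bar>a\<^sup>2 - b\<^sup>2\<bar> \<le> \<bar>(a - b)\<^sup>2\<bar> + \<bar>2 * ((a - b) * b)\<bar>" by linarith
        then show ?thesis by (simp add: abs_mult)
      qed
      ultimately show ?thesis by (simp add: distrib_right)
    qed
    have "\<bar>(LINT x|M. (hk k x)\<^sup>2) - ?H\<bar> = \<bar>LINT x|M. (hk k x)\<^sup>2 - (h x)\<^sup>2\<bar>"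
      using i by simp
    also have "\<dots> \<le> (LINT x|M. \<bar>(hk k x)\<^sup>2 - (h x)\<^sup>2\<bar>)" by (rule integral_abs_bound)
    also have "\<dots> \<le> (LINT x|M. (1 + 1 / \<epsilon>) * (hk k x - h x)\<^sup>2 + \<epsilon> * (h x)\<^sup>2)"
      using i pt by (intro integral_mono) auto
    also have "\<dots> = (1 + 1 / \<epsilon>) * (LINT x|M. (hk k x - h x)\<^sup>2) + \<epsilon> * ?H"
      using i by simp
    finally show ?thesis .
  qed
  have "e / (2 * (1 + 1 / \<epsilon>)) > 0" using e \<epsilon> by (simp add: add_pos_pos)
  from LIMSEQ_D[OF lim this] obtain K where
    K: "\<And>k. k \<ge> K \<Longrightarrow> \<bar>LINT x|M. (hk k x - h x)\<^sup>2\<bar> < e / (2 * (1 + 1 / \<epsilon>))" by auto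
  have "norm ((LINT x|M. (hk k x)\<^sup>2) - ?H) < e" if "k \<ge> K" for k
  proof -
    have "1 + 1 / \<epsilon> > 0" using \<epsilon> by (simp add: add_pos_pos)
    have "a * b < e / 2" if "\<bar>b\<bar> < e / (2 * a)" "0 < a" for a b :: real
      using that by (simp add: field_simps abs_less_iff)
    from this[OF K[OF that] \<open>1 + 1 / \<epsilon> > 0\<close>] have
      "(1 + 1 / \<epsilon>) * (LINT x|M. (hk k x - h x)\<^sup>2) < e / 2" .
    from add_strict_mono[OF this \<epsilon>H] have
      "(1 + 1 / \<epsilon>) * (LINT x|M. (hk k x - h x)\<^sup>2) + \<epsilon> * ?H < e" by (simp only: field_sum_of_halves)
    then show ?thesis unfolding real_norm_def by (rule order_le_less_trans[OF bd])
  qed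
  then show "\<exists>K. \<forall>k\<ge>K. norm ((LINT x|M. (hk k x)\<^sup>2) - ?H) < e" by blast
qed

context prob_space
begin

text \<open>Jensen's inequality for the square, in the guise of a nonnegative variance.\<close>

lemma L2_tendsto_L1:
  assumes f: "\<And>k. sq_integrable M (f k)" and lim: "(\<lambda>k. LINT x|M. (norm (f k x))\<^sup>2) \<longlonglongrightarrow> 0"
  shows "(\<lambda>k. LINT x|M. norm (f k x)) \<longlonglongrightarrow> 0"
proof (rule tendsto_sandwich[where f = "\<lambda>_. 0"])
  have "(LINT x|M. norm (f k x)) \<le> sqrt (LINT x|M. (norm (f k x))\<^sup>2)" for k
  proof -
    have i: "integrable M (\<lambda>x. norm (f k x))" "integrable M (\<lambda>x. (norm (f k x))\<^sup>2)"
      using f sq_integrable_integrable[OF f[of k]] by (auto simp: sq_integrable_def)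
    have "0 \<le> variance (\<lambda>x. norm (f k x))" by (rule variance_positive)
    with variance_eq[OF i] show ?thesis by (intro real_le_rsqrt) simp
  qed
  then show "\<forall>\<^sub>F k in sequentially. (LINT x|M. norm (f k x)) \<le> sqrt (LINT x|M. (norm (f k x))\<^sup>2)" by simp
  show "(\<lambda>k. sqrt (LINT x|M. (norm (f k x))\<^sup>2)) \<longlonglongrightarrow> 0"
    using tendsto_real_sqrt[OF lim] by simp
qed auto

lemma L2_tendsto_mean:
  assumes f: "\<And>k. sq_integrable M (f k)" "sq_integrable M g"
    and lim: "(\<lambda>k. LINT x|M. (norm (f k x - g x))\<^sup>2) \<longlonglongrightarrow> 0"
  shows "(\<lambda>k. LINT x|M. f k x) \<longlonglongrightarrow> (LINT x|M. g x)"
proof (rule LIM_zero_cancel, rule Lim_null_comparison)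
  show "(\<lambda>k. LINT x|M. norm (f k x - g x)) \<longlonglongrightarrow> 0"
    using f lim by (intro L2_tendsto_L1 sq_integrable_diff) auto
  have "norm ((LINT x|M. f k x) - (LINT x|M. g x)) \<le> (LINT x|M. norm (f k x - g x))" for k
    using f[THEN sq_integrable_integrable] integral_norm_bound[of M "\<lambda>x. f k x - g x"] by simp
  then show "\<forall>\<^sub>F k in sequentially. norm ((LINT x|M. f k x) - (LINT x|M. g x)) \<le> (LINT x|M. norm (f k x - g x))"
    by simp
qed

text \<open>\<open>iexp\<close> is 1-Lipschitz, so L1 convergence is enough.\<close>

lemma L2_tendsto_char:
  fixes g :: "'a \<Rightarrow> real"
  assumes f: "\<And>k. sq_integrable M (f k)" "sq_integrable M g"
    and lim: "(\<lambda>k. LINT x|M. (f k x - g x)\<^sup>2) \<longlonglongrightarrow> 0"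
  shows "(\<lambda>k. CLINT x|M. iexp (f k x)) \<longlonglongrightarrow> (CLINT x|M. iexp (g x))"
proof (rule LIM_zero_cancel, rule Lim_null_comparison)
  show "(\<lambda>k. LINT x|M. norm (f k x - g x)) \<longlonglongrightarrow> 0"
    using f lim by (intro L2_tendsto_L1 sq_integrable_diff) auto
  have [measurable]: "f k \<in> borel_measurable M" "g \<in> borel_measurable M" for k
    using f by (auto simp: sq_integrable_def)
  have lip: "norm (iexp a - iexp b) \<le> \<bar>a - b\<bar>" for a b :: real
  proof -
    have "iexp a - iexp b = iexp b * (iexp (a - b) - 1)"
      by (simp add: right_diff_distrib exp_diff field_simps)
    then have "norm (iexp a - iexp b) = norm (iexp (a - b) - 1)" by (simp add: norm_mult)
    also have "\<dots> \<le> \<bar>a - b\<bar>" using iexp_approx1[of "a - b" 0] by simp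
    finally show ?thesis .
  qed
  have "norm ((CLINT x|M. iexp (f k x)) - (CLINT x|M. iexp (g x))) \<le> (LINT x|M. norm (f k x - g x))" for k
  proof -
    have i: "complex_integrable M (\<lambda>x. iexp (f k x))" "complex_integrable M (\<lambda>x. iexp (g x))"
      by (auto intro!: integrable_iexp)
    have "norm ((CLINT x|M. iexp (f k x)) - (CLINT x|M. iexp (g x))) \<le> (LINT x|M. norm (iexp (f k x) - iexp (g x)))"
      unfolding Bochner_Integration.integral_diff[OF i, symmetric] by (rule integral_norm_bound)
    also have "\<dots> \<le> (LINT x|M. norm (f k x - g x))"
    proof (rule integral_mono)
      show "integrable M (\<lambda>x. norm (f k x - g x))"
        using f[THEN sq_integrable_integrable] by auto
    qed (use i lip in auto)
    finally show ?thesis .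
  qed
  then show "\<forall>\<^sub>F k in sequentially. norm ((CLINT x|M. iexp (f k x)) - (CLINT x|M. iexp (g x))) \<le> (LINT x|M. norm (f k x - g x))"
    by simp
qed

text \<open>The bias-variance decomposition: the centred variable is orthogonal to constants. It is
  the reason why averaging a simple approximation does not worsen it.\<close>

lemma expectation_norm_diff_square:
  assumes f: "sq_integrable M f"
  shows "(LINT x|M. (norm (f x - a))\<^sup>2)
    = (LINT x|M. (norm (f x - expectation f))\<^sup>2) + (norm (expectation f - a))\<^sup>2"
proof -
  let ?m = "expectation f"
  have c: "sq_integrable M (\<lambda>x. b)" for b :: 'b
    by (rule sq_integrable_bounded[of _ "norm b"]) auto
  have s: "sq_integrable M (\<lambda>x. f x - ?m)" by (intro sq_integrable_diff f c)
  have i: "integrable M f" "integrable M (\<lambda>x. f x - ?m)" "integrable M (\<lambda>x. (norm (f x - ?m))\<^sup>2)"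
    using f s sq_integrable_integrable by (auto simp: sq_integrable_def)
  have "(norm (f x - a))\<^sup>2 = (norm (f x - ?m))\<^sup>2 + 2 * ((f x - ?m) \<bullet> (?m - a)) + (norm (?m - a))\<^sup>2" for x
    by (simp add: power2_norm_eq_inner inner_diff_left inner_diff_right inner_commute algebra_simps)
  moreover have "(LINT x|M. (f x - ?m) \<bullet> (?m - a)) = 0"
    using i by (subst integral_inner_left) (auto simp: prob_space)
  ultimately show ?thesis using i by (simp add: prob_space)
qed

end

section \<open>Integrals of simple processes\<close>

context brownian
begin

lemma increment_orthogonal:
  assumes "0 \<le> s" "s < t" "Y \<in> borel_measurable (Filt s)" "integrable M Y"
  shows "integrable M (\<lambda>\<omega>. Y \<omega> * (W t \<omega> - W s \<omega>))" "(LINT \<omega>|M. Y \<omega> * (W t \<omega> - W s \<omega>)) = 0"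
  using indep_var_increment[OF assms(1-3), of "\<lambda>x. x"] assms
    increment_mean[of s t] increment_sq_integrable[of s t, THEN sq_integrable_integrable]
    indep_var_integrable[of Y "\<lambda>\<omega>. W t \<omega> - W s \<omega>"]
    indep_var_lebesgue_integral[of Y "\<lambda>\<omega>. W t \<omega> - W s \<omega>"]
  by simp_all

lemma increment_isometry:
  assumes "0 \<le> s" "s < t" "Y \<in> borel_measurable (Filt s)" "integrable M Y"
  shows "integrable M (\<lambda>\<omega>. Y \<omega> * (W t \<omega> - W s \<omega>)\<^sup>2)"
    "(LINT \<omega>|M. Y \<omega> * (W t \<omega> - W s \<omega>)\<^sup>2) = expectation Y * (t - s)"
  using indep_var_increment[OF assms(1-3), of "\<lambda>x. x\<^sup>2"] assms
    increment_square[of s t] increment_sq_integrable[of s t]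
    indep_var_integrable[of Y "\<lambda>\<omega>. (W t \<omega> - W s \<omega>)\<^sup>2"]
    indep_var_lebesgue_integral[of Y "\<lambda>\<omega>. (W t \<omega> - W s \<omega>)\<^sup>2"]
  by (simp_all add: sq_integrable_def)

lemma simple_process_mono:
  assumes "simple_process M Filt T N p \<xi>" "i \<le> j" "j \<le> N"
  shows "p i \<le> p j"
  using assms(2,3)
proof (induction j rule: dec_induct)
  case (step k)
  moreover have "p k \<le> p (Suc k)" using step assms(1) by (simp add: simple_process_def)
  ultimately show ?case by simp
qed simp

lemma simple_process_nonneg:
  assumes "simple_process M Filt T N p \<xi>" "j \<le> N"
  shows "0 \<le> p j" "p j \<le> T"
  using assms simple_process_mono[OF assms(1), of 0 j] simple_process_mono[OF assms(1), of j N]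
  by (auto simp: simple_process_def)

lemma simple_process_sq_integrable:
  assumes "simple_process M Filt T N p \<xi>" "i < N"
  shows "sq_integrable M (\<xi> i)"
  using assms unfolding simple_process_def by (metis sq_integrable_bounded measurable_Filt)

text \<open>Induction over the number of intervals, carrying measurability at \<open>p n\<close>
  along. The next increment is then independent of the partial sum and of \<open>\<xi> n\<close>, so
  the cross term has mean zero and the square factorises.\<close>

lemma simple_integral_isometry:
  assumes sp: "simple_process M Filt T N p \<xi>" and t: "0 \<le> t" and n: "n \<le> N"
  shows "simple_integral W n p \<xi> t \<in> borel_measurable (Filt (p n))"
    and "sq_integrable M (simple_integral W n p \<xi> t)"
    and "(LINT \<omega>|M. (norm (simple_integral W n p \<xi> t \<omega>))\<^sup>2)
      = (\<Sum>i<n. (min t (p (Suc i)) - min t (p i)) * (LINT \<omega>|M. (norm (\<xi> i \<omega>))\<^sup>2))"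
proof -
  have "simple_integral W n p \<xi> t \<in> borel_measurable (Filt (p n)) \<and>
    sq_integrable M (simple_integral W n p \<xi> t) \<and>
    (LINT \<omega>|M. (norm (simple_integral W n p \<xi> t \<omega>))\<^sup>2)
      = (\<Sum>i<n. (min t (p (Suc i)) - min t (p i)) * (LINT \<omega>|M. (norm (\<xi> i \<omega>))\<^sup>2))"
    using n
  proof (induction n)
    case 0
    then show ?case by (simp add: simple_integral_def [abs_def])
  next
    case (Suc n)
    let ?S = "simple_integral W n p \<xi> t"
    define q r where "q = min t (p (Suc n))" and "r = min t (p n)"
    have n: "n < N" "n \<le> N" using Suc by auto
    have pn: "0 \<le> p n" "p n \<le> p (Suc n)"
      using simple_process_nonneg[OF sp n(2)] simple_process_mono[OF sp, of n "Suc n"] Suc by auto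
    from Suc have S: "?S \<in> borel_measurable (Filt (p n))" "sq_integrable M ?S"
      "(LINT \<omega>|M. (norm (?S \<omega>))\<^sup>2)
        = (\<Sum>i<n. (min t (p (Suc i)) - min t (p i)) * (LINT \<omega>|M. (norm (\<xi> i \<omega>))\<^sup>2))" by auto
    have \<xi>: "\<xi> n \<in> borel_measurable (Filt (p n))" using sp n by (auto simp: simple_process_def)
    have \<xi>sq: "sq_integrable M (\<xi> n)" by (rule simple_process_sq_integrable[OF sp n(1)])
    have eq: "simple_integral W (Suc n) p \<xi> t = (\<lambda>\<omega>. ?S \<omega> + (W q \<omega> - W r \<omega>) *\<^sub>R \<xi> n \<omega>)"
      by (simp add: simple_integral_def fun_eq_iff q_def r_def)
    have qr: "0 \<le> r" "r \<le> q" "r \<le> p n" "q \<le> p (Suc n)" using t pn by (auto simp: q_def r_def)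
    have meas: "simple_integral W (Suc n) p \<xi> t \<in> borel_measurable (Filt (p (Suc n)))"
      unfolding eq using qr pn S(1) \<xi>
      by (intro borel_measurable_add borel_measurable_scaleR borel_measurable_diff measurable_W_Filt
          measurable_Filt_mono[where s = "p n" and t = "p (Suc n)"]) auto
    show ?case
    proof (cases "q = r")
      case True
      then have "simple_integral W (Suc n) p \<xi> t = ?S" by (simp add: eq fun_eq_iff)
      with meas S True show ?thesis by (simp add: q_def r_def)
    next
      case False
      then have rq: "r < q" using qr by simp
      \<comment> \<open>A nonempty stopped interval starts at \<open>p n\<close> itself, where
        \<open>\<xi> n\<close> is already measurable.\<close>
      then have r: "r = p n" by (auto simp: q_def r_def min_def split: if_splits)
      have S\<xi>: "(\<lambda>\<omega>. ?S \<omega> \<bullet> \<xi> n \<omega>) \<in> borel_measurable (Filt r)" "integrable M (\<lambda>\<omega>. ?S \<omega> \<bullet> \<xi> n \<omega>)"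
        using S \<xi> \<xi>sq r by (auto intro: sq_integrable_inner)
      have \<xi>2: "(\<lambda>\<omega>. (norm (\<xi> n \<omega>))\<^sup>2) \<in> borel_measurable (Filt r)" "integrable M (\<lambda>\<omega>. (norm (\<xi> n \<omega>))\<^sup>2)"
        using \<xi> \<xi>sq r by (auto simp: sq_integrable_def)
      note o = increment_orthogonal[OF qr(1) rq S\<xi>] and s = increment_isometry[OF qr(1) rq \<xi>2]
      have sq: "(norm (simple_integral W (Suc n) p \<xi> t \<omega>))\<^sup>2
        = (norm (?S \<omega>))\<^sup>2 + 2 * ((?S \<omega> \<bullet> \<xi> n \<omega>) * (W q \<omega> - W r \<omega>)) + (norm (\<xi> n \<omega>))\<^sup>2 * (W q \<omega> - W r \<omega>)\<^sup>2" for \<omega>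
        unfolding eq norm_add_scaleR_square ..
      have i: "integrable M (\<lambda>\<omega>. (norm (?S \<omega>))\<^sup>2)" using S(2) by (simp add: sq_integrable_def)
      have "sq_integrable M (simple_integral W (Suc n) p \<xi> t)"
        unfolding sq_integrable_def sq using measurable_Filt[OF meas] o s i by auto
      moreover have "(LINT \<omega>|M. (norm (simple_integral W (Suc n) p \<xi> t \<omega>))\<^sup>2)
          = (LINT \<omega>|M. (norm (?S \<omega>))\<^sup>2) + (LINT \<omega>|M. (norm (\<xi> n \<omega>))\<^sup>2) * (q - r)"
        unfolding sq using o s i by simp
      ultimately show ?thesis using meas by (simp add: S(3) q_def r_def mult.commute)
    qed
  qed
  then show "simple_integral W n p \<xi> t \<in> borel_measurable (Filt (p n))"
    "sq_integrable M (simple_integral W n p \<xi> t)"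
    "(LINT \<omega>|M. (norm (simple_integral W n p \<xi> t \<omega>))\<^sup>2)
      = (\<Sum>i<n. (min t (p (Suc i)) - min t (p i)) * (LINT \<omega>|M. (norm (\<xi> i \<omega>))\<^sup>2))" by auto
qed

text \<open>The intervals are half-open and ordered, hence disjoint: at most one summand is
  nonzero.\<close>

lemma simple_value_square:
  assumes sp: "simple_process M Filt T N p \<xi>"
  shows "(norm (simple_value N p \<xi> s \<omega>))\<^sup>2 = (\<Sum>i<N. indicat_real {p i<..p (Suc i)} s * (norm (\<xi> i \<omega>))\<^sup>2)"
proof -
  have "(norm (simple_value n p \<xi> s \<omega>))\<^sup>2 = (\<Sum>i<n. indicat_real {p i<..p (Suc i)} s * (norm (\<xi> i \<omega>))\<^sup>2)"
    if "n \<le> N" for n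
    using that
  proof (induction n)
    case (Suc n)
    show ?case
    proof (cases "s \<in> {p n<..p (Suc n)}")
      case True
      have "s \<notin> {p i<..p (Suc i)}" if "i < n" for i
        using True simple_process_mono[OF sp, of "Suc i" n] that Suc by auto
      then have "simple_value n p \<xi> s \<omega> = 0" "(\<Sum>i<n. indicat_real {p i<..p (Suc i)} s * (norm (\<xi> i \<omega>))\<^sup>2) = 0"
        by (auto simp: simple_value_def intro!: sum.neutral)
      with True show ?thesis by (simp add: simple_value_def)
    qed (use Suc in \<open>simp add: simple_value_def\<close>)
  qed (simp add: simple_value_def)
  then show ?thesis by simp
qed

lemma nn_integral_simple_value:
  assumes sp: "simple_process M Filt T N p \<xi>"
  shows "(\<integral>\<^sup>+s\<in>{0..T}. ennreal ((norm (simple_value N p \<xi> s \<omega>))\<^sup>2) \<partial>lborel)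
    = ennreal (\<Sum>i<N. (p (Suc i) - p i) * (norm (\<xi> i \<omega>))\<^sup>2)"
proof -
  have eq: "ennreal ((norm (simple_value N p \<xi> s \<omega>))\<^sup>2) * indicator {0..T} s
    = (\<Sum>i<N. ennreal ((norm (\<xi> i \<omega>))\<^sup>2) * indicator {p i<..p (Suc i)} s)" for s
  proof -
    have "ennreal ((norm (simple_value N p \<xi> s \<omega>))\<^sup>2) * indicator {0..T} s
      = (\<Sum>i<N. ennreal (indicat_real {p i<..p (Suc i)} s * (norm (\<xi> i \<omega>))\<^sup>2)) * indicator {0..T} s"
      unfolding simple_value_square[OF sp] by (subst sum_ennreal) auto
    also have "\<dots> = (\<Sum>i<N. ennreal (indicat_real {p i<..p (Suc i)} s * (norm (\<xi> i \<omega>))\<^sup>2) * indicator {0..T} s)"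
      by (rule sum_distrib_right)
    also have "\<dots> = (\<Sum>i<N. ennreal ((norm (\<xi> i \<omega>))\<^sup>2) * indicator {p i<..p (Suc i)} s)"
    proof (rule sum.cong[OF refl])
      fix i assume "i \<in> {..<N}"
      then have "0 \<le> p i" "p (Suc i) \<le> T"
        using simple_process_nonneg[OF sp, of i] simple_process_nonneg[OF sp, of "Suc i"] by auto
      then show "ennreal (indicat_real {p i<..p (Suc i)} s * (norm (\<xi> i \<omega>))\<^sup>2) * indicator {0..T} s
        = ennreal ((norm (\<xi> i \<omega>))\<^sup>2) * indicator {p i<..p (Suc i)} s"
        by (auto split: split_indicator)
    qed
    finally show ?thesis .
  qed
  have "(\<integral>\<^sup>+s\<in>{0..T}. ennreal ((norm (simple_value N p \<xi> s \<omega>))\<^sup>2) \<partial>lborel)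
    = (\<Sum>i<N. \<integral>\<^sup>+s. ennreal ((norm (\<xi> i \<omega>))\<^sup>2) * indicator {p i<..p (Suc i)} s \<partial>lborel)"
    unfolding eq by (intro nn_integral_sum) simp
  also have "\<dots> = (\<Sum>i<N. ennreal ((norm (\<xi> i \<omega>))\<^sup>2) * emeasure lborel {p i<..p (Suc i)})"
    by (intro sum.cong refl nn_integral_cmult_indicator) simp
  also have "\<dots> = (\<Sum>i<N. ennreal ((p (Suc i) - p i) * (norm (\<xi> i \<omega>))\<^sup>2))"
    using sp by (intro sum.cong refl) (auto simp: simple_process_def ennreal_mult mult.commute)
  also have "\<dots> = ennreal (\<Sum>i<N. (p (Suc i) - p i) * (norm (\<xi> i \<omega>))\<^sup>2)"
    using sp by (intro sum_ennreal) (auto simp: simple_process_def)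
  finally show ?thesis .
qed

text \<open>Stopping at \<open>t\<close> only shortens the intervals in the isometry.\<close>

lemma simple_integral_le:
  assumes sp: "simple_process M Filt T N p \<xi>" and t: "0 \<le> t"
  shows "(\<integral>\<^sup>+\<omega>. ennreal ((norm (simple_integral W N p \<xi> t \<omega>))\<^sup>2) \<partial>M)
    \<le> (\<integral>\<^sup>+\<omega>. (\<integral>\<^sup>+s\<in>{0..T}. ennreal ((norm (simple_value N p \<xi> s \<omega>))\<^sup>2) \<partial>lborel) \<partial>M)"
proof -
  have i: "integrable M (\<lambda>\<omega>. (norm (\<xi> i \<omega>))\<^sup>2)" if "i < N" for i
    using simple_process_sq_integrable[OF sp that] by (simp add: sq_integrable_def)
  have mono: "p i \<le> p (Suc i)" if "i < N" for i using sp that by (auto simp: simple_process_def)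
  have "(LINT \<omega>|M. (norm (simple_integral W N p \<xi> t \<omega>))\<^sup>2)
      \<le> (\<Sum>i<N. (p (Suc i) - p i) * (LINT \<omega>|M. (norm (\<xi> i \<omega>))\<^sup>2))"
    unfolding simple_integral_isometry(3)[OF sp t order_refl]
    using mono by (intro sum_mono mult_right_mono) (force simp: min_def)+
  also have "\<dots> = (LINT \<omega>|M. (\<Sum>i<N. (p (Suc i) - p i) * (norm (\<xi> i \<omega>))\<^sup>2))"
    using i by (subst Bochner_Integration.integral_sum) auto
  finally show ?thesis
    unfolding nn_integral_simple_value[OF sp] nn_integral_sq[OF simple_integral_isometry(2)[OF sp t order_refl]]
    using i mono by (subst nn_integral_eq_integral) (auto intro!: sum_nonneg ennreal_leI)
qed

end

section \<open>Ito integrals of deterministic integrands\<close>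

lemma ennreal_norm_add_square_le:
  fixes a b :: "'b::real_normed_vector"
  shows "ennreal ((norm (a + b))\<^sup>2) \<le> 2 * ennreal ((norm a)\<^sup>2) + 2 * ennreal ((norm b)\<^sup>2)"
proof -
  have "ennreal ((norm (a + b))\<^sup>2) \<le> ennreal (2 * (norm a)\<^sup>2 + 2 * (norm b)\<^sup>2)"
    by (intro ennreal_leI norm_add_square_le)
  then show ?thesis by (simp add: ennreal_plus ennreal_mult)
qed

lemma tendsto_0_ennreal_double_add:
  fixes a b :: "nat \<Rightarrow> ennreal"
  assumes "a \<longlonglongrightarrow> 0" "b \<longlonglongrightarrow> 0" "\<And>k. c k \<le> 2 * a k + 2 * b k"
  shows "c \<longlonglongrightarrow> 0"
proof (rule tendsto_sandwich[where f = "\<lambda>_. 0" and h = "\<lambda>k. (a k + a k) + (b k + b k)"])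
  show "(\<lambda>k. (a k + a k) + (b k + b k)) \<longlonglongrightarrow> 0"
    using tendsto_add[OF tendsto_add[OF assms(1,1)] tendsto_add[OF assms(2,2)]] by simp
  show "\<forall>\<^sub>F k in sequentially. c k \<le> (a k + a k) + (b k + b k)"
    using assms(3) by (simp add: mult_2)
qed auto

lemma inner_square_le: "(a \<bullet> b)\<^sup>2 \<le> (norm a)\<^sup>2 * (norm b)\<^sup>2"
  using power_mono[of "\<bar>a \<bullet> b\<bar>" "norm a * norm b" 2] Cauchy_Schwarz_ineq2[of a b]
  by (simp add: power_mult_distrib)

lemma sq_integrable_inner_const:
  fixes f :: "'a \<Rightarrow> 'b::euclidean_space"
  assumes "sq_integrable K f"
  shows "sq_integrable K (\<lambda>x. y \<bullet> f x)"
  unfolding sq_integrable_def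
proof
  have [measurable]: "f \<in> borel_measurable K" using assms by (simp add: sq_integrable_def)
  show "(\<lambda>x. y \<bullet> f x) \<in> borel_measurable K" by measurable
  show "integrable K (\<lambda>x. (norm (y \<bullet> f x))\<^sup>2)"
  proof (rule Bochner_Integration.integrable_bound)
    show "integrable K (\<lambda>x. (norm y)\<^sup>2 * (norm (f x))\<^sup>2)" using assms by (auto simp: sq_integrable_def)
    show "AE x in K. norm ((norm (y \<bullet> f x))\<^sup>2) \<le> norm ((norm y)\<^sup>2 * (norm (f x))\<^sup>2)"
      by (simp add: inner_square_le)
  qed measurable
qed

lemma sq_integrable_indicator_scaleR:
  assumes "sq_integrable K f" and A: "A \<in> sets K"
  shows "sq_integrable K (\<lambda>x. indicat_real A x *\<^sub>R f x)"
  unfolding sq_integrable_def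
proof
  have [measurable]: "f \<in> borel_measurable K" using assms by (simp add: sq_integrable_def)
  note A [measurable]
  show "(\<lambda>x. indicat_real A x *\<^sub>R f x) \<in> borel_measurable K" by measurable
  show "integrable K (\<lambda>x. (norm (indicat_real A x *\<^sub>R f x))\<^sup>2)"
    by (rule Bochner_Integration.integrable_bound[where f = "\<lambda>x. (norm (f x))\<^sup>2"])
       (use assms in \<open>auto simp: sq_integrable_def split: split_indicator\<close>)
qed

lemma L2_tendsto_inner_sum:
  fixes f :: "nat \<Rightarrow> 'j \<Rightarrow> 'a \<Rightarrow> 'b::euclidean_space"
  assumes J: "finite J" and f: "\<And>j k. j \<in> J \<Longrightarrow> sq_integrable K (f k j)" "\<And>j. j \<in> J \<Longrightarrow> sq_integrable K (g j)"
    and lim: "\<And>j. j \<in> J \<Longrightarrow> (\<lambda>k. LINT x|K. (norm (f k j x - g j x))\<^sup>2) \<longlonglongrightarrow> 0"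
  shows "(\<lambda>k. LINT x|K. ((\<Sum>j\<in>J. y j \<bullet> f k j x) - (\<Sum>j\<in>J. y j \<bullet> g j x))\<^sup>2) \<longlonglongrightarrow> 0"
proof (rule tendsto_sandwich[where f = "\<lambda>_. 0"])
  \<comment> \<open>The factor \<open>card J\<close> is the price of bounding the square of a sum by
    a sum of squares.\<close>
  let ?u = "\<lambda>k. (\<Sum>j\<in>J. (norm (y j))\<^sup>2 * (LINT x|K. (norm (f k j x - g j x))\<^sup>2)) * card J"
  have "?u \<longlonglongrightarrow> (\<Sum>j\<in>J. (norm (y j))\<^sup>2 * 0) * card J"
    by (intro tendsto_intros lim)
  then show "?u \<longlonglongrightarrow> 0" by simp
  have "(LINT x|K. ((\<Sum>j\<in>J. y j \<bullet> f k j x) - (\<Sum>j\<in>J. y j \<bullet> g j x))\<^sup>2) \<le> ?u k" for k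
  proof -
    have d: "sq_integrable K (\<lambda>x. f k j x - g j x)" if "j \<in> J" for j
      using f that by (intro sq_integrable_diff)
    then have i: "integrable K (\<lambda>x. (norm (f k j x - g j x))\<^sup>2)" if "j \<in> J" for j
      using that by (simp add: sq_integrable_def)
    have "sq_integrable K (\<lambda>x. \<Sum>j\<in>J. y j \<bullet> (f k j x - g j x))"
      using d by (intro sq_integrable_sum sq_integrable_inner_const)
    then have l: "integrable K (\<lambda>x. (\<Sum>j\<in>J. y j \<bullet> (f k j x - g j x))\<^sup>2)"
      by (simp add: sq_integrable_def)
    have "(LINT x|K. ((\<Sum>j\<in>J. y j \<bullet> f k j x) - (\<Sum>j\<in>J. y j \<bullet> g j x))\<^sup>2)
        = (LINT x|K. (\<Sum>j\<in>J. y j \<bullet> (f k j x - g j x))\<^sup>2)"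
      by (simp add: inner_diff_right sum_subtractf)
    also have "\<dots> \<le> (LINT x|K. (\<Sum>j\<in>J. (norm (y j))\<^sup>2 * (norm (f k j x - g j x))\<^sup>2) * card J)"
    proof (rule integral_mono[OF l])
      show "integrable K (\<lambda>x. (\<Sum>j\<in>J. (norm (y j))\<^sup>2 * (norm (f k j x - g j x))\<^sup>2) * card J)"
        using i by (intro integrable_mult_left Bochner_Integration.integrable_sum integrable_mult_right) auto
      fix x
      have "(\<Sum>j\<in>J. y j \<bullet> (f k j x - g j x))\<^sup>2 \<le> (\<Sum>j\<in>J. (y j \<bullet> (f k j x - g j x))\<^sup>2) * card J"
        by (rule sum_squared_le_sum_of_squares)
      also have "\<dots> \<le> (\<Sum>j\<in>J. (norm (y j))\<^sup>2 * (norm (f k j x - g j x))\<^sup>2) * card J"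
        by (intro mult_right_mono sum_mono inner_square_le) simp
      finally show "(\<Sum>j\<in>J. y j \<bullet> (f k j x - g j x))\<^sup>2 \<le> (\<Sum>j\<in>J. (norm (y j))\<^sup>2 * (norm (f k j x - g j x))\<^sup>2) * card J" .
    qed
    also have "\<dots> = ?u k" using i by (simp add: Bochner_Integration.integral_sum)
    finally show ?thesis .
  qed
  then show "\<forall>\<^sub>F k in sequentially. (LINT x|K. ((\<Sum>j\<in>J. y j \<bullet> f k j x) - (\<Sum>j\<in>J. y j \<bullet> g j x))\<^sup>2) \<le> ?u k"
    by simp
qed auto

context brownian
begin

text \<open>Fixing one sample point turns joint measurability into measurability in time. The
  indicator extends this to the whole line, as nothing is known of \<phi> outside
  \<open>{0..T}\<close>.\<close>

lemma L2_prog_deterministic: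
  assumes "(\<lambda>s \<omega>. \<phi> s) \<in> L2_prog M Filt T" and T: "0 \<le> T"
  shows "(\<lambda>s. indicat_real {0..T} s *\<^sub>R \<phi> s) \<in> borel_measurable borel"
    and "(\<integral>\<^sup>+s\<in>{0..T}. ennreal ((norm (\<phi> s))\<^sup>2) \<partial>lborel) < \<infinity>"
proof -
  obtain \<omega>0 where \<omega>0: "\<omega>0 \<in> space M" using not_empty by blast
  have "(\<lambda>(s, \<omega>). \<phi> s) \<in> borel_measurable (restrict_space borel {0..T} \<Otimes>\<^sub>M Filt T)"
    using assms by (auto simp: L2_prog_def progressively_measurable_def)
  from measurable_compose[OF measurable_Pair2'[of \<omega>0 "Filt T"] this] \<omega>0
  have "\<phi> \<in> borel_measurable (restrict_space borel {0..T})" by simp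
  then show "(\<lambda>s. indicat_real {0..T} s *\<^sub>R \<phi> s) \<in> borel_measurable borel"
    by (subst (asm) borel_measurable_restrict_space_iff) auto
  show "(\<integral>\<^sup>+s\<in>{0..T}. ennreal ((norm (\<phi> s))\<^sup>2) \<partial>lborel) < \<infinity>"
    using assms by (simp add: L2_prog_def emeasure_space_1)
qed

lemma sq_integrable_deterministic:
  assumes "(\<lambda>s \<omega>. \<phi> s) \<in> L2_prog M Filt T" and T: "0 \<le> T"
  shows "sq_integrable lborel (\<lambda>s. indicat_real {0..T} s *\<^sub>R \<phi> s)"
proof (rule sq_integrableI)
  have "(\<integral>\<^sup>+s. ennreal ((norm (indicat_real {0..T} s *\<^sub>R \<phi> s))\<^sup>2) \<partial>lborel)
      = (\<integral>\<^sup>+s\<in>{0..T}. ennreal ((norm (\<phi> s))\<^sup>2) \<partial>lborel)"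
    by (intro nn_integral_cong) (auto split: split_indicator)
  also have "\<dots> < \<infinity>" by (rule L2_prog_deterministic[OF assms])
  finally show "(\<integral>\<^sup>+s. ennreal ((norm (indicat_real {0..T} s *\<^sub>R \<phi> s))\<^sup>2) \<partial>lborel) < \<infinity>" .
qed (use L2_prog_deterministic(1)[OF assms] in simp)

text \<open>The approximating simple processes of an Ito integral with deterministic integrand may be
  replaced by their expectations: this does not increase the distance to the integrand, and the
  integrals stay close by the isometry.\<close>

lemma simple_process_expectation:
  fixes \<phi> :: "real \<Rightarrow> 'b::euclidean_space"
  assumes sp: "simple_process M Filt T N p \<xi>" and T: "0 \<le> T" and t: "0 \<le> t"
    and \<phi>: "(\<lambda>s. indicat_real {0..T} s *\<^sub>R \<phi> s) \<in> borel_measurable borel"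
  defines "c \<equiv> \<lambda>i (\<omega>::'a). expectation (\<xi> i)"
    and "e \<equiv> \<integral>\<^sup>+\<omega>. (\<integral>\<^sup>+s\<in>{0..T}. ennreal ((norm (simple_value N p \<xi> s \<omega> - \<phi> s))\<^sup>2) \<partial>lborel) \<partial>M"
  shows "simple_process M Filt T N p c"
    and "(\<integral>\<^sup>+s\<in>{0..T}. ennreal ((norm (simple_value N p c s \<omega>0 - \<phi> s))\<^sup>2) \<partial>lborel) \<le> e"
    and "(\<integral>\<^sup>+\<omega>. ennreal ((norm (simple_integral W N p c t \<omega> - simple_integral W N p \<xi> t \<omega>))\<^sup>2) \<partial>M) \<le> e"
proof -
  show spc: "simple_process M Filt T N p c"
    unfolding simple_process_def c_def
  proof (intro conjI allI impI)
    show "\<exists>K. \<forall>\<omega>\<in>space M. norm (expectation (\<xi> i)) \<le> K" for i by blast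
  qed (use sp in \<open>simp_all add: simple_process_def\<close>)
  \<comment> \<open>The fluctuation about the mean is again a simple process, so the isometry
    applies to it.\<close>
  define \<eta> where "\<eta> = (\<lambda>i \<omega>. \<xi> i \<omega> - c i \<omega>)"
  have sp\<eta>: "simple_process M Filt T N p \<eta>"
    unfolding simple_process_def
  proof (intro conjI allI impI)
    fix i assume i: "i < N"
    then have m: "\<xi> i \<in> borel_measurable (Filt (p i))" using sp by (auto simp: simple_process_def)
    show "\<eta> i \<in> borel_measurable (Filt (p i))"
      using m by (simp add: \<eta>_def c_def)
    from i sp have "\<exists>K. \<forall>\<omega>\<in>space M. norm (\<xi> i \<omega>) \<le> K" by (simp add: simple_process_def)
    then obtain K where K: "\<And>\<omega>. \<omega> \<in> space M \<Longrightarrow> norm (\<xi> i \<omega>) \<le> K" by blast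
    have "norm (\<eta> i \<omega>) \<le> K + norm (expectation (\<xi> i))" if "\<omega> \<in> space M" for \<omega>
      unfolding \<eta>_def c_def using norm_triangle_ineq4[of "\<xi> i \<omega>" "expectation (\<xi> i)"] K[OF that] by linarith
    then show "\<exists>K. \<forall>\<omega>\<in>space M. norm (\<eta> i \<omega>) \<le> K" by blast
  qed (use sp in \<open>simp_all add: simple_process_def\<close>)
  have \<xi>m: "\<xi> i \<in> borel_measurable M" if "i < N" for i
    using sp that by (intro measurable_Filt[of "\<xi> i" "p i"]) (simp add: simple_process_def)
  have \<eta>m: "\<eta> i \<in> borel_measurable M" if "i < N" for i
    using \<xi>m[OF that] by (simp add: \<eta>_def c_def)

  have sv_eq: "simple_value N p \<eta> s \<omega> = simple_value N p \<xi> s \<omega> - simple_value N p c s \<omega>" for s \<omega>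
    by (simp add: simple_value_def \<eta>_def scaleR_diff_right sum_subtractf)
  have sv_c: "simple_value N p c s \<omega> = expectation (simple_value N p \<xi> s)" for s \<omega>
    using simple_process_sq_integrable[OF sp, THEN sq_integrable_integrable]
    unfolding simple_value_def c_def by (subst Bochner_Integration.integral_sum) auto
  have sv_sq: "sq_integrable M (simple_value N p \<xi> s)" for s
    unfolding simple_value_def
    by (intro sq_integrable_sum sq_integrable_scaleR simple_process_sq_integrable[OF sp]) auto
  \<comment> \<open>Variance plus squared bias at a fixed time. After integration over time,
    dropping either term gives one of the two estimates.\<close>
  have bias: "(\<integral>\<^sup>+\<omega>. ennreal ((norm (simple_value N p \<xi> s \<omega> - \<phi> s))\<^sup>2) \<partial>M)
    = (\<integral>\<^sup>+\<omega>. ennreal ((norm (simple_value N p \<eta> s \<omega>))\<^sup>2) \<partial>M)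
      + ennreal ((norm (simple_value N p c s \<omega>0 - \<phi> s))\<^sup>2)" for s
  proof -
    have "sq_integrable M (\<lambda>\<omega>. b)" for b :: 'b
      by (rule sq_integrable_bounded[of _ "norm b"]) auto
    then have "sq_integrable M (\<lambda>\<omega>. simple_value N p \<xi> s \<omega> - b)" for b
      by (intro sq_integrable_diff sv_sq)
    from nn_integral_sq[OF this] show ?thesis
      unfolding sv_eq sv_c
      by (simp only:) (subst expectation_norm_diff_square[OF sv_sq], simp add: ennreal_plus)
  qed
  interpret P: pair_sigma_finite M lborel ..
  have pair: "(\<lambda>(\<omega>, s). simple_value N p \<zeta> s \<omega>) \<in> borel_measurable (M \<Otimes>\<^sub>M lborel)"
    if "\<And>i. i < N \<Longrightarrow> \<zeta> i \<in> borel_measurable M" for \<zeta> :: "nat \<Rightarrow> 'a \<Rightarrow> 'b"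
    unfolding simple_value_def case_prod_unfold
  proof (rule borel_measurable_sum, rule borel_measurable_scaleR)
    show "(\<lambda>x. \<zeta> i (fst x)) \<in> borel_measurable (M \<Otimes>\<^sub>M lborel)" if "i \<in> {..<N}" for i
      using that \<open>\<And>i. i < N \<Longrightarrow> \<zeta> i \<in> borel_measurable M\<close> by (intro measurable_compose[OF measurable_fst]) auto
  qed measurable
  have pair_norm: "(\<lambda>(\<omega>, s). ennreal ((norm (g \<omega> s - f s))\<^sup>2) * indicator {0..T} s) \<in> borel_measurable (M \<Otimes>\<^sub>M lborel)"
    if [measurable]: "(\<lambda>(\<omega>, s). g \<omega> s) \<in> borel_measurable (M \<Otimes>\<^sub>M lborel)" "f \<in> borel_measurable borel"
    for g :: "'a \<Rightarrow> real \<Rightarrow> 'b" and f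
    by measurable
  have e_eq: "e = (\<integral>\<^sup>+s. (\<integral>\<^sup>+\<omega>. ennreal ((norm (simple_value N p \<xi> s \<omega> - \<phi> s))\<^sup>2) \<partial>M) * indicator {0..T} s \<partial>lborel)"
  proof -
    \<comment> \<open>Fubini needs joint measurability, so \<phi> is first cut off outside
      \<open>{0..T}\<close>.\<close>
    have "e = (\<integral>\<^sup>+\<omega>. (\<integral>\<^sup>+s. ennreal ((norm (simple_value N p \<xi> s \<omega> - indicat_real {0..T} s *\<^sub>R \<phi> s))\<^sup>2) * indicator {0..T} s \<partial>lborel) \<partial>M)"
      unfolding e_def by (intro nn_integral_cong) (auto split: split_indicator)
    also have "\<dots> = (\<integral>\<^sup>+s. (\<integral>\<^sup>+\<omega>. ennreal ((norm (simple_value N p \<xi> s \<omega> - indicat_real {0..T} s *\<^sub>R \<phi> s))\<^sup>2) * indicator {0..T} s \<partial>M) \<partial>lborel)"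
      by (rule P.Fubini' [symmetric], rule pair_norm[OF pair[OF \<xi>m] \<phi>])
    also have "\<dots> = (\<integral>\<^sup>+s. (\<integral>\<^sup>+\<omega>. ennreal ((norm (simple_value N p \<xi> s \<omega> - \<phi> s))\<^sup>2) \<partial>M) * indicator {0..T} s \<partial>lborel)"
      by (intro nn_integral_cong) (auto split: split_indicator)
    finally show ?thesis .
  qed
  show "(\<integral>\<^sup>+s\<in>{0..T}. ennreal ((norm (simple_value N p c s \<omega>0 - \<phi> s))\<^sup>2) \<partial>lborel) \<le> e"
    unfolding e_eq bias by (intro nn_integral_mono mult_right_mono) auto
  have "(\<integral>\<^sup>+\<omega>. ennreal ((norm (simple_integral W N p \<eta> t \<omega>))\<^sup>2) \<partial>M)
      \<le> (\<integral>\<^sup>+\<omega>. (\<integral>\<^sup>+s\<in>{0..T}. ennreal ((norm (simple_value N p \<eta> s \<omega>))\<^sup>2) \<partial>lborel) \<partial>M)"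
    by (rule simple_integral_le[OF sp\<eta> t])
  also have "\<dots> = (\<integral>\<^sup>+s. (\<integral>\<^sup>+\<omega>. ennreal ((norm (simple_value N p \<eta> s \<omega>))\<^sup>2) * indicator {0..T} s \<partial>M) \<partial>lborel)"
    by (rule P.Fubini' [symmetric], rule pair_norm[OF pair[OF \<eta>m] borel_measurable_const[of 0], simplified])
  also have "\<dots> \<le> e"
    unfolding e_eq bias by (intro nn_integral_mono) (auto split: split_indicator)
  finally show "(\<integral>\<^sup>+\<omega>. ennreal ((norm (simple_integral W N p c t \<omega> - simple_integral W N p \<xi> t \<omega>))\<^sup>2) \<partial>M) \<le> e"
    by (subst norm_minus_commute)
       (simp add: simple_integral_def \<eta>_def scaleR_diff_right sum_subtractf)
qed

lemma ito_integral_measurable: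
  assumes "ito_integral M Filt W T \<phi> I" and "t \<in> {0..T}"
  shows "I t \<in> borel_measurable M"
proof (rule measurable_Filt)
  show "I t \<in> borel_measurable (Filt t)" using assms by (simp add: ito_integral_def)
qed

text \<open>The averaged processes inherit both convergences from the given ones. Since the values
  \<open>c k i\<close> are constants, \<open>\<zeta>\<close> is only a dummy sample point.\<close>

lemma ito_integral_deterministic_approx:
  fixes \<phi> :: "real \<Rightarrow> 'b::euclidean_space" and \<zeta> :: 'a
  assumes ito: "ito_integral M Filt W T (\<lambda>s \<omega>. \<phi> s) I" and T: "0 \<le> T"
  obtains N p c where "\<And>k. simple_process M Filt T (N k) (p k) (\<lambda>i \<omega>. c k i)"
    and "(\<lambda>k. \<integral>\<^sup>+s\<in>{0..T}. ennreal ((norm (simple_value (N k) (p k) (\<lambda>i \<omega>. c k i) s \<zeta> - \<phi> s))\<^sup>2) \<partial>lborel) \<longlonglongrightarrow> 0"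
    and "\<And>t. t \<in> {0..T} \<Longrightarrow>
      (\<lambda>k. \<integral>\<^sup>+\<omega>. ennreal ((norm (simple_integral W (N k) (p k) (\<lambda>i \<omega>. c k i) t \<omega> - I t \<omega>))\<^sup>2) \<partial>M) \<longlonglongrightarrow> 0"
proof -
  from ito have L2: "(\<lambda>s \<omega>. \<phi> s) \<in> L2_prog M Filt T" by (simp add: ito_integral_def)
  note \<phi> = L2_prog_deterministic(1)[OF L2 T]
  from ito obtain N p \<xi> where
    sp: "\<And>k. simple_process M Filt T (N k) (p k) (\<xi> k)" and
    e: "(\<lambda>k. \<integral>\<^sup>+\<omega>. (\<integral>\<^sup>+s\<in>{0..T}. ennreal ((norm (simple_value (N k) (p k) (\<xi> k) s \<omega> - \<phi> s))\<^sup>2) \<partial>lborel) \<partial>M) \<longlonglongrightarrow> 0"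
      (is "?e \<longlonglongrightarrow> 0") and
    d: "\<And>t. t \<in> {0..T} \<Longrightarrow> (\<lambda>k. \<integral>\<^sup>+\<omega>. ennreal ((norm (simple_integral W (N k) (p k) (\<xi> k) t \<omega> - I t \<omega>))\<^sup>2) \<partial>M) \<longlonglongrightarrow> 0"
    unfolding ito_integral_def by blast
  define c where "c k i = expectation (\<xi> k i)" for k i
  note E = simple_process_expectation[OF sp T _ \<phi>, folded c_def]
  show thesis
  proof (rule that[of N p c])
    show "simple_process M Filt T (N k) (p k) (\<lambda>i \<omega>. c k i)" for k
      by (rule E(1)[OF order_refl])
    show "(\<lambda>k. \<integral>\<^sup>+s\<in>{0..T}. ennreal ((norm (simple_value (N k) (p k) (\<lambda>i \<omega>. c k i) s \<zeta> - \<phi> s))\<^sup>2) \<partial>lborel) \<longlonglongrightarrow> 0"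
    proof (rule tendsto_sandwich[OF _ _ tendsto_const e])
      show "\<forall>\<^sub>F k in sequentially. (\<integral>\<^sup>+s\<in>{0..T}. ennreal ((norm (simple_value (N k) (p k) (\<lambda>i \<omega>. c k i) s \<zeta> - \<phi> s))\<^sup>2) \<partial>lborel) \<le> ?e k"
        by (rule always_eventually, rule allI, rule E(2)[OF order_refl])
    qed simp
    fix t assume t: "t \<in> {0..T}"
    let ?J = "\<lambda>k. simple_integral W (N k) (p k) (\<lambda>i \<omega>. c k i) t"
    let ?S = "\<lambda>k. simple_integral W (N k) (p k) (\<xi> k) t"
    have m: "?J k \<in> borel_measurable M" "?S k \<in> borel_measurable M" "I t \<in> borel_measurable M" for k
      using simple_integral_isometry(2)[OF sp _ order_refl] simple_integral_isometry(2)[OF E(1)[OF order_refl] _ order_refl]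
        t ito_integral_measurable[OF ito t] by (simp_all add: sq_integrable_def)
    show "(\<lambda>k. \<integral>\<^sup>+\<omega>. ennreal ((norm (?J k \<omega> - I t \<omega>))\<^sup>2) \<partial>M) \<longlonglongrightarrow> 0"
    \<comment> \<open>Averaging moves the integral by at most the error \<open>?e k\<close>, and the
      original integrals converge to \<open>I t\<close>; the factors 2 come from squaring a
      sum.\<close>
    proof (rule tendsto_0_ennreal_double_add[OF e d[OF t]])
      fix k
      have "(\<integral>\<^sup>+\<omega>. ennreal ((norm (?J k \<omega> - I t \<omega>))\<^sup>2) \<partial>M)
        \<le> (\<integral>\<^sup>+\<omega>. 2 * ennreal ((norm (?J k \<omega> - ?S k \<omega>))\<^sup>2) + 2 * ennreal ((norm (?S k \<omega> - I t \<omega>))\<^sup>2) \<partial>M)"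
      proof (rule nn_integral_mono)
        show "ennreal ((norm (?J k \<omega> - I t \<omega>))\<^sup>2)
          \<le> 2 * ennreal ((norm (?J k \<omega> - ?S k \<omega>))\<^sup>2) + 2 * ennreal ((norm (?S k \<omega> - I t \<omega>))\<^sup>2)" for \<omega>
          using ennreal_norm_add_square_le[of "?J k \<omega> - ?S k \<omega>" "?S k \<omega> - I t \<omega>"] by simp
      qed
      also have "\<dots> = 2 * (\<integral>\<^sup>+\<omega>. ennreal ((norm (?J k \<omega> - ?S k \<omega>))\<^sup>2) \<partial>M)
          + 2 * (\<integral>\<^sup>+\<omega>. ennreal ((norm (?S k \<omega> - I t \<omega>))\<^sup>2) \<partial>M)"
        using m by (simp add: nn_integral_add nn_integral_cmult)
      also have "\<dots> \<le> 2 * ?e k + 2 * (\<integral>\<^sup>+\<omega>. ennreal ((norm (?S k \<omega> - I t \<omega>))\<^sup>2) \<partial>M)"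
        using t by (intro add_mono mult_left_mono E(3)) auto
      finally show "(\<integral>\<^sup>+\<omega>. ennreal ((norm (?J k \<omega> - I t \<omega>))\<^sup>2) \<partial>M)
        \<le> 2 * ?e k + 2 * (\<integral>\<^sup>+\<omega>. ennreal ((norm (?S k \<omega> - I t \<omega>))\<^sup>2) \<partial>M)" .
    qed
  qed
qed

text \<open>Some square integrable simple integral has finite mean square distance from
  \<open>I t\<close>.\<close>

lemma ito_integral_sq_integrable:
  fixes \<phi> :: "real \<Rightarrow> 'a \<Rightarrow> 'b::euclidean_space"
  assumes ito: "ito_integral M Filt W T \<phi> I" and t: "t \<in> {0..T}"
  shows "sq_integrable M (I t)"
proof -
  from ito t obtain N p \<xi> where
    sp: "\<And>k. simple_process M Filt T (N k) (p k) (\<xi> k)" and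
    d: "(\<lambda>k. \<integral>\<^sup>+\<omega>. ennreal ((norm (simple_integral W (N k) (p k) (\<xi> k) t \<omega> - I t \<omega>))\<^sup>2) \<partial>M) \<longlonglongrightarrow> 0"
    unfolding ito_integral_def by blast
  let ?S = "\<lambda>k. simple_integral W (N k) (p k) (\<xi> k) t"
  have "I t \<in> borel_measurable M" by (rule ito_integral_measurable[OF ito t])
  moreover have S: "sq_integrable M (?S k)" for k
    using simple_integral_isometry(2)[OF sp _ order_refl] t by simp
  moreover have "\<forall>\<^sub>F k in sequentially. (\<integral>\<^sup>+\<omega>. ennreal ((norm (?S k \<omega> - I t \<omega>))\<^sup>2) \<partial>M) < 1"
    using d by (rule order_tendstoD) simp
  then obtain k where "(\<integral>\<^sup>+\<omega>. ennreal ((norm (?S k \<omega> - I t \<omega>))\<^sup>2) \<partial>M) < 1"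
    using eventually_happens by fastforce
  moreover have "?S k \<in> borel_measurable M" using S[of k] by (simp add: sq_integrable_def)
  ultimately have "sq_integrable M (\<lambda>\<omega>. ?S k \<omega> - I t \<omega>)"
    by (intro sq_integrableI borel_measurable_diff) (auto intro: order.strict_trans)
  from sq_integrable_diff[OF S[of k] this] show ?thesis by simp
qed

text \<open>Simple integrals with constant values are combinations of centred variables, and means
  pass to mean square limits.\<close>

lemma ito_integral_deterministic_mean:
  fixes \<phi> :: "real \<Rightarrow> 'b::euclidean_space"
  assumes ito: "ito_integral M Filt W T (\<lambda>s \<omega>. \<phi> s) I" and T: "0 \<le> T" and t: "t \<in> {0..T}"
  shows "expectation (I t) = 0"
proof -
  obtain N p c where sp: "\<And>k. simple_process M Filt T (N k) (p k) (\<lambda>i \<omega>. c k i)"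
    and "(\<lambda>k. \<integral>\<^sup>+s\<in>{0..T}. ennreal ((norm (simple_value (N k) (p k) (\<lambda>i \<omega>. c k i) s (undefined :: 'a) - \<phi> s))\<^sup>2) \<partial>lborel) \<longlonglongrightarrow> 0"
    and lim: "\<And>t. t \<in> {0..T} \<Longrightarrow>
      (\<lambda>k. \<integral>\<^sup>+\<omega>. ennreal ((norm (simple_integral W (N k) (p k) (\<lambda>i \<omega>. c k i) t \<omega> - I t \<omega>))\<^sup>2) \<partial>M) \<longlonglongrightarrow> 0"
    by (rule ito_integral_deterministic_approx[OF ito T, where \<zeta> = undefined], rule that, simp_all)
  let ?J = "\<lambda>k. simple_integral W (N k) (p k) (\<lambda>i \<omega>. c k i) t"
  have J: "sq_integrable M (?J k)" for k
    using simple_integral_isometry(2)[OF sp _ order_refl] t by simp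
  have I: "sq_integrable M (I t)" by (rule ito_integral_sq_integrable[OF ito t])
  have "(\<lambda>k. LINT \<omega>|M. (norm (?J k \<omega> - I t \<omega>))\<^sup>2) \<longlonglongrightarrow> 0"
    using lim[OF t] unfolding nn_integral_sq[OF sq_integrable_diff[OF J I]]
    by (simp add: ennreal_0 [symmetric] del: ennreal_0)
  from L2_tendsto_mean[OF J I this] have "(\<lambda>k. expectation (?J k)) \<longlonglongrightarrow> expectation (I t)" .
  moreover have "expectation (?J k) = 0" for k
  proof -
    have "0 \<le> min t (p k i)" if "i \<le> N k" for i
      using simple_process_nonneg[OF sp that] t by simp
    then have "integrable M (W (min t (p k i)))" "expectation (W (min t (p k i))) = 0" if "i \<le> N k" for i
      using that sq_integrable_W[THEN sq_integrable_integrable] W_mean by auto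
    then show ?thesis
      unfolding simple_integral_def by (subst Bochner_Integration.integral_sum) auto
  qed
  ultimately show ?thesis by (simp add: LIMSEQ_const_iff)
qed

text \<open>With constant values, a combination of simple integrals is a combination of values of
  \<open>W\<close>, whose characteristic function is known; both sides pass to the mean square
  limit.\<close>

lemma ito_integral_deterministic_char:
  fixes \<phi> :: "real \<Rightarrow> 'b::euclidean_space" and w :: "'j \<Rightarrow> 'b"
  assumes ito: "ito_integral M Filt W T (\<lambda>s \<omega>. \<phi> s) I" and T: "0 \<le> T"
    and J: "finite J" "\<And>j. j \<in> J \<Longrightarrow> \<tau> j \<in> {0..T}"
  shows "(CLINT \<omega>|M. iexp (\<Sum>j\<in>J. w j \<bullet> I (\<tau> j) \<omega>))
    = exp (- (LBINT s. (\<Sum>j\<in>J. indicat_real {0<..\<tau> j} s * (w j \<bullet> \<phi> s))\<^sup>2) / 2)"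
proof -
  obtain N p c where sp: "\<And>k. simple_process M Filt T (N k) (p k) (\<lambda>i \<omega>. c k i)"
    and lim\<phi>: "(\<lambda>k. \<integral>\<^sup>+s\<in>{0..T}. ennreal ((norm (simple_value (N k) (p k) (\<lambda>i \<omega>. c k i) s (undefined :: 'a) - \<phi> s))\<^sup>2) \<partial>lborel) \<longlonglongrightarrow> 0"
    and limI: "\<And>t. t \<in> {0..T} \<Longrightarrow>
      (\<lambda>k. \<integral>\<^sup>+\<omega>. ennreal ((norm (simple_integral W (N k) (p k) (\<lambda>i \<omega>. c k i) t \<omega> - I t \<omega>))\<^sup>2) \<partial>M) \<longlonglongrightarrow> 0"
    by (rule ito_integral_deterministic_approx[OF ito T, where \<zeta> = undefined], rule that, simp_all)
  define S where "S k = simple_integral W (N k) (p k) (\<lambda>i \<omega>. c k i)" for k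
  define v where "v k s = simple_value (N k) (p k) (\<lambda>i \<omega>. c k i) s (undefined :: 'a)" for k s
  define \<phi>0 where "\<phi>0 s = indicat_real {0..T} s *\<^sub>R \<phi> s" for s
  have \<phi>0: "sq_integrable lborel \<phi>0"
    unfolding \<phi>0_def [abs_def]
    by (rule sq_integrable_deterministic[OF _ T]) (use ito in \<open>simp add: ito_integral_def\<close>)
  have p0: "0 \<le> p k i \<and> p k i \<le> T" if "i \<le> N k" for k i
    using simple_process_nonneg[OF sp that] by simp
  have v_out: "v k s = 0" if "s \<notin> {0..T}" for k s
  proof -
    have "s \<notin> {p k i<..p k (Suc i)}" if "i < N k" for i
      using p0[of i k] p0[of "Suc i" k] that \<open>s \<notin> {0..T}\<close> by auto
    then show ?thesis by (auto simp: v_def simple_value_def intro!: sum.neutral)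
  qed
  have vc: "sq_integrable lborel (\<lambda>s. indicat_real {a<..b} s *\<^sub>R y)" for a b :: real and y :: 'b
  proof -
    have "(norm (indicat_real {a<..b} s *\<^sub>R y))\<^sup>2 = indicat_real {a<..b} s * (norm y)\<^sup>2" for s
      by (auto split: split_indicator)
    moreover have "integrable lborel (indicat_real {a<..b})"
      using emeasure_bounded_finite[of "{a<..b}"] by (intro integrable_real_indicator) auto
    moreover have "(\<lambda>s. indicat_real {a<..b} s *\<^sub>R y) \<in> borel_measurable lborel" by measurable
    ultimately show ?thesis unfolding sq_integrable_def by (simp only: integrable_mult_left simp_thms)
  qed
  have v: "sq_integrable lborel (v k)" for k
    unfolding v_def simple_value_def by (intro sq_integrable_sum vc)
  have S: "sq_integrable M (S k t)" if "t \<in> {0..T}" for k t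
    unfolding S_def using simple_integral_isometry(2)[OF sp _ order_refl] that by simp
  have I: "sq_integrable M (I t)" if "t \<in> {0..T}" for t
    by (rule ito_integral_sq_integrable[OF ito that])
  define h where "h s = (\<Sum>j\<in>J. w j \<bullet> (indicat_real {0<..\<tau> j} s *\<^sub>R \<phi>0 s))" for s
  define hk where "hk k s = (\<Sum>j\<in>J. w j \<bullet> (indicat_real {0<..\<tau> j} s *\<^sub>R v k s))" for k s
  define G where "G \<omega> = (\<Sum>j\<in>J. w j \<bullet> I (\<tau> j) \<omega>)" for \<omega>
  define Gk where "Gk k \<omega> = (\<Sum>j\<in>J. w j \<bullet> S k (\<tau> j) \<omega>)" for k \<omega>
  have h_eq: "h s = (\<Sum>j\<in>J. indicat_real {0<..\<tau> j} s * (w j \<bullet> \<phi> s))" for s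
    unfolding h_def
  proof (rule sum.cong[OF refl])
    fix j assume "j \<in> J"
    then have "\<tau> j \<le> T" using J(2)[of j] by simp
    then show "w j \<bullet> (indicat_real {0<..\<tau> j} s *\<^sub>R \<phi>0 s) = indicat_real {0<..\<tau> j} s * (w j \<bullet> \<phi> s)"
      by (auto simp: \<phi>0_def split: split_indicator)
  qed
  have h: "sq_integrable lborel h"
    unfolding h_def by (intro sq_integrable_sum sq_integrable_inner_const sq_integrable_indicator_scaleR \<phi>0) auto
  have hk: "sq_integrable lborel (hk k)" for k
    unfolding hk_def by (intro sq_integrable_sum sq_integrable_inner_const sq_integrable_indicator_scaleR v) auto
  have G: "sq_integrable M G"
    unfolding G_def by (intro sq_integrable_sum sq_integrable_inner_const I J)
  have Gk: "sq_integrable M (Gk k)" for k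
    unfolding Gk_def by (intro sq_integrable_sum sq_integrable_inner_const S J)
  have lim\<phi>0: "(\<lambda>k. LBINT s. (norm (v k s - \<phi>0 s))\<^sup>2) \<longlonglongrightarrow> 0"
  proof -
    have "(\<integral>\<^sup>+s\<in>{0..T}. ennreal ((norm (simple_value (N k) (p k) (\<lambda>i \<omega>. c k i) s (undefined :: 'a) - \<phi> s))\<^sup>2) \<partial>lborel)
      = (\<integral>\<^sup>+s. ennreal ((norm (v k s - \<phi>0 s))\<^sup>2) \<partial>lborel)" for k
      using v_out[of _ k] by (intro nn_integral_cong) (auto simp: v_def \<phi>0_def split: split_indicator)
    with lim\<phi> show ?thesis
      unfolding nn_integral_sq[OF sq_integrable_diff[OF v \<phi>0]]
      by (simp add: ennreal_0 [symmetric] del: ennreal_0)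
  qed
  have limh: "(\<lambda>k. LBINT s. (hk k s - h s)\<^sup>2) \<longlonglongrightarrow> 0"
    unfolding h_def hk_def
  proof (rule L2_tendsto_inner_sum[OF J(1)])
    fix j
    have i: "integrable lborel (\<lambda>s. (norm (v k s - \<phi>0 s))\<^sup>2)"
      "integrable lborel (\<lambda>s. (norm (indicat_real {0<..\<tau> j} s *\<^sub>R (v k s - \<phi>0 s)))\<^sup>2)" for k
      using sq_integrable_diff[OF v[of k] \<phi>0] sq_integrable_indicator_scaleR[OF sq_integrable_diff[OF v[of k] \<phi>0], of "{0<..\<tau> j}"]
      by (simp_all add: sq_integrable_def)
    show "(\<lambda>k. LBINT s. (norm (indicat_real {0<..\<tau> j} s *\<^sub>R v k s - indicat_real {0<..\<tau> j} s *\<^sub>R \<phi>0 s))\<^sup>2) \<longlonglongrightarrow> 0"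
    proof (rule tendsto_sandwich[OF _ _ tendsto_const lim\<phi>0])
      show "\<forall>\<^sub>F k in sequentially. (LBINT s. (norm (indicat_real {0<..\<tau> j} s *\<^sub>R v k s - indicat_real {0<..\<tau> j} s *\<^sub>R \<phi>0 s))\<^sup>2)
          \<le> (LBINT s. (norm (v k s - \<phi>0 s))\<^sup>2)"
        unfolding scaleR_diff_right [symmetric]
        by (intro always_eventually allI integral_mono i) (auto split: split_indicator)
    qed simp
  qed (intro sq_integrable_indicator_scaleR v \<phi>0; simp)+
  have limG: "(\<lambda>k. LINT \<omega>|M. (Gk k \<omega> - G \<omega>)\<^sup>2) \<longlonglongrightarrow> 0"
    unfolding G_def Gk_def
  proof (rule L2_tendsto_inner_sum[OF J(1)])
    fix j assume "j \<in> J"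
    then have t: "\<tau> j \<in> {0..T}" by (rule J)
    show "sq_integrable M (S k (\<tau> j))" "sq_integrable M (I (\<tau> j))" for k by (intro S I t)+
    show "(\<lambda>k. LINT \<omega>|M. (norm (S k (\<tau> j) \<omega> - I (\<tau> j) \<omega>))\<^sup>2) \<longlonglongrightarrow> 0"
      using limI[OF t] unfolding S_def [symmetric] nn_integral_sq[OF sq_integrable_diff[OF S[OF t] I[OF t]]]
      by (simp add: ennreal_0 [symmetric] del: ennreal_0)
  qed
  have char: "(CLINT \<omega>|M. iexp (Gk k \<omega>)) = exp (- (LBINT s. (hk k s)\<^sup>2) / 2)" for k
  proof -
    \<comment> \<open>Each increment contributes two values of \<open>W\<close>: the Boolean selects
      the endpoint in \<open>\<sigma>\<close> and the sign in \<open>a\<close>.\<close>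
    define L where "L = J \<times> {..<N k} \<times> (UNIV :: bool set)"
    define a where "a = (\<lambda>(j, i, b). if b then w j \<bullet> c k i else - (w j \<bullet> c k i))"
    define \<sigma> where "\<sigma> = (\<lambda>(j, i, b). min (\<tau> j) (p k (if b then Suc i else i)))"
    have L: "0 \<le> \<sigma> l" if l: "l \<in> L" for l
    proof -
      from l obtain j i b where l: "l = (j, i, b)" "j \<in> J" "i < N k" by (auto simp: L_def)
      have "0 \<le> p k (if b then Suc i else i)" using p0[of i k] p0[of "Suc i" k] l by auto
      then show ?thesis using J(2)[OF l(2)] by (simp add: \<sigma>_def l)
    qed
    have sum: "(\<Sum>l\<in>L. a l * f (\<sigma> l))
      = (\<Sum>j\<in>J. \<Sum>i<N k. (w j \<bullet> c k i) * (f (min (\<tau> j) (p k (Suc i))) - f (min (\<tau> j) (p k i))))" for f :: "real \<Rightarrow> real"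
    proof -
      have "(\<Sum>l\<in>L. a l * f (\<sigma> l)) = (\<Sum>j\<in>J. \<Sum>i<N k. \<Sum>b\<in>UNIV. a (j, i, b) * f (\<sigma> (j, i, b)))"
        unfolding L_def sum.cartesian_product by (intro sum.cong refl) auto
      then show ?thesis by (simp add: UNIV_bool a_def \<sigma>_def algebra_simps)
    qed
    have "Gk k \<omega> = (\<Sum>l\<in>L. a l * W (\<sigma> l) \<omega>)" for \<omega>
      unfolding sum[of "\<lambda>t. W t \<omega>"] Gk_def S_def simple_integral_def inner_sum_right
      by (intro sum.cong refl) simp
    moreover have "hk k s = (\<Sum>l\<in>L. a l * indicat_real {0<..\<sigma> l} s)" for s
      unfolding sum[of "\<lambda>t. indicat_real {0<..t} s"] hk_def v_def simple_value_def scaleR_sum_right inner_sum_right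
    proof (intro sum.cong refl)
      fix j i assume "i \<in> {..<N k}"
      then have "0 \<le> p k i" "p k i \<le> p k (Suc i)"
        using p0[of i k] simple_process_mono[OF sp, of i "Suc i" k] by auto
      \<comment> \<open>Stopping an interval at \<open>\<tau> j\<close> amounts to stopping both of
        its endpoints.\<close>
      then have "indicat_real {0<..\<tau> j} s * indicat_real {p k i<..p k (Suc i)} s
        = indicat_real {0<..min (\<tau> j) (p k (Suc i))} s - indicat_real {0<..min (\<tau> j) (p k i)} s"
        by (auto split: split_indicator)
      then show "w j \<bullet> (indicat_real {0<..\<tau> j} s *\<^sub>R indicat_real {p k i<..p k (Suc i)} s *\<^sub>R c k i)
        = (w j \<bullet> c k i) * (indicat_real {0<..min (\<tau> j) (p k (Suc i))} s - indicat_real {0<..min (\<tau> j) (p k i)} s)"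
        by (simp add: mult.assoc [symmetric])
    qed
    moreover have "(CLINT \<omega>|M. iexp (\<Sum>l\<in>L. a l * W (\<sigma> l) \<omega>))
      = exp (- (LBINT s. (\<Sum>l\<in>L. a l * indicat_real {0<..\<sigma> l} s)\<^sup>2) / 2)"
      by (intro char_combination L) (simp_all add: L_def J(1))
    ultimately show ?thesis by (simp only:)
  qed
  have "(\<lambda>k. CLINT \<omega>|M. iexp (Gk k \<omega>)) \<longlonglongrightarrow> (CLINT \<omega>|M. iexp (G \<omega>))"
    by (rule L2_tendsto_char[OF Gk G limG])
  moreover have "(\<lambda>k. complex_of_real (exp (- (LBINT s. (hk k s)\<^sup>2) / 2))) \<longlonglongrightarrow> exp (- (LBINT s. (h s)\<^sup>2) / 2)"
    by (intro tendsto_intros tendsto_integral_square[OF h hk limh]) simp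
  ultimately have "(CLINT \<omega>|M. iexp (G \<omega>)) = exp (- (LBINT s. (h s)\<^sup>2) / 2)"
    unfolding char by (rule LIMSEQ_unique)
  then show ?thesis unfolding G_def h_eq .
qed

end

section \<open>Riemann--Stieltjes sums\<close>

text \<open>On each cell the increment of \<open>f\<close> is the integral of \<open>f'\<close>, so
  the error integrates \<open>f'\<close> against the deviation of \<open>g\<close> from its right
  end value. As \<epsilon> need not be small, the estimate serves for convergence and, with a crude
  oscillation bound, for domination.\<close>

lemma Riemann_Stieltjes_estimate:
  fixes f :: "real \<Rightarrow> 'a::euclidean_space" and g :: "real \<Rightarrow> 'b::euclidean_space"
    and pr :: "'a \<Rightarrow> 'b \<Rightarrow> 'c::euclidean_space"
  assumes pr: "bounded_bilinear pr"
    and f: "\<And>s. (f has_vector_derivative f' s) (at s)" and f': "continuous_on UNIV f'"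
    and K: "\<And>s y. s \<in> {q 0..q n} \<Longrightarrow> norm (pr (f' s) y) \<le> K * norm y"
    and g: "continuous_on {q 0..q n} g"
    and q: "\<And>j. j < n \<Longrightarrow> q j \<le> q (Suc j)"
    and osc: "\<And>j s. j < n \<Longrightarrow> s \<in> {q j..q (Suc j)} \<Longrightarrow> norm (g (q (Suc j)) - g s) \<le> \<epsilon>"
    and K0: "0 \<le> K"
  shows "norm ((\<Sum>j<n. pr (f (q (Suc j)) - f (q j)) (g (q (Suc j))))
      - integral {q 0..q n} (\<lambda>s. pr (f' s) (g s))) \<le> K * \<epsilon> * (q n - q 0)"
  using K g q osc
proof (induction n)
  case 0
  then show ?case by (simp add: bounded_bilinear.zero_left[OF pr])
next
  case (Suc n)
  let ?a = "q n" and ?b = "q (Suc n)"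
  have mono: "q 0 \<le> q m" if "m \<le> Suc n" for m
    using that by (induction m) (use Suc.prems(3) in \<open>auto intro: order_trans\<close>)
  have ab: "q 0 \<le> ?a" "?a \<le> ?b" using mono[of n] Suc.prems(3)[of n] by auto
  have cont: "continuous_on {q 0..?b} (\<lambda>s. pr (f' s) (g s))"
    using Suc.prems(2) continuous_on_subset[OF f']
    by (intro bounded_bilinear.continuous_on[OF pr]) auto
  have int: "(\<lambda>s. pr (f' s) (g s)) integrable_on {q 0..?b}"
    by (rule integrable_continuous_interval[OF cont])
  have int_ab: "(\<lambda>s. pr (f' s) (g s)) integrable_on {?a..?b}"
    using ab by (intro integrable_continuous_interval continuous_on_subset[OF cont]) auto
  have "((\<lambda>s. pr (f' s) (g ?b)) has_integral pr (f ?b) (g ?b) - pr (f ?a) (g ?b)) {?a..?b}"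
  proof (rule fundamental_theorem_of_calculus[OF ab(2)])
    fix s
    show "((\<lambda>s. pr (f s) (g ?b)) has_vector_derivative pr (f' s) (g ?b)) (at s within {?a..?b})"
      using bounded_linear.has_vector_derivative[OF bounded_bilinear.bounded_linear_left[OF pr]
          has_vector_derivative_at_within[OF f]] .
  qed
  from has_integral_diff[OF this integrable_integral[OF int_ab]]
  have d: "((\<lambda>s. pr (f' s) (g ?b - g s)) has_integral
      pr (f ?b - f ?a) (g ?b) - integral {?a..?b} (\<lambda>s. pr (f' s) (g s))) {?a..?b}"
    by (simp add: bounded_bilinear.diff_left[OF pr] bounded_bilinear.diff_right[OF pr])
  have "norm (pr (f ?b - f ?a) (g ?b) - integral {?a..?b} (\<lambda>s. pr (f' s) (g s)))
      \<le> (K * \<epsilon>) * (?b - ?a)"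
  proof -
    have \<epsilon>: "0 \<le> \<epsilon>" using Suc.prems(4)[of n ?b] ab by simp
    have "norm (pr (f' s) (g ?b - g s)) \<le> K * \<epsilon>" if "s \<in> {?a..?b}" for s
    proof -
      have "norm (pr (f' s) (g ?b - g s)) \<le> K * norm (g ?b - g s)"
        using that ab by (intro Suc.prems(1)) auto
      also have "\<dots> \<le> K * \<epsilon>" using Suc.prems(4)[of n s] that K0 by (intro mult_left_mono) auto
      finally show ?thesis .
    qed
    then show ?thesis
      using has_integral_bound[of "K * \<epsilon>" "\<lambda>s. pr (f' s) (g ?b - g s)" _ ?a ?b] d K0 \<epsilon> ab
      by (auto simp: content_real)
  qed
  moreover have "norm ((\<Sum>j<n. pr (f (q (Suc j)) - f (q j)) (g (q (Suc j))))
      - integral {q 0..?a} (\<lambda>s. pr (f' s) (g s))) \<le> K * \<epsilon> * (?a - q 0)"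
  proof (rule Suc.IH)
    show "norm (pr (f' s) y) \<le> K * norm y" if "s \<in> {q 0..?a}" for s y
      using that ab by (intro Suc.prems(1)) auto
    show "continuous_on {q 0..?a} g"
      using ab by (intro continuous_on_subset[OF Suc.prems(2)]) auto
  qed (use Suc.prems(3,4) in auto)
  moreover have "integral {q 0..?b} (\<lambda>s. pr (f' s) (g s))
      = integral {q 0..?a} (\<lambda>s. pr (f' s) (g s)) + integral {?a..?b} (\<lambda>s. pr (f' s) (g s))"
    using Henstock_Kurzweil_Integration.integral_combine[OF ab int] by simp
  ultimately show ?case
    using norm_triangle_ineq[of "(\<Sum>j<n. pr (f (q (Suc j)) - f (q j)) (g (q (Suc j)))) - integral {q 0..?a} (\<lambda>s. pr (f' s) (g s))"
        "pr (f ?b - f ?a) (g ?b) - integral {?a..?b} (\<lambda>s. pr (f' s) (g s))"]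
    by (simp add: algebra_simps)
qed

text \<open>The uniform partition of \<open>{0..T}\<close> into \<open>Suc n\<close> cells, stopped
  at \<open>t\<close>: one partition serves all times, and the points beyond \<open>t\<close>
  collapse to \<open>t\<close> and contribute no increment.\<close>

definition grid :: "real \<Rightarrow> real \<Rightarrow> nat \<Rightarrow> nat \<Rightarrow> real" where
  "grid T t n j = min t (real j * T / real (Suc n))"

lemma grid_0: "0 \<le> t \<Longrightarrow> grid T t n 0 = 0"
  and grid_end: "t \<le> T \<Longrightarrow> grid T t n (Suc n) = t"
  by (simp_all add: grid_def)

lemma grid_bounds:
  assumes "0 < T" "t \<in> {0..T}"
  shows "grid T t n j \<in> {0..t}" "grid T t n j \<le> grid T t n (Suc j)"
    "grid T t n (Suc j) - grid T t n j \<le> T / real (Suc n)"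
proof -
  have *: "min t a \<in> {0..t} \<and> min t a \<le> min t (a + h) \<and> min t (a + h) - min t a \<le> h"
    if "0 \<le> a" "0 \<le> h" for a h
    using assms that by (auto simp: min_def)
  have "real (Suc j) * T / real (Suc n) = real j * T / real (Suc n) + T / real (Suc n)"
    by (simp only: of_nat_Suc distrib_right add_divide_distrib mult_1_left)
  moreover have "0 \<le> T / real (Suc n)" "0 \<le> real j * T / real (Suc n)" using assms by auto
  ultimately show "grid T t n j \<in> {0..t}" "grid T t n j \<le> grid T t n (Suc j)"
    "grid T t n (Suc j) - grid T t n j \<le> T / real (Suc n)"
    unfolding grid_def using * by simp_all
qed

text \<open>Compactness of the image of \<open>{0..T}\<close>. With the matrix-vector product as
  \<open>pr\<close>, this also bounds a continuous family of matrices uniformly.\<close>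

lemma Riemann_Stieltjes_bound:
  fixes f' :: "real \<Rightarrow> 'a::euclidean_space" and pr :: "'a \<Rightarrow> 'b::euclidean_space \<Rightarrow> 'c::euclidean_space"
  assumes pr: "bounded_bilinear pr" and f': "continuous_on UNIV f'"
  obtains K where "0 < K" "\<And>s y. s \<in> {0..T} \<Longrightarrow> norm (pr (f' s) y) \<le> K * norm y"
proof -
  obtain L where L: "0 < L" "\<And>a b. norm (pr a b) \<le> norm a * norm b * L"
    using bounded_bilinear.pos_bounded[OF pr] by blast
  have "compact (f' ` {0..T})"
    by (intro compact_continuous_image continuous_on_subset[OF f']) auto
  then obtain B where B: "0 < B" "\<And>s. s \<in> {0..T} \<Longrightarrow> norm (f' s) \<le> B"
    using compact_imp_bounded bounded_pos by (metis image_eqI)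
  show thesis
  proof (rule that[of "B * L"])
    show "0 < B * L" using B L by simp
    fix s :: real and y :: 'b assume "s \<in> {0..T}"
    then have "norm (f' s) * norm y * L \<le> B * norm y * L"
      using B L by (intro mult_right_mono) auto
    with L(2)[of "f' s" y] show "norm (pr (f' s) y) \<le> B * L * norm y"
      by (simp add: mult.assoc mult.left_commute mult.commute)
  qed
qed

lemma Riemann_Stieltjes_tendsto:
  fixes f :: "real \<Rightarrow> 'a::euclidean_space" and g :: "real \<Rightarrow> 'b::euclidean_space"
    and pr :: "'a \<Rightarrow> 'b \<Rightarrow> 'c::euclidean_space"
  assumes pr: "bounded_bilinear pr"
    and f: "\<And>s. (f has_vector_derivative f' s) (at s)" and f': "continuous_on UNIV f'"
    and g: "continuous_on {0..T} g" and T: "0 < T" and t: "t \<in> {0..T}"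
  shows "(\<lambda>n. \<Sum>j<Suc n. pr (f (grid T t n (Suc j)) - f (grid T t n j)) (g (grid T t n (Suc j))))
    \<longlonglongrightarrow> integral {0..t} (\<lambda>s. pr (f' s) (g s))"
proof (rule LIMSEQ_I)
  fix e :: real assume e: "0 < e"
  obtain K where K: "0 < K" "\<And>s y. s \<in> {0..T} \<Longrightarrow> norm (pr (f' s) y) \<le> K * norm y"
    using Riemann_Stieltjes_bound[OF pr f'] by blast
  define \<epsilon> where "\<epsilon> = e / (2 * K * T)"
  have \<epsilon>: "0 < \<epsilon>" using e K T by (simp add: \<epsilon>_def)
  have "uniformly_continuous_on {0..T} g"
    by (intro compact_uniformly_continuous g) simp
  then obtain d where d: "0 < d" "\<And>a b. a \<in> {0..T} \<Longrightarrow> b \<in> {0..T} \<Longrightarrow> dist a b < d \<Longrightarrow> dist (g a) (g b) < \<epsilon>"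
    using \<epsilon> unfolding uniformly_continuous_on_def by metis
  obtain n0 where n0: "T / d < real n0" using reals_Archimedean2 by blast
  have "norm ((\<Sum>j<Suc n. pr (f (grid T t n (Suc j)) - f (grid T t n j)) (g (grid T t n (Suc j))))
      - integral {0..t} (\<lambda>s. pr (f' s) (g s))) < e" if n: "n0 \<le> n" for n
  proof -
    have mesh: "T / real (Suc n) < d"
    proof -
      have "T / d < real (Suc n)" using n0 n by simp
      then show ?thesis using d T by (simp add: field_simps)
    qed
    note gb = grid_bounds[OF T t, of n]
    have t': "0 \<le> t" "t \<le> T" using t by auto
    have "norm ((\<Sum>j<Suc n. pr (f (grid T t n (Suc j)) - f (grid T t n j)) (g (grid T t n (Suc j))))
      - integral {grid T t n 0..grid T t n (Suc n)} (\<lambda>s. pr (f' s) (g s)))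
      \<le> K * \<epsilon> * (grid T t n (Suc n) - grid T t n 0)"
    proof (rule Riemann_Stieltjes_estimate[OF pr f f'])
      show "continuous_on {grid T t n 0..grid T t n (Suc n)} g"
        unfolding grid_0[OF t'(1)] grid_end[OF t'(2)] using t' by (intro continuous_on_subset[OF g]) auto
      show "norm (pr (f' s) y) \<le> K * norm y" if "s \<in> {grid T t n 0..grid T t n (Suc n)}" for s y
        using that t' unfolding grid_0[OF t'(1)] grid_end[OF t'(2)] by (intro K(2)) auto
      fix j s assume s: "s \<in> {grid T t n j..grid T t n (Suc j)}"
      have "dist (g (grid T t n (Suc j))) (g s) < \<epsilon>"
        using s gb(1)[of j] gb(1)[of "Suc j"] gb(3)[of j] mesh t'
        by (intro d(2)) (auto simp: dist_real_def)
      then show "norm (g (grid T t n (Suc j)) - g s) \<le> \<epsilon>" by (simp add: dist_norm)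
    qed (use gb K in auto)
    also have "\<dots> \<le> K * \<epsilon> * T"
      unfolding grid_0[OF t'(1)] grid_end[OF t'(2)] using K \<epsilon> t' by (intro mult_left_mono) auto
    also have "\<dots> = e / 2" using K T by (simp add: \<epsilon>_def field_simps)
    also have "\<dots> < e" using e by simp
    finally show ?thesis unfolding grid_0[OF t'(1)] grid_end[OF t'(2)] .
  qed
  then show "\<exists>N. \<forall>n\<ge>N. norm ((\<Sum>j<Suc n. pr (f (grid T t n (Suc j)) - f (grid T t n j)) (g (grid T t n (Suc j))))
      - integral {0..t} (\<lambda>s. pr (f' s) (g s))) < e" by blast
qed

section \<open>The maximal inequality\<close>

primrec rmax :: "(nat \<Rightarrow> real) \<Rightarrow> nat \<Rightarrow> real" where
  "rmax f 0 = f 0"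
| "rmax f (Suc k) = max (rmax f k) (f (Suc k))"

lemma rmax_ge: "k \<le> n \<Longrightarrow> f k \<le> rmax f n"
  by (induction n) (auto simp: le_Suc_eq)

text \<open>A pathwise form of Doob's inequality, the sum being a martingale transform.\<close>

lemma rmax_square_le: "(rmax f n)\<^sup>2 \<le> 4 * (f n)\<^sup>2 - 4 * (\<Sum>k<n. rmax f k * (f (Suc k) - f k))"
proof -
  have "4 * (\<Sum>k<n. rmax f k * (f (Suc k) - f k)) \<le> 4 * rmax f n * f n - 2 * (rmax f n)\<^sup>2"
  proof (induction n)
    case 0
    then show ?case by (simp add: power2_eq_square)
  next
    case (Suc n)
    let ?m = "rmax f n" and ?y = "f (Suc n)"
    have "4 * (\<Sum>k<Suc n. rmax f k * (f (Suc k) - f k)) \<le> 4 * ?m * ?y - 2 * ?m\<^sup>2"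
      using Suc.IH by (simp add: algebra_simps)
    \<comment> \<open>A new maximum \<open>?y\<close> increases the right side by twice the square
      of \<open>?y - ?m\<close>; otherwise nothing changes.\<close>
    also have "\<dots> \<le> 4 * max ?m ?y * ?y - 2 * (max ?m ?y)\<^sup>2"
      using zero_le_power2[of "?m - ?y"] by (auto simp: max_def power2_eq_square algebra_simps)
    finally show ?case by simp
  qed
  \<comment> \<open>The square of \<open>rmax f n - 2 * f n\<close> is nonnegative; this is the
    source of Doob's constant 4.\<close>
  moreover have "4 * rmax f n * f n \<le> (rmax f n)\<^sup>2 + 4 * (f n)\<^sup>2"
    using zero_le_power2[of "rmax f n - 2 * f n"] by (simp add: power2_eq_square algebra_simps)
  ultimately show ?thesis by simp
qed

text \<open>Dyadic approximation of \<open>t\<close> from below by rounding. It bounds an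
  uncountable supremum, which need not be measurable, by a countable one.\<close>

lemma sup_le_dyadic:
  fixes g :: "real \<Rightarrow> 'b::real_normed_vector"
  assumes g: "continuous_on {0..T} g" and T: "0 < T" and t: "t \<in> {0..T}"
  shows "ennreal ((norm (g t))\<^sup>2) \<le> (SUP n. SUP k\<in>{..2 ^ n}. ennreal ((norm (g (real k * T / 2 ^ n)))\<^sup>2))"
proof -
  define k where "k n = nat \<lfloor>t / T * 2 ^ n\<rfloor>" for n :: nat
  define s where "s n = real (k n) * T / 2 ^ n" for n
  have r: "0 \<le> t / T" "t / T \<le> 1" using t T by auto
  have k: "real (k n) \<le> t / T * 2 ^ n" "t / T * 2 ^ n - 1 \<le> real (k n)" for n
  proof -
    have "real (nat \<lfloor>x\<rfloor>) \<le> x \<and> x - 1 \<le> real (nat \<lfloor>x\<rfloor>)" if "0 \<le> x" for x :: real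
      using that by (simp; linarith)
    from this[OF mult_nonneg_nonneg[OF r(1) zero_le_power[OF zero_le_numeral]]]
    show "real (k n) \<le> t / T * 2 ^ n" "t / T * 2 ^ n - 1 \<le> real (k n)"
      unfolding k_def by blast+
  qed
  have k_le: "k n \<le> 2 ^ n" for n
  proof -
    have "real (k n) \<le> 1 * 2 ^ n" using k(1)[of n] r by (meson mult_right_mono order_trans zero_le_numeral zero_le_power)
    then show ?thesis by (metis mult_1 of_nat_le_iff of_nat_numeral of_nat_power)
  qed
  have s: "s n \<le> t" "t - T / 2 ^ n \<le> s n" "0 \<le> s n" for n
  proof -
    have "s n \<le> (t / T * 2 ^ n) * T / 2 ^ n"
      unfolding s_def using k(1)[of n] T by (intro divide_right_mono mult_right_mono) auto
    then show "s n \<le> t" using T by simp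
    have "(t / T * 2 ^ n - 1) * T / 2 ^ n \<le> s n"
      unfolding s_def using k(2)[of n] T by (intro divide_right_mono mult_right_mono) auto
    moreover have "(t / T * 2 ^ n - 1) * T / 2 ^ n = t - T / 2 ^ n"
      using T by (simp add: left_diff_distrib diff_divide_distrib)
    ultimately show "t - T / 2 ^ n \<le> s n" by simp
    show "0 \<le> s n" using T by (simp add: s_def)
  qed
  have "s \<longlonglongrightarrow> t"
  proof (rule tendsto_sandwich)
    have "(\<lambda>n. t - T * (1 / 2) ^ n) \<longlonglongrightarrow> t - T * 0"
      by (intro tendsto_intros LIMSEQ_power_zero) simp
    then show "(\<lambda>n. t - T / 2 ^ n) \<longlonglongrightarrow> t" by (simp add: power_one_over)
  qed (use s in auto)
  then have "(\<lambda>n. g (s n)) \<longlonglongrightarrow> g t"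
    using g s t by (intro continuous_on_tendsto_compose[OF g]) (auto intro!: always_eventually order_trans[OF s(1)])
  then have lim: "(\<lambda>n. ennreal ((norm (g (s n)))\<^sup>2)) \<longlonglongrightarrow> ennreal ((norm (g t))\<^sup>2)"
    by (intro tendsto_ennrealI tendsto_intros)
  show ?thesis
  proof (rule LIMSEQ_le_const2[OF lim], intro exI allI impI)
    fix n
    have "ennreal ((norm (g (s n)))\<^sup>2) \<le> (SUP k\<in>{..2 ^ n}. ennreal ((norm (g (real k * T / 2 ^ n)))\<^sup>2))"
      unfolding s_def using k_le by (intro SUP_upper) auto
    also have "\<dots> \<le> (SUP n. SUP k\<in>{..2 ^ n}. ennreal ((norm (g (real k * T / 2 ^ n)))\<^sup>2))"
      by (intro SUP_upper) auto
    finally show "ennreal ((norm (g (s n)))\<^sup>2) \<le> (SUP n. SUP k\<in>{..2 ^ n}. ennreal ((norm (g (real k * T / 2 ^ n)))\<^sup>2))" .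
  qed
qed

context brownian
begin

text \<open>The running maximum at step \<open>k\<close> is known at time \<open>q k\<close>, so the
  sum in the pathwise inequality has mean zero. The scalar \<open>c\<close> will be 1 and -1, to
  control maximum and minimum.\<close>

lemma rmax_W:
  assumes q: "\<And>k. q k \<le> q (Suc k)" "0 \<le> q 0"
  shows "(\<lambda>\<omega>. rmax (\<lambda>k. c * W (q k) \<omega>) n) \<in> borel_measurable (Filt (q n))"
    and "sq_integrable M (\<lambda>\<omega>. rmax (\<lambda>k. c * W (q k) \<omega>) n)"
    and "(\<integral>\<^sup>+\<omega>. ennreal ((rmax (\<lambda>k. c * W (q k) \<omega>) n)\<^sup>2) \<partial>M) \<le> ennreal (4 * c\<^sup>2 * q n)"
proof -
  have q0: "0 \<le> q k" for k
    using q by (induction k) (auto intro: order_trans)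
  let ?R = "\<lambda>n \<omega>. rmax (\<lambda>k. c * W (q k) \<omega>) n"
  have cW: "sq_integrable M (\<lambda>\<omega>. c * W (q k) \<omega>)" for k
    using sq_integrable_scaleR[OF sq_integrable_W[OF q0[of k]], of c] by simp
  have R: "?R n \<in> borel_measurable (Filt (q n)) \<and> sq_integrable M (?R n)" for n
  proof (induction n)
    case 0
    show ?case
      using cW[of 0] q0[of 0]
      by (simp, intro borel_measurable_times borel_measurable_const measurable_W_Filt) auto
  next
    case (Suc n)
    have "?R n \<in> borel_measurable (Filt (q (Suc n)))"
      using Suc q(1)[of n] by (blast intro: measurable_Filt_mono)
    then have m: "?R (Suc n) \<in> borel_measurable (Filt (q (Suc n)))"
      using q0[of "Suc n"] by (simp, intro borel_measurable_max borel_measurable_times measurable_W_Filt) auto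
    have "integrable M (\<lambda>\<omega>. (?R (Suc n) \<omega>)\<^sup>2)"
    proof (rule Bochner_Integration.integrable_bound)
      show "integrable M (\<lambda>\<omega>. (?R n \<omega>)\<^sup>2 + (c * W (q (Suc n)) \<omega>)\<^sup>2)"
        using Suc cW[of "Suc n"] by (auto simp: sq_integrable_def)
      show "AE \<omega> in M. norm ((?R (Suc n) \<omega>)\<^sup>2) \<le> norm ((?R n \<omega>)\<^sup>2 + (c * W (q (Suc n)) \<omega>)\<^sup>2)"
        by (intro AE_I2) (simp add: max_def)
    qed (use measurable_Filt[OF m] in measurable)
    with m show ?case unfolding sq_integrable_def using measurable_Filt[OF m] by simp
  qed
  then show "?R n \<in> borel_measurable (Filt (q n))" "sq_integrable M (?R n)" by auto
  have zero: "integrable M (\<lambda>\<omega>. ?R k \<omega> * (c * W (q (Suc k)) \<omega> - c * W (q k) \<omega>)) \<and>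
    (LINT \<omega>|M. ?R k \<omega> * (c * W (q (Suc k)) \<omega> - c * W (q k) \<omega>)) = 0" for k
  proof (cases "q k = q (Suc k)")
    case False
    then have lt: "q k < q (Suc k)" using q(1)[of k] by simp
    have i: "integrable M (?R k)" using R sq_integrable_integrable by blast
    note o = increment_orthogonal[OF q0 lt _ i]
    have eq: "?R k \<omega> * (c * W (q (Suc k)) \<omega> - c * W (q k) \<omega>) = c * (?R k \<omega> * (W (q (Suc k)) \<omega> - W (q k) \<omega>))" for \<omega>
      by (simp add: algebra_simps)
    show ?thesis unfolding eq using o R by simp
  qed simp
  have iR: "integrable M (\<lambda>\<omega>. (?R n \<omega>)\<^sup>2)" using R by (simp add: sq_integrable_def)
  have iW: "integrable M (\<lambda>\<omega>. (W (q n) \<omega>)\<^sup>2)" using sq_integrable_W[OF q0] by (simp add: sq_integrable_def)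
  have "(LINT \<omega>|M. (?R n \<omega>)\<^sup>2)
      \<le> (LINT \<omega>|M. 4 * c\<^sup>2 * (W (q n) \<omega>)\<^sup>2 - 4 * (\<Sum>k<n. ?R k \<omega> * (c * W (q (Suc k)) \<omega> - c * W (q k) \<omega>)))"
  proof (rule integral_mono[OF iR])
    show "integrable M (\<lambda>\<omega>. 4 * c\<^sup>2 * (W (q n) \<omega>)\<^sup>2 - 4 * (\<Sum>k<n. ?R k \<omega> * (c * W (q (Suc k)) \<omega> - c * W (q k) \<omega>)))"
      using zero iW by auto
    show "(?R n \<omega>)\<^sup>2 \<le> 4 * c\<^sup>2 * (W (q n) \<omega>)\<^sup>2 - 4 * (\<Sum>k<n. ?R k \<omega> * (c * W (q (Suc k)) \<omega> - c * W (q k) \<omega>))" for \<omega>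
      using rmax_square_le[of "\<lambda>k. c * W (q k) \<omega>" n] by (simp add: power_mult_distrib)
  qed
  also have "\<dots> = 4 * c\<^sup>2 * q n"
    using zero iW W_square[OF q0] by (simp add: Bochner_Integration.integral_sum)
  finally show "(\<integral>\<^sup>+\<omega>. ennreal ((?R n \<omega>)\<^sup>2) \<partial>M) \<le> ennreal (4 * c\<^sup>2 * q n)"
    using iR by (subst nn_integral_eq_integral) (auto intro: ennreal_leI)
qed

lemma Sup_W_finite:
  assumes T: "0 < T"
  shows "(\<integral>\<^sup>+\<omega>. (SUP t\<in>{0..T}. ennreal ((W t \<omega>)\<^sup>2)) \<partial>M) < \<infinity>"
proof -
  define S where "S n \<omega> = (SUP k\<in>{..2 ^ n}. ennreal ((W (real k * T / 2 ^ n) \<omega>)\<^sup>2))" for n :: nat and \<omega>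
  have [measurable]: "W (real k * T / 2 ^ n) \<in> borel_measurable M" for k n using T by simp
  have [measurable]: "S n \<in> borel_measurable M" for n
    unfolding S_def by measurable
  have "incseq S"
  proof (rule incseq_SucI, rule le_funI)
    fix n \<omega>
    show "S n \<omega> \<le> S (Suc n) \<omega>"
      unfolding S_def
    proof (rule SUP_mono)
      fix k :: nat assume "k \<in> {..2 ^ n}"
      then show "\<exists>m\<in>{..2 ^ Suc n}. ennreal ((W (real k * T / 2 ^ n) \<omega>)\<^sup>2) \<le> ennreal ((W (real m * T / 2 ^ Suc n) \<omega>)\<^sup>2)"
        by (intro bexI[of _ "2 * k"]) auto
    qed
  qed
  \<comment> \<open>4 \<open>T\<close> for the maximum of \<open>W\<close> and 4 \<open>T\<close>
    for that of its negative, uniformly in the dyadic level.\<close>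
  have Sn: "(\<integral>\<^sup>+\<omega>. S n \<omega> \<partial>M) \<le> ennreal (8 * T)" for n
  proof -
    define q where "q k = real k * T / 2 ^ n" for k
    have q: "q k \<le> q (Suc k)" "0 \<le> q 0" "q (2 ^ n) = T" for k
      using T by (auto simp: q_def divide_right_mono)
    let ?R = "\<lambda>c \<omega>. ennreal ((rmax (\<lambda>k. c * W (q k) \<omega>) (2 ^ n))\<^sup>2)"
    have "S n \<omega> \<le> ?R 1 \<omega> + ?R (- 1) \<omega>" for \<omega>
      unfolding S_def
    proof (rule SUP_least)
      fix k :: nat assume k: "k \<in> {..2 ^ n}"
      have "x\<^sup>2 \<le> a\<^sup>2 + b\<^sup>2" if "x \<le> a" "- x \<le> b" for x a b :: real
      proof (cases "0 \<le> x")
        case True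
        with that have "x\<^sup>2 \<le> a\<^sup>2" by (intro power_mono) auto
        then show ?thesis by (simp add: add_increasing2)
      next
        case False
        with that have "(- x)\<^sup>2 \<le> b\<^sup>2" by (intro power_mono) auto
        then show ?thesis by (simp add: add_increasing)
      qed
      from this[of "W (q k) \<omega>" "rmax (\<lambda>k. 1 * W (q k) \<omega>) (2 ^ n)" "rmax (\<lambda>k. - 1 * W (q k) \<omega>) (2 ^ n)"]
        rmax_ge[of k "2 ^ n" "\<lambda>k. 1 * W (q k) \<omega>"] rmax_ge[of k "2 ^ n" "\<lambda>k. - 1 * W (q k) \<omega>"] k
      have "(W (q k) \<omega>)\<^sup>2 \<le> (rmax (\<lambda>k. 1 * W (q k) \<omega>) (2 ^ n))\<^sup>2 + (rmax (\<lambda>k. - 1 * W (q k) \<omega>) (2 ^ n))\<^sup>2"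
        by simp
      then show "ennreal ((W (real k * T / 2 ^ n) \<omega>)\<^sup>2) \<le> ?R 1 \<omega> + ?R (- 1) \<omega>"
        by (simp add: q_def ennreal_plus [symmetric] ennreal_leI del: ennreal_plus)
    qed
    then have "(\<integral>\<^sup>+\<omega>. S n \<omega> \<partial>M) \<le> (\<integral>\<^sup>+\<omega>. ?R 1 \<omega> + ?R (- 1) \<omega> \<partial>M)"
      by (intro nn_integral_mono)
    also have "\<dots> = (\<integral>\<^sup>+\<omega>. ?R 1 \<omega> \<partial>M) + (\<integral>\<^sup>+\<omega>. ?R (- 1) \<omega> \<partial>M)"
      using rmax_W(2)[OF q(1,2), of 1 "2 ^ n"] rmax_W(2)[OF q(1,2), of "- 1" "2 ^ n"]
      by (intro nn_integral_add) (auto simp: sq_integrable_def)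
    also have "\<dots> \<le> ennreal (4 * T) + ennreal (4 * T)"
      using rmax_W(3)[OF q(1,2), of 1 "2 ^ n"] rmax_W(3)[OF q(1,2), of "- 1" "2 ^ n"]
      by (intro add_mono) (simp_all add: q)
    also have "\<dots> = ennreal (8 * T)" using T by (simp add: ennreal_plus [symmetric] del: ennreal_plus)
    finally show ?thesis .
  qed
  have "(\<integral>\<^sup>+\<omega>. (SUP t\<in>{0..T}. ennreal ((W t \<omega>)\<^sup>2)) \<partial>M) \<le> (\<integral>\<^sup>+\<omega>. (SUP n. S n \<omega>) \<partial>M)"
  proof (rule nn_integral_mono_AE)
    show "AE \<omega> in M. (SUP t\<in>{0..T}. ennreal ((W t \<omega>)\<^sup>2)) \<le> (SUP n. S n \<omega>)"
      using continuous_W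
    proof eventually_elim
      fix \<omega> assume "continuous_on {0..} (\<lambda>t. W t \<omega>)"
      then have "continuous_on {0..T} (\<lambda>t. W t \<omega>)" by (rule continuous_on_subset) auto
      then show "(SUP t\<in>{0..T}. ennreal ((W t \<omega>)\<^sup>2)) \<le> (SUP n. S n \<omega>)"
        unfolding S_def using sup_le_dyadic[of T "\<lambda>t. W t \<omega>"] T by (intro SUP_least) simp
    qed
  qed
  also have "\<dots> = (SUP n. \<integral>\<^sup>+\<omega>. S n \<omega> \<partial>M)"
    by (rule nn_integral_monotone_convergence_SUP[OF \<open>incseq S\<close>]) simp
  also have "\<dots> \<le> ennreal (8 * T)" by (rule SUP_least) (rule Sn)
  finally show ?thesis by (rule order_le_less_trans) simp
qed

end

section \<open>Variation of constants\<close>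

lemma has_vector_derivative_mexp_reverse:
  "((\<lambda>s. mexp A (T - s)) has_vector_derivative - (A ** mexp A (T - s))) (at s within S)"
proof -
  have "((\<lambda>s. T - s) has_vector_derivative - 1) (at s)"
    by (auto intro!: derivative_eq_intros)
  from vector_diff_chain_at[OF this has_vector_derivative_mexp]
  have "((\<lambda>s. mexp A (T - s)) has_vector_derivative - (A ** mexp A (T - s))) (at s)"
    by (simp add: o_def)
  then show ?thesis by (rule has_vector_derivative_at_within)
qed

text \<open>Only continuity of \<open>b\<close> is assumed, since it will contain the path of a
  stochastic integral. The remainder \<open>Y\<close> is differentiable, and in the derivative of
  \<open>mexp A (T - s) *v Y s\<close> the terms with \<open>Y\<close> cancel.\<close>

lemma variation_of_constants:
  fixes X :: "real \<Rightarrow> real^'d"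
  assumes T: "0 \<le> T" and X: "continuous_on {0..T} X" and b: "continuous_on {0..T} b"
    and eq: "\<And>t. t \<in> {0..T} \<Longrightarrow> X t = x + integral {0..t} (\<lambda>s. A *v X s) + b t"
  shows "X T = mexp A T *v x + b T + integral {0..T} (\<lambda>s. (A ** mexp A (T - s)) *v b s)"
proof -
  define Y where "Y t = x + integral {0..t} (\<lambda>s. A *v X s)" for t
  have AX: "continuous_on {0..T} (\<lambda>s. A *v X s)"
    by (intro continuous_intros X)
  have Y: "(Y has_vector_derivative A *v X t) (at t within {0..T})" if "t \<in> {0..T}" for t
    using integral_has_vector_derivative[OF AX that]
    unfolding Y_def by (auto intro!: derivative_eq_intros)
  have "((\<lambda>s. (A ** mexp A (T - s)) *v b s) has_integral mexp A (T - T) *v Y T - mexp A (T - 0) *v Y 0) {0..T}"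
  proof (rule fundamental_theorem_of_calculus[OF T])
    fix s assume s: "s \<in> {0..T}"
    have "X s = Y s + b s" using eq[OF s] by (simp add: Y_def)
    then have "mexp A (T - s) *v (A *v X s) + - (A ** mexp A (T - s)) *v Y s = (A ** mexp A (T - s)) *v b s"
      by (simp add: matrix_vector_mul_assoc mexp_commute matrix_vector_right_distrib
          bounded_bilinear.minus_left[OF bounded_bilinear_matrix_vector_mult])
    with bounded_bilinear.has_vector_derivative[OF bounded_bilinear_matrix_vector_mult
        has_vector_derivative_mexp_reverse[of A T s "{0..T}"] Y[OF s]]
    show "((\<lambda>s. mexp A (T - s) *v Y s) has_vector_derivative (A ** mexp A (T - s)) *v b s) (at s within {0..T})"
      by simp
  qed
  then have "integral {0..T} (\<lambda>s. (A ** mexp A (T - s)) *v b s) = Y T - mexp A T *v x"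
    by (simp add: integral_unique Y_def)
  moreover have "X T = Y T + b T" using eq[of T] T by (simp add: Y_def)
  ultimately show ?thesis by simp
qed

text \<open>Only the cells from the one containing \<open>s\<close> onwards contribute, and their
  increments telescope. This identifies the integrand that belongs to a Riemann sum of stochastic
  integrals.\<close>

lemma step_sum:
  fixes f :: "real \<Rightarrow> 'b::real_vector"
  assumes q: "\<And>j. q j \<le> q (Suc j)" and s: "q 0 < s" "s \<le> q n" and q0: "0 \<le> q 0"
  shows "\<exists>m<n. q m < s \<and> s \<le> q (Suc m) \<and>
    (\<Sum>j<n. indicat_real {0<..q (Suc j)} s *\<^sub>R (f (q (Suc j)) - f (q j))) = f (q n) - f (q m)"
  using s(2)
proof (induction n)
  case 0
  then show ?case using s(1) by simp
next
  case (Suc n)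
  show ?case
  proof (cases "s \<le> q n")
    case True
    with Suc.IH obtain m where m: "m < n" "q m < s" "s \<le> q (Suc m)"
      "(\<Sum>j<n. indicat_real {0<..q (Suc j)} s *\<^sub>R (f (q (Suc j)) - f (q j))) = f (q n) - f (q m)" by blast
    have "indicat_real {0<..q (Suc n)} s = 1" using Suc.prems s q0 by simp
    with m show ?thesis by (intro exI[of _ m]) simp
  next
    case False
    have "q (Suc j) \<le> q n" if "j < n" for j
      using lift_Suc_mono_le[of q "Suc j" n] q that by auto
    then have "(\<Sum>j<n. indicat_real {0<..q (Suc j)} s *\<^sub>R (f (q (Suc j)) - f (q j))) = 0"
      using False by (intro sum.neutral) force
    moreover have "indicat_real {0<..q (Suc n)} s = 1" using Suc.prems s q0 by simp
    ultimately show ?thesis using False Suc.prems by (intro exI[of _ n]) simp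
  qed
qed

section \<open>The law of a solution\<close>

context brownian
begin

text \<open>The time integral is the pathwise limit of Riemann-Stieltjes sums, each a combination of
  finitely many values of \<open>I\<close>. Their characteristic functions are explicit, and the
  integrands in them converge to the exponential kernel applied to \<phi>.\<close>

lemma ito_convolution_char:
  fixes \<phi> :: "real \<Rightarrow> real^'d" and A :: "real^'d^'d"
  assumes T: "0 < T" and ito: "ito_integral M Filt W T (\<lambda>s \<omega>. \<phi> s) I"
    and Y: "Y \<in> borel_measurable M"
    and Y_eq: "AE \<omega> in M. Y \<omega> = I T \<omega> + integral {0..T} (\<lambda>s. (A ** mexp A (T - s)) *v I s \<omega>)"
  shows "(CLINT \<omega>|M. iexp (w \<bullet> Y \<omega>))
    = exp (- (LBINT s. (indicat_real {0<..T} s * (w \<bullet> (mexp A (T - s) *v \<phi> s)))\<^sup>2) / 2)"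
proof -
  have L2: "(\<lambda>s \<omega>. \<phi> s) \<in> L2_prog M Filt T" using ito by (simp add: ito_integral_def)
  have T0: "0 \<le> T" "T \<in> {0..T}" using T by auto
  define \<phi>0 where "\<phi>0 s = indicat_real {0..T} s *\<^sub>R \<phi> s" for s
  have \<phi>0: "sq_integrable lborel \<phi>0"
    unfolding \<phi>0_def [abs_def] by (rule sq_integrable_deterministic[OF L2 T0(1)])
  then have [measurable]: "\<phi>0 \<in> borel_measurable borel" by (simp add: sq_integrable_def)
  \<comment> \<open>An antiderivative of the kernel \<open>A ** mexp A (T - s)\<close>, normalised
    by \<open>f T = - mat 1\<close>.\<close>
  define f where "f s = - mexp A (T - s)" for s
  have f: "(f has_vector_derivative A ** mexp A (T - s)) (at s)" for s
    unfolding f_def using has_vector_derivative_minus[OF has_vector_derivative_mexp_reverse[of A T s UNIV]] by simp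
  have fT: "f T = - mat 1" by (simp add: f_def)
  have fcont: "continuous_on UNIV f" unfolding f_def by (intro continuous_intros)
  have f'cont: "continuous_on UNIV (\<lambda>s. A ** mexp A (T - s))"
    by (intro bounded_bilinear.continuous_on[OF bounded_bilinear_matrix_matrix_mult] continuous_intros)
  let ?q = "\<lambda>n. grid T T n"
  note q = grid_bounds[OF T T0(2)]
  define D where "D n j = f (?q n (Suc j)) - f (?q n j)" for n j
  define G where "G n \<omega> = w \<bullet> I T \<omega> + w \<bullet> (\<Sum>j<Suc n. D n j *v I (?q n (Suc j)) \<omega>)" for n \<omega>
  define h where "h s = indicat_real {0<..T} s * (w \<bullet> (mexp A (T - s) *v \<phi> s))" for s
  \<comment> \<open>The index \<open>Suc n\<close> stands for the separate term \<open>I T\<close>,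
    the smaller ones for the Riemann sum.\<close>
  define hn where "hn n s = (\<Sum>j\<in>{..Suc n}. indicat_real {0<..if j = Suc n then T else ?q n (Suc j)} s
      * ((if j = Suc n then w else transpose (D n j) *v w) \<bullet> \<phi> s))" for n s
  have adj: "(transpose B *v w) \<bullet> y = w \<bullet> (B *v y)" for B :: "real^'d^'d" and y
    by (metis dot_lmul_matrix transpose_matrix_vector)
  have char: "(CLINT \<omega>|M. iexp (G n \<omega>)) = exp (- (LBINT s. (hn n s)\<^sup>2) / 2)" for n
  proof -
    have "(CLINT \<omega>|M. iexp (\<Sum>j\<in>{..Suc n}. (if j = Suc n then w else transpose (D n j) *v w)
          \<bullet> I (if j = Suc n then T else ?q n (Suc j)) \<omega>)) = exp (- (LBINT s. (hn n s)\<^sup>2) / 2)"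
      unfolding hn_def using q(1) T by (intro ito_integral_deterministic_char[OF ito T0(1)]) auto
    moreover have "(\<Sum>j\<in>{..Suc n}. (if j = Suc n then w else transpose (D n j) *v w)
          \<bullet> I (if j = Suc n then T else ?q n (Suc j)) \<omega>) = G n \<omega>" for \<omega>
    proof -
      have "(\<Sum>j\<in>{..Suc n}. (if j = Suc n then w else transpose (D n j) *v w)
          \<bullet> I (if j = Suc n then T else ?q n (Suc j)) \<omega>)
        = w \<bullet> I T \<omega> + (\<Sum>j<Suc n. (transpose (D n j) *v w) \<bullet> I (?q n (Suc j)) \<omega>)"
        unfolding lessThan_Suc_atMost [symmetric] sum.lessThan_Suc[of _ "Suc n"]
        by (subst add.commute, intro arg_cong2[where f = "(+)"] sum.cong) auto
      then show ?thesis unfolding G_def inner_sum_right adj .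
    qed
    ultimately show ?thesis by (simp only:)
  qed
  have hn_eq: "\<exists>m. ?q n m < s \<and> s \<le> ?q n (Suc m) \<and> hn n s = w \<bullet> (- f (?q n m) *v \<phi> s)"
    if s: "s \<in> {0<..T}" for n s
  proof -
    obtain m where m: "?q n m < s" "s \<le> ?q n (Suc m)"
      "(\<Sum>j<Suc n. indicat_real {0<..?q n (Suc j)} s *\<^sub>R D n j) = f (?q n (Suc n)) - f (?q n m)"
      using step_sum[of "?q n" s "Suc n" f] q(2) s grid_0[OF T0(1)] grid_end[OF order_refl[of T]]
      unfolding D_def by auto
    have "hn n s = w \<bullet> \<phi> s + (\<Sum>j<Suc n. indicat_real {0<..?q n (Suc j)} s * ((transpose (D n j) *v w) \<bullet> \<phi> s))"
      unfolding hn_def lessThan_Suc_atMost [symmetric] sum.lessThan_Suc[of _ "Suc n"] using s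
      by (subst add.commute, intro arg_cong2[where f = "(+)"] sum.cong) auto
    also have "(\<Sum>j<Suc n. indicat_real {0<..?q n (Suc j)} s * ((transpose (D n j) *v w) \<bullet> \<phi> s))
        = w \<bullet> ((\<Sum>j<Suc n. indicat_real {0<..?q n (Suc j)} s *\<^sub>R D n j) *v \<phi> s)"
      unfolding bounded_bilinear.sum_left[OF bounded_bilinear_matrix_vector_mult]
        bounded_bilinear.scaleR_left[OF bounded_bilinear_matrix_vector_mult] inner_sum_right adj
      by simp
    \<comment> \<open>Telescoping leaves \<open>f T - f (?q n m)\<close>, and
      \<open>f T = - mat 1\<close> cancels the contribution of \<open>I T\<close>.\<close>
    also have "w \<bullet> \<phi> s + \<dots> = w \<bullet> (- f (?q n m) *v \<phi> s)"
      unfolding m(3) grid_end[OF order_refl] fT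
      by (simp add: bounded_bilinear.diff_left[OF bounded_bilinear_matrix_vector_mult]
          bounded_bilinear.minus_left[OF bounded_bilinear_matrix_vector_mult] inner_diff_right)
    finally show ?thesis using m by blast
  qed
  have hn_out: "hn n s = 0" if s: "s \<notin> {0<..T}" for n s
    unfolding hn_def
  proof (rule sum.neutral, rule ballI)
    fix j
    have "s \<notin> {0<..if j = Suc n then T else ?q n (Suc j)}" using s q(1)[of n "Suc j"] by auto
    then show "indicat_real {0<..if j = Suc n then T else ?q n (Suc j)} s
      * ((if j = Suc n then w else transpose (D n j) *v w) \<bullet> \<phi> s) = 0" by simp
  qed
  have hn_lim: "(\<lambda>n. hn n s) \<longlonglongrightarrow> h s" for s
  proof (cases "s \<in> {0<..T}")
    case True
    then obtain m where m: "\<And>n. ?q n (m n) < s" "\<And>n. s \<le> ?q n (Suc (m n))"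
      "\<And>n. hn n s = w \<bullet> (- f (?q n (m n)) *v \<phi> s)" using hn_eq[OF True] by metis
    have "(\<lambda>n. ?q n (m n)) \<longlonglongrightarrow> s"
    proof (rule tendsto_sandwich)
      have "(\<lambda>n. s - T * (1 / real (Suc n))) \<longlonglongrightarrow> s - T * 0"
        by (intro tendsto_intros LIMSEQ_Suc[OF lim_1_over_n])
      then show "(\<lambda>n. s - T / real (Suc n)) \<longlonglongrightarrow> s" by simp
      show "\<forall>\<^sub>F n in sequentially. s - T / real (Suc n) \<le> ?q n (m n)"
        using q(3) m(2) by (intro always_eventually allI) (smt (verit))
      show "\<forall>\<^sub>F n in sequentially. ?q n (m n) \<le> s"
        by (intro always_eventually allI less_imp_le m(1))
    qed auto
    then have "(\<lambda>n. f (?q n (m n))) \<longlonglongrightarrow> f s"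
      using fcont by (intro continuous_on_tendsto_compose[OF fcont]) auto
    then have "(\<lambda>n. w \<bullet> (- f (?q n (m n)) *v \<phi> s)) \<longlonglongrightarrow> w \<bullet> (- f s *v \<phi> s)"
      by (intro tendsto_intros bounded_bilinear.tendsto[OF bounded_bilinear_matrix_vector_mult])
    with True show ?thesis unfolding m(3) by (simp add: h_def f_def)
  qed (simp add: hn_out h_def)
  obtain B where B: "0 < B" "\<And>s y. s \<in> {0..T} \<Longrightarrow> norm (- f s *v y) \<le> B * norm y"
    by (rule Riemann_Stieltjes_bound[OF bounded_bilinear_matrix_vector_mult continuous_on_minus[OF fcont], of T])
       blast
  \<comment> \<open>The kernel is bounded on \<open>{0..T}\<close>, so the square of \<phi>
    dominates for all partitions at once.\<close>
  have bound: "(hn n s)\<^sup>2 \<le> (norm w * B)\<^sup>2 * (norm (\<phi>0 s))\<^sup>2" for n s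
  proof (cases "s \<in> {0<..T}")
    case True
    then obtain m where m: "?q n m < s" "hn n s = w \<bullet> (- f (?q n m) *v \<phi> s)" using hn_eq[OF True] by blast
    have "(hn n s)\<^sup>2 \<le> (norm w)\<^sup>2 * (norm (- f (?q n m) *v \<phi> s))\<^sup>2"
      unfolding m(2) by (rule inner_square_le)
    also have "\<dots> \<le> (norm w)\<^sup>2 * (B * norm (\<phi> s))\<^sup>2"
      using q(1) by (intro mult_left_mono power_mono B) auto
    finally show ?thesis using True by (simp add: \<phi>0_def power_mult_distrib mult.assoc)
  qed (simp add: hn_out)
  have hn_meas [measurable]: "hn n \<in> borel_measurable borel" for n
  proof -
    have "hn n = (\<lambda>s. \<Sum>j\<in>{..Suc n}. indicat_real {0<..if j = Suc n then T else ?q n (Suc j)} s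
      * ((if j = Suc n then w else transpose (D n j) *v w) \<bullet> \<phi>0 s))"
      unfolding hn_def fun_eq_iff
    proof (intro allI sum.cong refl)
      fix s j
      have "?q n (Suc j) \<le> T" using q(1)[of n "Suc j"] by simp
      then show "indicat_real {0<..if j = Suc n then T else ?q n (Suc j)} s
          * ((if j = Suc n then w else transpose (D n j) *v w) \<bullet> \<phi> s)
        = indicat_real {0<..if j = Suc n then T else ?q n (Suc j)} s
          * ((if j = Suc n then w else transpose (D n j) *v w) \<bullet> \<phi>0 s)"
        by (auto simp: \<phi>0_def split: split_indicator)
    qed
    also have "\<dots> \<in> borel_measurable borel"
      by (intro borel_measurable_sum borel_measurable_times borel_measurable_inner
          borel_measurable_const borel_measurable_indicator) auto
    finally show ?thesis .
  qed
  have h_meas [measurable]: "h \<in> borel_measurable borel"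
    by (rule borel_measurable_LIMSEQ_real[OF hn_lim hn_meas])
  have "(\<lambda>n. LBINT s. (hn n s)\<^sup>2) \<longlonglongrightarrow> (LBINT s. (h s)\<^sup>2)"
  proof (rule integral_dominated_convergence[where w = "\<lambda>s. (norm w * B)\<^sup>2 * (norm (\<phi>0 s))\<^sup>2"])
    show "integrable lborel (\<lambda>s. (norm w * B)\<^sup>2 * (norm (\<phi>0 s))\<^sup>2)"
      using \<phi>0 by (simp add: sq_integrable_def)
    show "AE s in lborel. (\<lambda>n. (hn n s)\<^sup>2) \<longlonglongrightarrow> (h s)\<^sup>2"
      by (intro AE_I2 tendsto_intros hn_lim)
    show "AE s in lborel. norm ((hn n s)\<^sup>2) \<le> (norm w * B)\<^sup>2 * (norm (\<phi>0 s))\<^sup>2" for n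
      using bound by simp
  qed measurable
  from tendsto_of_real[OF tendsto_exp[OF tendsto_divide[OF tendsto_minus[OF this] tendsto_const[of 2]]]]
  have lim1: "(\<lambda>n. complex_of_real (exp (- (LBINT s. (hn n s)\<^sup>2) / 2))) \<longlonglongrightarrow> exp (- (LBINT s. (h s)\<^sup>2) / 2)"
    by simp
  have [measurable]: "I t \<in> borel_measurable M" if "t \<in> {0..T}" for t
    by (rule ito_integral_measurable[OF ito that])
  have G_meas: "G n \<in> borel_measurable M" for n
    unfolding G_def using q(1) T0
    by (intro borel_measurable_add borel_measurable_inner borel_measurable_const borel_measurable_sum
        measurable_compose[OF _ borel_measurable_continuous_onI[OF continuous_on_matrix_vector_mult[OF continuous_on_const continuous_on_id]]]
        ito_integral_measurable[OF ito]) auto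
  have "AE \<omega> in M. continuous_on {0..T} (\<lambda>t. I t \<omega>)" using ito by (simp add: ito_integral_def)
  with Y_eq have G_lim: "AE \<omega> in M. (\<lambda>n. G n \<omega>) \<longlonglongrightarrow> w \<bullet> Y \<omega>"
  proof eventually_elim
    case (elim \<omega>)
    from Riemann_Stieltjes_tendsto[OF bounded_bilinear_matrix_vector_mult f f'cont elim(2) T T0(2)]
    have "(\<lambda>n. \<Sum>j<Suc n. D n j *v I (?q n (Suc j)) \<omega>)
        \<longlonglongrightarrow> integral {0..T} (\<lambda>s. (A ** mexp A (T - s)) *v I s \<omega>)"
      unfolding D_def .
    then have "(\<lambda>n. G n \<omega>) \<longlonglongrightarrow> w \<bullet> I T \<omega> + w \<bullet> integral {0..T} (\<lambda>s. (A ** mexp A (T - s)) *v I s \<omega>)"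
      unfolding G_def by (intro tendsto_intros)
    then show ?case using elim(1) by (simp add: inner_add_right)
  qed
  have "(\<lambda>n. CLINT \<omega>|M. iexp (G n \<omega>)) \<longlonglongrightarrow> (CLINT \<omega>|M. iexp (w \<bullet> Y \<omega>))"
  proof (rule integral_dominated_convergence[where w = "\<lambda>_. 1"])
    show "AE \<omega> in M. (\<lambda>n. iexp (G n \<omega>)) \<longlonglongrightarrow> iexp (w \<bullet> Y \<omega>)"
      using G_lim by eventually_elim (intro tendsto_intros)
  qed (use Y G_meas in auto)
  with lim1 show ?thesis unfolding char h_def [symmetric] by (metis LIMSEQ_unique)
qed

section \<open>Domination and means of processes in the solution class\<close>

lemma dyadic_in_interval:
  assumes "0 < T" "k \<in> {..(2::nat) ^ n}"
  shows "real k * T / 2 ^ n \<in> {0..T}"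
proof -
  have "real k \<le> 2 ^ n" using assms(2) by (metis atMost_iff of_nat_le_iff of_nat_numeral of_nat_power)
  then show ?thesis using assms(1) by (simp add: field_simps)
qed

text \<open>The bound is built from the dyadic supremum, which is measurable. The added 1 lets one
  function bound both the norm and its square.\<close>

lemma process_dominated:
  fixes X :: "real \<Rightarrow> 'a \<Rightarrow> 'b::euclidean_space"
  assumes T: "0 < T" and X: "\<And>t. t \<in> {0..T} \<Longrightarrow> X t \<in> borel_measurable M"
    and cont: "AE \<omega> in M. continuous_on {0..T} (\<lambda>t. X t \<omega>)"
    and fin: "(\<integral>\<^sup>+\<omega>. (SUP t\<in>{0..T}. ennreal ((norm (X t \<omega>))\<^sup>2)) \<partial>M) < \<infinity>"
  obtains g where "integrable M g" "AE \<omega> in M. \<forall>t\<in>{0..T}. norm (X t \<omega>) \<le> g \<omega> \<and> (norm (X t \<omega>))\<^sup>2 \<le> g \<omega>"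
proof -
  define H where "H \<omega> = (SUP n. SUP k\<in>{..(2::nat) ^ n}. ennreal ((norm (X (real k * T / 2 ^ n) \<omega>))\<^sup>2))" for \<omega>
  note in_T = dyadic_in_interval[OF T]
  have H_meas [measurable]: "H \<in> borel_measurable M"
    unfolding H_def
  proof (intro borel_measurable_SUP)
    fix n k assume "k \<in> {..(2::nat) ^ n}"
    note [measurable] = X[OF in_T[OF this]]
    show "(\<lambda>\<omega>. ennreal ((norm (X (real k * T / 2 ^ n) \<omega>))\<^sup>2)) \<in> borel_measurable M" by measurable
  qed auto
  have "(\<integral>\<^sup>+\<omega>. H \<omega> \<partial>M) \<le> (\<integral>\<^sup>+\<omega>. (SUP t\<in>{0..T}. ennreal ((norm (X t \<omega>))\<^sup>2)) \<partial>M)"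
    unfolding H_def by (intro nn_integral_mono SUP_least SUP_upper in_T)
  with fin have H_fin: "(\<integral>\<^sup>+\<omega>. H \<omega> \<partial>M) < \<infinity>" by (rule order_le_less_trans[rotated])
  then have H_ae: "AE \<omega> in M. H \<omega> \<noteq> \<infinity>" by (intro nn_integral_PInf_AE) auto
  show thesis
  proof (rule that[of "\<lambda>\<omega>. 1 + enn2real (H \<omega>)"])
    have "(\<integral>\<^sup>+\<omega>. ennreal (norm (enn2real (H \<omega>))) \<partial>M) = (\<integral>\<^sup>+\<omega>. H \<omega> \<partial>M)"
      using H_ae by (intro nn_integral_cong_AE) (auto simp: less_top)
    then have "integrable M (\<lambda>\<omega>. enn2real (H \<omega>))"
      using H_fin by (simp add: integrable_iff_bounded)
    then show "integrable M (\<lambda>\<omega>. 1 + enn2real (H \<omega>))" by simp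
    show "AE \<omega> in M. \<forall>t\<in>{0..T}. norm (X t \<omega>) \<le> 1 + enn2real (H \<omega>) \<and> (norm (X t \<omega>))\<^sup>2 \<le> 1 + enn2real (H \<omega>)"
      using cont H_ae
    proof eventually_elim
      case (elim \<omega>)
      show ?case
      proof
        fix t assume t: "t \<in> {0..T}"
        have "ennreal ((norm (X t \<omega>))\<^sup>2) \<le> H \<omega>"
          unfolding H_def by (rule sup_le_dyadic[OF elim(1) T t])
        then have "(norm (X t \<omega>))\<^sup>2 \<le> enn2real (H \<omega>)"
          using elim(2) by (metis enn2real_ennreal enn2real_mono infinity_ennreal_def less_top zero_le_power2)
        moreover have "norm (X t \<omega>) \<le> 1 + (norm (X t \<omega>))\<^sup>2"
          using zero_le_power2[of "norm (X t \<omega>) - 1 / 2"] by (simp add: power2_eq_square algebra_simps)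
        ultimately show "norm (X t \<omega>) \<le> 1 + enn2real (H \<omega>) \<and> (norm (X t \<omega>))\<^sup>2 \<le> 1 + enn2real (H \<omega>)"
          by simp
      qed
    qed
  qed
qed

text \<open>Dominated convergence along sequences of times. Continuity of the mean later gives
  integrability of the drift term with \<open>A2\<close>.\<close>

lemma continuous_on_expectation:
  fixes X :: "real \<Rightarrow> 'a \<Rightarrow> 'b::euclidean_space"
  assumes T: "0 < T" and X: "\<And>t. t \<in> {0..T} \<Longrightarrow> X t \<in> borel_measurable M"
    and cont: "AE \<omega> in M. continuous_on {0..T} (\<lambda>t. X t \<omega>)"
    and fin: "(\<integral>\<^sup>+\<omega>. (SUP t\<in>{0..T}. ennreal ((norm (X t \<omega>))\<^sup>2)) \<partial>M) < \<infinity>"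
  shows "continuous_on {0..T} (\<lambda>t. expectation (X t))"
proof -
  obtain g where g: "integrable M g"
    "AE \<omega> in M. \<forall>t\<in>{0..T}. norm (X t \<omega>) \<le> g \<omega> \<and> (norm (X t \<omega>))\<^sup>2 \<le> g \<omega>"
    by (rule process_dominated[OF assms])
  show ?thesis
    unfolding continuous_on_sequentially o_def
  proof (intro allI ballI impI)
    fix x t assume t: "t \<in> {0..T}" and x: "(\<forall>n. x n \<in> {0..T}) \<and> x \<longlonglongrightarrow> t"
    show "(\<lambda>n. expectation (X (x n))) \<longlonglongrightarrow> expectation (X t)"
    proof (rule integral_dominated_convergence[where w = g])
      show "AE \<omega> in M. (\<lambda>n. X (x n) \<omega>) \<longlonglongrightarrow> X t \<omega>"
        using cont by eventually_elim (use t x in \<open>auto intro: continuous_on_tendsto_compose\<close>)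
      show "AE \<omega> in M. norm (X (x n) \<omega>) \<le> g \<omega>" for n
        using g(2) by eventually_elim (use x in auto)
    qed (use X t x g in auto)
  qed
qed

text \<open>The norm of the mean is at most 1 plus the second moment at every time: where
  \<open>u s\<close> is not integrable, its expectation has the default value 0. Fubini then gives
  integrability in time.\<close>

lemma set_integrable_expectation:
  fixes u :: "real \<Rightarrow> 'a \<Rightarrow> 'b::euclidean_space"
  assumes u: "u \<in> L2_prog M Filt T" and T: "0 < T"
  shows "set_integrable lborel {0..T} (\<lambda>s. expectation (u s))"
proof -
  define R where "R = restrict_space (lborel :: real measure) {0..T}"
  have sR: "sets R = sets (restrict_space borel {0..T})"
    by (simp add: R_def sets_restrict_space)
  interpret R: finite_measure R
    by (rule finite_measureI)
       (use T in \<open>simp add: R_def emeasure_restrict_space space_restrict_space less_imp_le\<close>)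
  interpret P: pair_sigma_finite R M ..
  have id: "(\<lambda>\<omega>. \<omega>) \<in> measurable M (Filt T)" by (rule measurable_Filt[of _ T]) simp
  have u': "(\<lambda>(s, \<omega>). u s \<omega>) \<in> borel_measurable (restrict_space borel {0..T} \<Otimes>\<^sub>M Filt T)"
    using u T by (simp add: L2_prog_def progressively_measurable_def)
  have "fst \<in> measurable (R \<Otimes>\<^sub>M M) (restrict_space borel {0..T})"
    using measurable_fst[of R M] by (simp only: measurable_cong_sets[OF refl sR])
  from measurable_compose[OF measurable_Pair[OF this measurable_compose[OF measurable_snd id]] u']
  have um [measurable]: "(\<lambda>(s, \<omega>). u s \<omega>) \<in> borel_measurable (R \<Otimes>\<^sub>M M)"
    by (simp add: case_prod_unfold)
  have m: "(\<lambda>s. expectation (u s)) \<in> borel_measurable R"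
    by (rule borel_measurable_lebesgue_integral) (rule um)
  have le: "ennreal (norm (expectation (u s))) \<le> (\<integral>\<^sup>+\<omega>. 1 + ennreal ((norm (u s \<omega>))\<^sup>2) \<partial>M)" for s
  proof (cases "integrable M (u s)")
    case True
    have "norm y \<le> 1 + (norm y)\<^sup>2" for y :: 'b
      using zero_le_power2[of "norm y - 1 / 2"] by (simp add: power2_eq_square algebra_simps)
    then have pt: "ennreal (norm y) \<le> 1 + ennreal ((norm y)\<^sup>2)" for y :: 'b
      by (metis ennreal_1 ennreal_leI ennreal_plus zero_le_one zero_le_power2)
    have "ennreal (norm (expectation (u s))) \<le> (\<integral>\<^sup>+\<omega>. ennreal (norm (u s \<omega>)) \<partial>M)"
      by (rule integral_norm_bound_ennreal[OF True])
    also have "\<dots> \<le> (\<integral>\<^sup>+\<omega>. 1 + ennreal ((norm (u s \<omega>))\<^sup>2) \<partial>M)"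
      by (intro nn_integral_mono pt)
    finally show ?thesis .
  next
    case False
    then show ?thesis by (simp add: not_integrable_integral_eq)
  qed
  have "(\<integral>\<^sup>+s. ennreal (norm (expectation (u s))) \<partial>R) \<le> (\<integral>\<^sup>+s. (\<integral>\<^sup>+\<omega>. 1 + ennreal ((norm (u s \<omega>))\<^sup>2) \<partial>M) \<partial>R)"
    by (intro nn_integral_mono le)
  also have "\<dots> = (\<integral>\<^sup>+\<omega>. (\<integral>\<^sup>+s. 1 + ennreal ((norm (u s \<omega>))\<^sup>2) \<partial>R) \<partial>M)"
    by (rule P.Fubini' [symmetric]) measurable
  also have "\<dots> = (\<integral>\<^sup>+\<omega>. emeasure R (space R) + (\<integral>\<^sup>+s. ennreal ((norm (u s \<omega>))\<^sup>2) \<partial>R) \<partial>M)"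
    by (intro nn_integral_cong) (simp add: nn_integral_add)
  also have "\<dots> = emeasure R (space R) + (\<integral>\<^sup>+\<omega>. (\<integral>\<^sup>+s. ennreal ((norm (u s \<omega>))\<^sup>2) \<partial>R) \<partial>M)"
    by (subst nn_integral_add) (auto simp: emeasure_space_1)
  also have "\<dots> < \<infinity>"
  proof -
    have "(\<integral>\<^sup>+\<omega>. (\<integral>\<^sup>+s. ennreal ((norm (u s \<omega>))\<^sup>2) \<partial>R) \<partial>M) < \<infinity>"
      using u by (simp add: R_def nn_integral_restrict_space L2_prog_def)
    moreover have "emeasure R (space R) < \<infinity>"
      using R.emeasure_finite[of "space R"] by (metis infinity_ennreal_def less_top)
    ultimately show ?thesis by simp
  qed
  finally have "integrable R (\<lambda>s. expectation (u s))"
    using m by (simp add: integrable_iff_bounded)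
  then show ?thesis
    unfolding R_def set_integrable_def by (subst (asm) integrable_restrict_space) auto
qed

lemma solution_char:
  fixes A1 A2 C :: "real^'d^'d" and B2 D2 :: "real^'n^'d"
  assumes T: "0 < T" and u: "u \<in> L2_prog M Filt T" and sol: "mf_solution M Filt W T A1 A2 B2 C D2 x u X"
  defines "\<phi> \<equiv> \<lambda>s. C *v expectation (X s) + D2 *v expectation (u s)"
  shows "(\<lambda>s \<omega>::'a. \<phi> s) \<in> L2_prog M Filt T" and "X T \<in> borel_measurable M"
    and "\<exists>\<alpha>. \<forall>w. (CLINT \<omega>|M. iexp (w \<bullet> X T \<omega>))
      = iexp (w \<bullet> \<alpha>) * exp (- (LBINT s. (indicat_real {0<..T} s * (w \<bullet> (mexp A1 (T - s) *v \<phi> s)))\<^sup>2) / 2)"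
proof -
  have X_F: "\<And>t. t \<in> {0..T} \<Longrightarrow> X t \<in> borel_measurable (Filt t)"
    and X_cont: "AE \<omega> in M. continuous_on {0..T} (\<lambda>t. X t \<omega>)"
    and X_sup: "(\<integral>\<^sup>+\<omega>. (SUP t\<in>{0..T}. ennreal ((norm (X t \<omega>))\<^sup>2)) \<partial>M) < \<infinity>"
    using sol unfolding mf_solution_def by blast+
  obtain I where ito: "ito_integral M Filt W T (\<lambda>s \<omega>. \<phi> s) I"
    and X_eq: "AE \<omega> in M. \<forall>t\<in>{0..T}. X t \<omega> = x +
      (LBINT s:{0..t}. A1 *v X s \<omega> + A2 *v expectation (X s) + B2 *v expectation (u s)) + I t \<omega>"
    using sol unfolding mf_solution_def \<phi>_def by blast
  show "(\<lambda>s \<omega>::'a. \<phi> s) \<in> L2_prog M Filt T" using ito by (simp add: ito_integral_def)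
  have X_m: "X t \<in> borel_measurable M" if "t \<in> {0..T}" for t
    by (rule measurable_Filt[OF X_F[OF that]])
  show XT: "X T \<in> borel_measurable M" using T by (intro X_m) simp
  have m_cont: "continuous_on {0..T} (\<lambda>t. expectation (X t))"
    by (rule continuous_on_expectation[OF T X_m X_cont X_sup])
  define b where "b s = A2 *v expectation (X s) + B2 *v expectation (u s)" for s
  have "set_integrable lborel {0..T} (\<lambda>s. A2 *v expectation (X s))"
    by (intro borel_integrable_atLeastAtMost' continuous_intros m_cont)
  moreover have "set_integrable lborel {0..T} (\<lambda>s. B2 *v expectation (u s))"
    using integrable_bounded_linear[OF matrix_vector_mul_bounded_linear[of B2]
        set_integrable_expectation[OF u T, unfolded set_integrable_def]]
    by (simp add: set_integrable_def matrix_vector_mult_scaleR)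
  ultimately have b: "set_integrable lborel {0..T} b"
    unfolding b_def by (rule set_integral_add)
  \<comment> \<open>The drift caused by the means is merely integrable, but its primitive is
    continuous, as required of a forcing term in \<open>variation_of_constants\<close>.\<close>
  define \<beta> where "\<beta> t = integral {0..t} b" for t
  have \<beta>: "continuous_on {0..T} \<beta>"
    unfolding \<beta>_def by (intro indefinite_integral_continuous_1 set_borel_integral_eq_integral(1) b)
  \<comment> \<open>The response to the initial value and to \<open>\<beta>\<close>; by linearity it
    separates from the response to the path of \<open>I\<close>.\<close>
  define \<alpha> where "\<alpha> = mexp A1 T *v x + \<beta> T + integral {0..T} (\<lambda>s. (A1 ** mexp A1 (T - s)) *v \<beta> s)"
  have I_cont: "AE \<omega> in M. continuous_on {0..T} (\<lambda>t. I t \<omega>)" using ito by (simp add: ito_integral_def)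
  have Y_eq: "AE \<omega> in M. X T \<omega> - \<alpha> = I T \<omega> + integral {0..T} (\<lambda>s. (A1 ** mexp A1 (T - s)) *v I s \<omega>)"
    using X_cont I_cont X_eq
  proof eventually_elim
    case (elim \<omega>)
    have AX: "continuous_on {0..T} (\<lambda>s. A1 *v X s \<omega>)" by (intro continuous_intros elim)
    have "X T \<omega> = mexp A1 T *v x + (\<beta> T + I T \<omega>) + integral {0..T} (\<lambda>s. (A1 ** mexp A1 (T - s)) *v (\<beta> s + I s \<omega>))"
    proof (rule variation_of_constants)
      fix t assume t: "t \<in> {0..T}"
      have i1: "set_integrable lborel {0..t} (\<lambda>s. A1 *v X s \<omega>)"
        using t by (intro borel_integrable_atLeastAtMost' continuous_on_subset[OF AX]) auto
      have i2: "set_integrable lborel {0..t} b"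
        using t by (intro set_integrable_subset[OF b]) auto
      have "(LBINT s:{0..t}. A1 *v X s \<omega> + A2 *v expectation (X s) + B2 *v expectation (u s))
        = (LBINT s:{0..t}. A1 *v X s \<omega> + b s)"
        by (simp add: b_def add.assoc)
      also have "\<dots> = integral {0..t} (\<lambda>s. A1 *v X s \<omega>) + \<beta> t"
        using i1 i2 by (simp add: set_integral_add set_borel_integral_eq_integral \<beta>_def)
      finally show "X t \<omega> = x + integral {0..t} (\<lambda>s. A1 *v X s \<omega>) + (\<beta> t + I t \<omega>)"
        using elim(3) t by (simp add: add.assoc)
    qed (use T elim \<beta> in \<open>auto intro!: continuous_intros\<close>)
    moreover have "integral {0..T} (\<lambda>s. (A1 ** mexp A1 (T - s)) *v (\<beta> s + I s \<omega>))
      = integral {0..T} (\<lambda>s. (A1 ** mexp A1 (T - s)) *v \<beta> s) + integral {0..T} (\<lambda>s. (A1 ** mexp A1 (T - s)) *v I s \<omega>)"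
      unfolding matrix_vector_right_distrib
      by (intro integral_add integrable_continuous_interval continuous_on_matrix_vector_mult \<beta> elim
          bounded_bilinear.continuous_on[OF bounded_bilinear_matrix_matrix_mult] continuous_intros)
    ultimately show ?case by (simp add: \<alpha>_def)
  qed
  have "(CLINT \<omega>|M. iexp (w \<bullet> X T \<omega>))
      = iexp (w \<bullet> \<alpha>) * exp (- (LBINT s. (indicat_real {0<..T} s * (w \<bullet> (mexp A1 (T - s) *v \<phi> s)))\<^sup>2) / 2)" for w
  proof -
    have "iexp (w \<bullet> X T \<omega>) = iexp (w \<bullet> \<alpha>) * iexp (w \<bullet> (X T \<omega> - \<alpha>))" for \<omega>
      by (simp add: inner_diff_right exp_add [symmetric] distrib_left [symmetric])
    then have "(CLINT \<omega>|M. iexp (w \<bullet> X T \<omega>)) = iexp (w \<bullet> \<alpha>) * (CLINT \<omega>|M. iexp (w \<bullet> (X T \<omega> - \<alpha>)))"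
      by (simp only: integral_mult_right_zero)
    then show ?thesis
      using ito_convolution_char[OF T ito _ Y_eq, of w] XT by simp
  qed
  then show "\<exists>\<alpha>. \<forall>w. (CLINT \<omega>|M. iexp (w \<bullet> X T \<omega>))
      = iexp (w \<bullet> \<alpha>) * exp (- (LBINT s. (indicat_real {0<..T} s * (w \<bullet> (mexp A1 (T - s) *v \<phi> s)))\<^sup>2) / 2)" by blast
qed

end

section \<open>Construction of solutions\<close>

lemma summation_by_parts:
  fixes a :: "nat \<Rightarrow> 'b::real_vector" and b :: "nat \<Rightarrow> real"
  shows "(\<Sum>i<n. (b (Suc i) - b i) *\<^sub>R a i) = b n *\<^sub>R a n - b 0 *\<^sub>R a 0 - (\<Sum>i<n. b (Suc i) *\<^sub>R (a (Suc i) - a i))"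
proof (induction n)
  case (Suc n)
  have "(b' - b) *\<^sub>R x + (b *\<^sub>R x - c - S) = b' *\<^sub>R y - c - (S + b' *\<^sub>R (y - x))"
    for b b' :: real and x y c S :: 'b
    by (simp add: scaleR_left_diff_distrib scaleR_right_diff_distrib)
  then show ?case unfolding sum.lessThan_Suc Suc.IH add.commute[of _ "(b (Suc n) - b n) *\<^sub>R a n"] .
qed simp

lemma C1_Lipschitz:
  fixes f :: "real \<Rightarrow> 'b::euclidean_space"
  assumes f: "\<And>s. (f has_vector_derivative f' s) (at s)" and f': "continuous_on UNIV f'"
  obtains L where "0 \<le> L" "\<And>a b. 0 \<le> a \<Longrightarrow> a \<le> b \<Longrightarrow> b \<le> T \<Longrightarrow> norm (f b - f a) \<le> L * (b - a)"
proof -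
  have "bounded (f' ` {0..T})"
    by (intro compact_imp_bounded compact_continuous_image continuous_on_subset[OF f']) auto
  then obtain L where L: "0 < L" "\<And>s. s \<in> {0..T} \<Longrightarrow> norm (f' s) \<le> L"
    unfolding bounded_pos by (auto simp only: ball_simps)
  show thesis
  proof (rule that[of L])
    fix a b :: real assume ab: "0 \<le> a" "a \<le> b" "b \<le> T"
    have "(f' has_integral f b - f a) {a..b}"
      by (rule fundamental_theorem_of_calculus[OF ab(2) has_vector_derivative_at_within[OF f]])
    then show "norm (f b - f a) \<le> L * (b - a)"
      using has_integral_bound[of L f' "f b - f a" a b] L ab by (auto simp: content_real)
  qed (use L in simp)
qed

context brownian
begin

text \<open>\<open>W\<close> is set to 0 on a null set that contains all bad paths. The result stays
  adapted because the filtration contains the null sets.\<close>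

lemma continuous_version:
  obtains V where "\<And>t. 0 \<le> t \<Longrightarrow> V t \<in> borel_measurable (Filt t)"
    and "\<And>\<omega>. \<omega> \<in> space M \<Longrightarrow> continuous_on {0..} (\<lambda>t. V t \<omega>)"
    and "\<And>\<omega>. \<omega> \<in> space M \<Longrightarrow> V 0 \<omega> = 0"
    and "AE \<omega> in M. \<forall>t. V t \<omega> = W t \<omega>"
proof -
  have "AE \<omega> in M. W 0 \<omega> = 0 \<and> continuous_on {0..} (\<lambda>t. W t \<omega>)"
    using W_0 continuous_W by eventually_elim simp
  then obtain N where N: "N \<in> null_sets M"
    "{\<omega> \<in> space M. \<not> (W 0 \<omega> = 0 \<and> continuous_on {0..} (\<lambda>t. W t \<omega>))} \<subseteq> N"
    by (elim AE_E) (auto simp: null_sets_def)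
  define V where "V t \<omega> = (if \<omega> \<in> N then 0 else W t \<omega>)" for t \<omega>
  show thesis
  proof (rule that[of V])
    fix t :: real assume t: "0 \<le> t"
    have "N \<in> sets (Filt t)" by (rule null_sets_Filt[OF N(1)])
    then have "N \<inter> space (Filt t) \<in> sets (Filt t)" by (rule sets.Int) (rule sets.top)
    then show "V t \<in> borel_measurable (Filt t)"
      unfolding V_def [abs_def] by (intro measurable_If_set measurable_W_Filt t) auto
  next
    fix \<omega> assume "\<omega> \<in> space M"
    then show "continuous_on {0..} (\<lambda>t. V t \<omega>)" "V 0 \<omega> = 0"
      using N(2) by (cases "\<omega> \<in> N"; force simp: V_def)+
  next
    show "AE \<omega> in M. \<forall>t. V t \<omega> = W t \<omega>"
      using AE_not_in[OF N(1)] by eventually_elim (simp add: V_def)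
  qed
qed

lemma L2_prog_continuous:
  fixes v :: "real \<Rightarrow> 'b::euclidean_space"
  assumes v: "continuous_on {0..T} v"
  shows "(\<lambda>s (\<omega>::'a). v s) \<in> L2_prog M Filt T"
  unfolding L2_prog_def progressively_measurable_def mem_Collect_eq
proof
  show "\<forall>t\<in>{0..T}. (\<lambda>(s, \<omega>). v s) \<in> borel_measurable (restrict_space borel {0..t} \<Otimes>\<^sub>M Filt t)"
  proof
    fix t assume t: "t \<in> {0..T}"
    have "v \<in> borel_measurable (restrict_space borel {0..t})"
      using t by (intro borel_measurable_continuous_on_restrict continuous_on_subset[OF v]) auto
    from measurable_compose[OF measurable_fst this]
    show "(\<lambda>(s, \<omega>). v s) \<in> borel_measurable (restrict_space borel {0..t} \<Otimes>\<^sub>M Filt t)"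
      by (simp add: case_prod_unfold)
  qed
  have "bounded (v ` {0..T})" by (intro compact_imp_bounded compact_continuous_image v) auto
  then obtain B where B: "\<And>s. s \<in> {0..T} \<Longrightarrow> norm (v s) \<le> B"
    unfolding bounded_iff by (auto simp only: ball_simps)
  have "(\<integral>\<^sup>+s\<in>{0..T}. ennreal ((norm (v s))\<^sup>2) \<partial>lborel) \<le> (\<integral>\<^sup>+s. ennreal (B\<^sup>2) * indicator {0..T} s \<partial>lborel)"
    using B by (intro nn_integral_mono) (auto split: split_indicator intro!: ennreal_leI power_mono)
  also have "\<dots> = ennreal (B\<^sup>2) * emeasure lborel {0..T}"
    by (rule nn_integral_cmult_indicator) simp
  also have "\<dots> < \<infinity>" by (simp add: ennreal_mult_less_top emeasure_lborel_Icc_eq)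
  finally show "(\<integral>\<^sup>+\<omega>. (\<integral>\<^sup>+s\<in>{0..T}. ennreal ((norm (v s))\<^sup>2) \<partial>lborel) \<partial>M) < \<infinity>"
    by (simp add: emeasure_space_1)
qed

text \<open>Needed because the diffusion coefficient of the constructed solution is identified on
  \<open>{0..T}\<close> only.\<close>

lemma ito_integral_cong:
  assumes eq: "\<And>s. s \<in> {0..T} \<Longrightarrow> \<phi> s = \<psi> s" and ito: "ito_integral M Filt W T (\<lambda>s \<omega>. \<phi> s) I"
  shows "ito_integral M Filt W T (\<lambda>s \<omega>. \<psi> s) I"
proof -
  have nn: "(\<integral>\<^sup>+s\<in>{0..T}. g (\<phi> s) s \<partial>lborel) = (\<integral>\<^sup>+s\<in>{0..T}. g (\<psi> s) s \<partial>lborel)" for g :: "'b \<Rightarrow> real \<Rightarrow> ennreal"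
    using eq by (intro nn_integral_cong) (auto split: split_indicator)
  have "(\<lambda>(s, \<omega>). \<phi> s) \<in> borel_measurable (restrict_space borel {0..t} \<Otimes>\<^sub>M Filt t)
     \<longleftrightarrow> (\<lambda>(s, \<omega>). \<psi> s) \<in> borel_measurable (restrict_space borel {0..t} \<Otimes>\<^sub>M Filt t)" if "t \<in> {0..T}" for t
    using that eq by (intro measurable_cong) (auto simp: space_pair_measure space_restrict_space)
  then have L2: "(\<lambda>s (\<omega>::'a). \<psi> s) \<in> L2_prog M Filt T"
    using ito nn[of "\<lambda>y s. ennreal ((norm y)\<^sup>2)"]
    by (auto simp: ito_integral_def L2_prog_def progressively_measurable_def)
  have eqn: "(\<integral>\<^sup>+s\<in>{0..T}. ennreal ((norm (simple_value N p \<xi> s \<omega> - \<phi> s))\<^sup>2) \<partial>lborel)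
    = (\<integral>\<^sup>+s\<in>{0..T}. ennreal ((norm (simple_value N p \<xi> s \<omega> - \<psi> s))\<^sup>2) \<partial>lborel)"
    for N p and \<xi> :: "nat \<Rightarrow> 'a \<Rightarrow> 'b" and \<omega>
    using nn[of "\<lambda>y s. ennreal ((norm (simple_value N p \<xi> s \<omega> - y))\<^sup>2)"] .
  show ?thesis using ito L2 unfolding ito_integral_def eqn by blast
qed

text \<open>\<open>f\<close> may itself be a supremum over an interval and so need not be
  measurable. Passing to the dyadic supremum of \<open>Z\<close> on the right makes additivity of
  the integral applicable.\<close>

lemma nn_integral_Sup_bound:
  fixes Z :: "real \<Rightarrow> 'a \<Rightarrow> 'b::euclidean_space"
  assumes T: "0 < T" and Z: "\<And>t. t \<in> {0..T} \<Longrightarrow> Z t \<in> borel_measurable M"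
    and cont: "\<And>\<omega>. \<omega> \<in> space M \<Longrightarrow> continuous_on {0..T} (\<lambda>t. Z t \<omega>)"
    and fin: "(\<integral>\<^sup>+\<omega>. (SUP t\<in>{0..T}. ennreal ((norm (Z t \<omega>))\<^sup>2)) \<partial>M) < \<infinity>"
    and f: "\<And>\<omega>. \<omega> \<in> space M \<Longrightarrow>
      f \<omega> \<le> ennreal c + ennreal d * (SUP t\<in>{0..T}. ennreal ((norm (Z t \<omega>))\<^sup>2))"
  shows "(\<integral>\<^sup>+\<omega>. f \<omega> \<partial>M) < \<infinity>"
proof -
  let ?H = "\<lambda>\<omega>. SUP n. SUP k\<in>{..(2::nat) ^ n}. ennreal ((norm (Z (real k * T / 2 ^ n) \<omega>))\<^sup>2)"
  have H: "?H \<in> borel_measurable M"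
  proof (intro borel_measurable_SUP)
    fix n k assume k: "k \<in> {..(2::nat) ^ n}"
    note [measurable] = Z[OF dyadic_in_interval[OF T k]]
    show "(\<lambda>\<omega>. ennreal ((norm (Z (real k * T / 2 ^ n) \<omega>))\<^sup>2)) \<in> borel_measurable M" by measurable
  qed auto
  have "f \<omega> \<le> ennreal c + ennreal d * ?H \<omega>" if \<omega>: "\<omega> \<in> space M" for \<omega>
  proof -
    have "(SUP t\<in>{0..T}. ennreal ((norm (Z t \<omega>))\<^sup>2)) \<le> ?H \<omega>"
      by (rule SUP_least) (rule sup_le_dyadic[OF cont[OF \<omega>] T])
    from order_trans[OF f[OF \<omega>] add_left_mono[OF mult_left_mono[OF this zero_le]]] show ?thesis .
  qed
  then have "(\<integral>\<^sup>+\<omega>. f \<omega> \<partial>M) \<le> (\<integral>\<^sup>+\<omega>. ennreal c + ennreal d * ?H \<omega> \<partial>M)"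
    by (rule nn_integral_mono)
  also have "\<dots> = ennreal c + ennreal d * (\<integral>\<^sup>+\<omega>. ?H \<omega> \<partial>M)"
    using H by (simp add: nn_integral_add nn_integral_cmult emeasure_space_1)
  also have "\<dots> < \<infinity>"
  proof -
    have "(\<integral>\<^sup>+\<omega>. ?H \<omega> \<partial>M) \<le> (\<integral>\<^sup>+\<omega>. (SUP t\<in>{0..T}. ennreal ((norm (Z t \<omega>))\<^sup>2)) \<partial>M)"
      by (intro nn_integral_mono SUP_least SUP_upper dyadic_in_interval T)
    with fin have "(\<integral>\<^sup>+\<omega>. ?H \<omega> \<partial>M) < \<infinity>" by (rule order_le_less_trans[rotated])
    then show ?thesis by (simp add: ennreal_mult_less_top)
  qed
  finally show ?thesis .
qed

text \<open>Integration by parts serves as construction. Summation by parts turns the simple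
  integrals with left endpoint values of \<sigma> into
  \<open>V t \<omega> *\<^sub>R \<sigma> t\<close> minus Riemann-Stieltjes sums, which converge path
  by path; the supremum of \<open>V\<close> dominates and gives mean square convergence.\<close>

lemma ito_integral_by_parts:
  fixes \<sigma> :: "real \<Rightarrow> 'b::euclidean_space"
  assumes T: "0 < T" and \<sigma>: "\<And>s. (\<sigma> has_vector_derivative \<sigma>' s) (at s)" and \<sigma>': "continuous_on UNIV \<sigma>'"
    and V: "\<And>t. 0 \<le> t \<Longrightarrow> V t \<in> borel_measurable (Filt t)"
      "\<And>\<omega>. \<omega> \<in> space M \<Longrightarrow> continuous_on {0..} (\<lambda>t. V t \<omega>)"
      "\<And>\<omega>. \<omega> \<in> space M \<Longrightarrow> V 0 \<omega> = 0" "AE \<omega> in M. \<forall>t. V t \<omega> = W t \<omega>"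
  defines "Z \<equiv> \<lambda>t \<omega>. V t \<omega> *\<^sub>R \<sigma> t - integral {0..t} (\<lambda>s. V s \<omega> *\<^sub>R \<sigma>' s)"
  shows "ito_integral M Filt W T (\<lambda>s \<omega>. \<sigma> s) Z"
    and "\<And>\<omega>. \<omega> \<in> space M \<Longrightarrow> continuous_on {0..T} (\<lambda>t. Z t \<omega>)"
    and "(\<integral>\<^sup>+\<omega>. (SUP t\<in>{0..T}. ennreal ((norm (Z t \<omega>))\<^sup>2)) \<partial>M) < \<infinity>"
proof -
  define pr where "pr = (\<lambda>(a::'b) (b::real). b *\<^sub>R a)"
  have pr: "bounded_bilinear pr"
    unfolding pr_def by (rule bounded_bilinear.flip[OF bounded_bilinear_scaleR])
  have \<sigma>cont: "continuous_on UNIV \<sigma>"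
    by (intro continuous_at_imp_continuous_on ballI has_vector_derivative_continuous[OF \<sigma>])
  have VT: "continuous_on {0..T} (\<lambda>t. V t \<omega>)" if "\<omega> \<in> space M" for \<omega>
    by (rule continuous_on_subset[OF V(2)[OF that]]) auto
  have V\<sigma>': "continuous_on {0..T} (\<lambda>s. V s \<omega> *\<^sub>R \<sigma>' s)" if "\<omega> \<in> space M" for \<omega>
    by (intro continuous_intros VT that continuous_on_subset[OF \<sigma>']) auto
  show Zcont: "continuous_on {0..T} (\<lambda>t. Z t \<omega>)" if "\<omega> \<in> space M" for \<omega>
    unfolding Z_def
    by (intro continuous_intros VT that continuous_on_subset[OF \<sigma>cont] indefinite_integral_continuous_1
        integrable_continuous_interval V\<sigma>') auto
  define RS where "RS n t \<omega> = (\<Sum>j<Suc n. pr (\<sigma> (grid T t n (Suc j)) - \<sigma> (grid T t n j)) (V (grid T t n (Suc j)) \<omega>))" for n t \<omega>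
  have RS_lim: "(\<lambda>n. RS n t \<omega>) \<longlonglongrightarrow> integral {0..t} (\<lambda>s. V s \<omega> *\<^sub>R \<sigma>' s)" if "\<omega> \<in> space M" "t \<in> {0..T}" for \<omega> t
    unfolding RS_def using Riemann_Stieltjes_tendsto[OF pr \<sigma> \<sigma>' VT[OF that(1)] T that(2)] by (simp add: pr_def)
  have ZF: "Z t \<in> borel_measurable (Filt t)" if t: "t \<in> {0..T}" for t
  proof -
    have "(\<lambda>\<omega>. integral {0..t} (\<lambda>s. V s \<omega> *\<^sub>R \<sigma>' s)) \<in> borel_measurable (Filt t)"
    proof (rule borel_measurable_LIMSEQ_metric)
      show "(\<lambda>\<omega>. RS n t \<omega>) \<in> borel_measurable (Filt t)" for n
        unfolding RS_def pr_def
      proof (intro borel_measurable_sum borel_measurable_scaleR borel_measurable_const)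
        fix j
        show "(\<lambda>\<omega>. V (grid T t n (Suc j)) \<omega>) \<in> borel_measurable (Filt t)"
          using grid_bounds(1)[OF T t, of n "Suc j"] by (intro measurable_Filt_mono[OF V(1)]) auto
      qed
    qed (use RS_lim[OF _ t] in simp)
    then show ?thesis
      unfolding Z_def using V(1)[of t] t by (intro borel_measurable_diff borel_measurable_scaleR) auto
  qed
  have VM: "V t \<in> borel_measurable M" if "t \<in> {0..T}" for t
    using V(1)[of t] that by (intro measurable_Filt[of "V t" t]) auto
  have ZM: "Z t \<in> borel_measurable M" if "t \<in> {0..T}" for t
    by (rule measurable_Filt[OF ZF[OF that]])
  have supV: "(\<integral>\<^sup>+\<omega>. (SUP t\<in>{0..T}. ennreal ((norm (V t \<omega>))\<^sup>2)) \<partial>M) < \<infinity>"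
  proof -
    have "(\<integral>\<^sup>+\<omega>. (SUP t\<in>{0..T}. ennreal ((norm (V t \<omega>))\<^sup>2)) \<partial>M) = (\<integral>\<^sup>+\<omega>. (SUP t\<in>{0..T}. ennreal ((W t \<omega>)\<^sup>2)) \<partial>M)"
      using V(4) by (intro nn_integral_cong_AE) (auto elim!: eventually_mono)
    with Sup_W_finite[OF T] show ?thesis by simp
  qed
  obtain K where K: "0 < K" "\<And>s y. s \<in> {0..T} \<Longrightarrow> norm (pr (\<sigma>' s) y) \<le> K * norm y"
    using Riemann_Stieltjes_bound[OF pr \<sigma>', of T] by blast
  obtain K0 where K0: "0 < K0" "\<And>s y. s \<in> {0..T} \<Longrightarrow> norm (pr (\<sigma> s) y) \<le> K0 * norm y"
    using Riemann_Stieltjes_bound[OF pr \<sigma>cont, of T] by blast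
  show "(\<integral>\<^sup>+\<omega>. (SUP t\<in>{0..T}. ennreal ((norm (Z t \<omega>))\<^sup>2)) \<partial>M) < \<infinity>"
  proof -
    \<comment> \<open>\<open>K0\<close> bounds the boundary term and \<open>K * T\<close> the
      integral, both relative to the largest modulus of \<open>V\<close> on
      \<open>{0..T}\<close>.\<close>
    define c where "c = (K0 + K * T)\<^sup>2"
    have "(SUP t\<in>{0..T}. ennreal ((norm (Z t \<omega>))\<^sup>2)) \<le> ennreal c * (SUP t\<in>{0..T}. ennreal ((norm (V t \<omega>))\<^sup>2))"
      if \<omega>: "\<omega> \<in> space M" for \<omega>
    proof (rule SUP_least)
      fix t assume t: "t \<in> {0..T}"
      have "\<exists>s0\<in>{0..T}. \<forall>s\<in>{0..T}. norm (V s \<omega>) \<le> norm (V s0 \<omega>)"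
        using T by (intro continuous_attains_sup continuous_intros VT \<omega>) auto
      then obtain s0 where s0: "s0 \<in> {0..T}" "\<And>s. s \<in> {0..T} \<Longrightarrow> norm (V s \<omega>) \<le> norm (V s0 \<omega>)" by blast
      have "norm (V t \<omega> *\<^sub>R \<sigma> t) \<le> K0 * norm (V s0 \<omega>)"
        using order_trans[OF K0(2)[OF t] mult_left_mono[OF s0(2)[OF t] less_imp_le[OF K0(1)]]] unfolding pr_def .
      moreover have "norm (integral {0..t} (\<lambda>s. V s \<omega> *\<^sub>R \<sigma>' s)) \<le> (K * norm (V s0 \<omega>)) * (t - 0)"
      proof (rule integral_bound)
        show "continuous_on {0..t} (\<lambda>s. V s \<omega> *\<^sub>R \<sigma>' s)"
          using t by (intro continuous_on_subset[OF V\<sigma>'[OF \<omega>]]) auto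
        show "norm (V s \<omega> *\<^sub>R \<sigma>' s) \<le> K * norm (V s0 \<omega>)" if "s \<in> {0..t}" for s
        proof -
          have s: "s \<in> {0..T}" using that t by auto
          show ?thesis
            using order_trans[OF K(2)[OF s] mult_left_mono[OF s0(2)[OF s] less_imp_le[OF K(1)]]] unfolding pr_def .
        qed
      qed (use t in simp)
      moreover have "(K * norm (V s0 \<omega>)) * (t - 0) \<le> (K * norm (V s0 \<omega>)) * T"
        using t K by (intro mult_left_mono) auto
      ultimately have "norm (Z t \<omega>) \<le> (K0 + K * T) * norm (V s0 \<omega>)"
        unfolding Z_def using norm_triangle_ineq4[of "V t \<omega> *\<^sub>R \<sigma> t" "integral {0..t} (\<lambda>s. V s \<omega> *\<^sub>R \<sigma>' s)"]
        by (simp add: algebra_simps)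
      then have "(norm (Z t \<omega>))\<^sup>2 \<le> c * (norm (V s0 \<omega>))\<^sup>2"
        unfolding c_def power_mult_distrib [symmetric] by (intro power_mono) auto
      then have "ennreal ((norm (Z t \<omega>))\<^sup>2) \<le> ennreal c * ennreal ((norm (V s0 \<omega>))\<^sup>2)"
        by (subst ennreal_mult [symmetric]) (auto simp: c_def intro: ennreal_leI)
      also have "\<dots> \<le> ennreal c * (SUP t\<in>{0..T}. ennreal ((norm (V t \<omega>))\<^sup>2))"
        by (intro mult_left_mono SUP_upper s0) auto
      finally show "ennreal ((norm (Z t \<omega>))\<^sup>2) \<le> ennreal c * (SUP t\<in>{0..T}. ennreal ((norm (V t \<omega>))\<^sup>2))" .
    qed
    then show ?thesis
      by (intro nn_integral_Sup_bound[OF T VM VT supV, where c = 0 and d = c]) simp_all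
  qed
  have "AE \<omega> in M. continuous_on {0..T} (\<lambda>t. V t \<omega>)" by (intro AE_I2 VT)
  from process_dominated[OF T VM this supV] obtain g where g: "integrable M g"
    "AE \<omega> in M. \<forall>t\<in>{0..T}. norm (V t \<omega>) \<le> g \<omega> \<and> (norm (V t \<omega>))\<^sup>2 \<le> g \<omega>" by blast
  define \<xi> where "\<xi> n i = (\<lambda>\<omega>::'a. \<sigma> (grid T T n i))" for n i
  have T': "T \<in> {0..T}" "0 \<le> T" using T by auto
  have sp: "simple_process M Filt T (Suc n) (grid T T n) (\<xi> n)" for n
    unfolding simple_process_def \<xi>_def
    using grid_0[OF T'(2)] grid_end[OF order_refl] grid_bounds(2)[OF T T'(1)] by auto
  have sv: "(\<lambda>n. \<integral>\<^sup>+\<omega>. (\<integral>\<^sup>+s\<in>{0..T}. ennreal ((norm (simple_value (Suc n) (grid T T n) (\<xi> n) s \<omega> - \<sigma> s))\<^sup>2) \<partial>lborel) \<partial>M) \<longlonglongrightarrow> 0"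
  proof -
    obtain L where L: "0 \<le> L" "\<And>a b. 0 \<le> a \<Longrightarrow> a \<le> b \<Longrightarrow> b \<le> T \<Longrightarrow> norm (\<sigma> b - \<sigma> a) \<le> L * (b - a)"
      using C1_Lipschitz[OF \<sigma> \<sigma>', of T] by blast
    have pt: "norm (simple_value (Suc n) (grid T T n) (\<xi> n) s \<omega> - \<sigma> s) \<le> L * (T / real (Suc n))"
      if s: "s \<in> {0<..T}" for n s \<omega>
    proof -
      let ?p = "grid T T n"
      note gb = grid_bounds[OF T T'(1), of n]
      have "(\<Sum>i<Suc n. indicat_real {?p i<..?p (Suc i)} s) = (\<Sum>i<Suc n. indicat_real {0<..?p (Suc i)} s - indicat_real {0<..?p i} s)"
      proof (rule sum.cong[OF refl])
        fix i show "indicat_real {?p i<..?p (Suc i)} s = indicat_real {0<..?p (Suc i)} s - indicat_real {0<..?p i} s"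
          using gb(1)[of i] gb(2)[of i] by (auto split: split_indicator)
      qed
      also have "\<dots> = 1"
        using s unfolding sum_lessThan_telescope[of "\<lambda>i. indicat_real {0<..?p i} s"] grid_0[OF T'(2)] grid_end[OF order_refl] by simp
      finally have one: "(\<Sum>i<Suc n. indicat_real {?p i<..?p (Suc i)} s) = 1" .
      have "simple_value (Suc n) ?p (\<xi> n) s \<omega> - \<sigma> s = (\<Sum>i<Suc n. indicat_real {?p i<..?p (Suc i)} s *\<^sub>R (\<sigma> (?p i) - \<sigma> s))"
        unfolding simple_value_def \<xi>_def scaleR_diff_right sum_subtractf scaleR_left.sum [symmetric] one by simp
      also have "norm \<dots> \<le> (\<Sum>i<Suc n. indicat_real {?p i<..?p (Suc i)} s * (L * (T / real (Suc n))))"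
      proof (rule sum_norm_le)
        fix i
        show "norm (indicat_real {?p i<..?p (Suc i)} s *\<^sub>R (\<sigma> (?p i) - \<sigma> s)) \<le> indicat_real {?p i<..?p (Suc i)} s * (L * (T / real (Suc n)))"
        proof (cases "s \<in> {?p i<..?p (Suc i)}")
          case True
          have "norm (\<sigma> s - \<sigma> (?p i)) \<le> L * (s - ?p i)"
            using True gb(1)[of i] s by (intro L) auto
          also have "\<dots> \<le> L * (T / real (Suc n))"
            using True gb(3)[of i] L(1) by (intro mult_left_mono) auto
          finally show ?thesis using True by (simp add: norm_minus_commute)
        qed simp
      qed
      also have "\<dots> = L * (T / real (Suc n))" unfolding sum_distrib_right [symmetric] one by simp
      finally show ?thesis .
    qed
    have ub: "(\<integral>\<^sup>+\<omega>. (\<integral>\<^sup>+s\<in>{0..T}. ennreal ((norm (simple_value (Suc n) (grid T T n) (\<xi> n) s \<omega> - \<sigma> s))\<^sup>2) \<partial>lborel) \<partial>M)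
        \<le> ennreal ((L * (T / real (Suc n)))\<^sup>2 * T)" for n
    proof -
      have c: "(\<integral>\<^sup>+s. ennreal ((L * (T / real (Suc n)))\<^sup>2) * indicator {0..T} s \<partial>lborel) = ennreal ((L * (T / real (Suc n)))\<^sup>2 * T)"
      proof -
        have "ennreal x * emeasure lborel {0..T} = ennreal (x * T)" if "0 \<le> x" for x
          using T that by (simp add: ennreal_mult)
        then show ?thesis by (subst nn_integral_cmult_indicator) simp_all
      qed
      have inner: "(\<integral>\<^sup>+s\<in>{0..T}. ennreal ((norm (simple_value (Suc n) (grid T T n) (\<xi> n) s \<omega> - \<sigma> s))\<^sup>2) \<partial>lborel)
          \<le> ennreal ((L * (T / real (Suc n)))\<^sup>2 * T)" for \<omega>
        unfolding c [symmetric]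
      proof (rule nn_integral_mono_AE)
        \<comment> \<open>The point 0 lies in no half-open cell, so the simple process is 0 there
          instead of close to \<sigma>; it is excluded as a null set.\<close>
        show "AE s in lborel. ennreal ((norm (simple_value (Suc n) (grid T T n) (\<xi> n) s \<omega> - \<sigma> s))\<^sup>2) * indicator {0..T} s
          \<le> ennreal ((L * (T / real (Suc n)))\<^sup>2) * indicator {0..T} s"
          using AE_lborel_singleton[of "0::real"]
        proof eventually_elim
          case (elim s)
          show ?case
          proof (cases "s \<in> {0..T}")
            case True
            with elim have "s \<in> {0<..T}" by auto
            have "(norm (simple_value (Suc n) (grid T T n) (\<xi> n) s \<omega> - \<sigma> s))\<^sup>2 \<le> (L * (T / real (Suc n)))\<^sup>2"
              by (rule power_mono[OF pt[OF \<open>s \<in> {0<..T}\<close>] norm_ge_zero])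
            from mult_right_mono[OF ennreal_leI[OF this] zero_le] show ?thesis .
          qed simp
        qed
      qed
      have "(\<integral>\<^sup>+\<omega>. (\<integral>\<^sup>+s\<in>{0..T}. ennreal ((norm (simple_value (Suc n) (grid T T n) (\<xi> n) s \<omega> - \<sigma> s))\<^sup>2) \<partial>lborel) \<partial>M)
        \<le> (\<integral>\<^sup>+\<omega>. ennreal ((L * (T / real (Suc n)))\<^sup>2 * T) \<partial>M)" by (rule nn_integral_mono) (rule inner)
      then show ?thesis by (simp add: emeasure_space_1)
    qed
    have "(\<lambda>n. (L * (T * (1 / real (Suc n))))\<^sup>2 * T) \<longlonglongrightarrow> (L * (T * 0))\<^sup>2 * T"
      by (intro tendsto_intros LIMSEQ_Suc[OF lim_1_over_n])
    then have "(\<lambda>n. ennreal ((L * (T / real (Suc n)))\<^sup>2 * T)) \<longlonglongrightarrow> ennreal 0"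
      by (intro tendsto_ennrealI) simp
    then have lim: "(\<lambda>n. ennreal ((L * (T / real (Suc n)))\<^sup>2 * T)) \<longlonglongrightarrow> 0" by (simp only: ennreal_0)
    show ?thesis
      by (rule tendsto_sandwich[OF _ always_eventually[OF allI[OF ub]] tendsto_const lim]) simp
  qed
  have si: "(\<lambda>n. \<integral>\<^sup>+\<omega>. ennreal ((norm (simple_integral W (Suc n) (grid T T n) (\<xi> n) t \<omega> - Z t \<omega>))\<^sup>2) \<partial>M) \<longlonglongrightarrow> 0"
    if t: "t \<in> {0..T}" for t
  proof -
    have t': "0 \<le> t" "t \<le> T" using t by auto
    have grid_min: "min t (grid T T n j) = grid T t n j" for n j
      using t by (simp add: grid_def min_def)
    have SZ: "AE \<omega> in M. \<forall>n. simple_integral W (Suc n) (grid T T n) (\<xi> n) t \<omega> - Z t \<omega>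
        = integral {0..t} (\<lambda>s. V s \<omega> *\<^sub>R \<sigma>' s) - RS n t \<omega>"
      using V(4) AE_space
    proof eventually_elim
      case (elim \<omega>)
      show ?case
      proof
        fix n
        let ?q = "grid T t n"
        have "simple_integral W (Suc n) (grid T T n) (\<xi> n) t \<omega> = (\<Sum>i<Suc n. (V (?q (Suc i)) \<omega> - V (?q i) \<omega>) *\<^sub>R \<sigma> (?q i))"
          unfolding simple_integral_def grid_min \<xi>_def
        proof (rule sum.cong[OF refl])
          fix i
          show "(W (?q (Suc i)) \<omega> - W (?q i) \<omega>) *\<^sub>R \<sigma> (grid T T n i) = (V (?q (Suc i)) \<omega> - V (?q i) \<omega>) *\<^sub>R \<sigma> (?q i)"
          proof (cases "grid T T n i \<le> t")
            case True
            then have "?q i = grid T T n i" using grid_min[of n i] by simp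
            then show ?thesis using elim(1) by simp
          next
            \<comment> \<open>Beyond \<open>t\<close> both stopped points equal \<open>t\<close>:
              the values of \<sigma> may differ, but they are multiplied by a vanishing
              increment.\<close>
            case False
            then have "?q i = t" using grid_min[of n i] by simp
            moreover have "?q (Suc i) = t"
              using \<open>?q i = t\<close> grid_bounds(1,2)[OF T t, of n] by (metis atLeastAtMost_iff order_antisym)
            ultimately show ?thesis by simp
          qed
        qed
        also have "\<dots> = V (?q (Suc n)) \<omega> *\<^sub>R \<sigma> (?q (Suc n)) - V (?q 0) \<omega> *\<^sub>R \<sigma> (?q 0) - RS n t \<omega>"
          unfolding summation_by_parts[of "\<lambda>i. V (?q i) \<omega>" "\<lambda>i. \<sigma> (?q i)"] RS_def pr_def ..
        also have "\<dots> = V t \<omega> *\<^sub>R \<sigma> t - RS n t \<omega>"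
          unfolding grid_0[OF t'(1)] grid_end[OF t'(2)] V(3)[OF elim(2)] by simp
        finally show "simple_integral W (Suc n) (grid T T n) (\<xi> n) t \<omega> - Z t \<omega>
          = integral {0..t} (\<lambda>s. V s \<omega> *\<^sub>R \<sigma>' s) - RS n t \<omega>" by (simp add: Z_def)
      qed
    qed
    have S_meas: "simple_integral W (Suc n) (grid T T n) (\<xi> n) t \<in> borel_measurable M" for n
      using simple_integral_isometry(2)[OF sp t'(1) order_refl] by (simp add: sq_integrable_def)
    have "(\<lambda>n. \<integral>\<^sup>+\<omega>. ennreal ((norm (simple_integral W (Suc n) (grid T T n) (\<xi> n) t \<omega> - Z t \<omega>))\<^sup>2) \<partial>M) \<longlonglongrightarrow> (\<integral>\<^sup>+\<omega>. 0 \<partial>M)"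
    \<comment> \<open>The dominating function is the Riemann-Stieltjes estimate with the crude
      oscillation bound \<open>2 * sqrt (g \<omega>)\<close> on an interval of length at most
      \<open>T\<close>.\<close>
    proof (rule nn_integral_dominated_convergence[where w = "\<lambda>\<omega>. ennreal ((2 * K * T)\<^sup>2 * g \<omega>)"])
      show "(\<lambda>\<omega>. ennreal ((norm (simple_integral W (Suc n) (grid T T n) (\<xi> n) t \<omega> - Z t \<omega>))\<^sup>2)) \<in> borel_measurable M" for n
        using S_meas[of n] ZM[OF t] by measurable
      show "(\<lambda>\<omega>. ennreal ((2 * K * T)\<^sup>2 * g \<omega>)) \<in> borel_measurable M"
        using g(1) by measurable
      show "(\<integral>\<^sup>+\<omega>. ennreal ((2 * K * T)\<^sup>2 * g \<omega>) \<partial>M) < \<infinity>"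
      proof -
        have "AE \<omega> in M. 0 \<le> g \<omega>"
          using g(2) by eventually_elim (use T' in \<open>meson norm_ge_zero order_trans\<close>)
        then have "(\<integral>\<^sup>+\<omega>. ennreal ((2 * K * T)\<^sup>2 * g \<omega>) \<partial>M) = ennreal (LINT \<omega>|M. (2 * K * T)\<^sup>2 * g \<omega>)"
          using g(1) by (intro nn_integral_eq_integral) auto
        then show ?thesis by simp
      qed
      show "AE \<omega> in M. ennreal ((norm (simple_integral W (Suc n) (grid T T n) (\<xi> n) t \<omega> - Z t \<omega>))\<^sup>2) \<le> ennreal ((2 * K * T)\<^sup>2 * g \<omega>)" for n
        using SZ g(2) AE_space
      proof eventually_elim
        case (elim \<omega>)
        let ?q = "grid T t n"
        note gb = grid_bounds[OF T t, of n]
        have g0: "0 \<le> g \<omega>" using elim(2) T' by (meson norm_ge_zero order_trans)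
        have Vg: "\<bar>V s \<omega>\<bar> \<le> sqrt (g \<omega>)" if "s \<in> {0..T}" for s
          using elim(2) that by (intro real_le_rsqrt) auto
        have "norm (RS n t \<omega> - integral {?q 0..?q (Suc n)} (\<lambda>s. pr (\<sigma>' s) (V s \<omega>))) \<le> K * (2 * sqrt (g \<omega>)) * (?q (Suc n) - ?q 0)"
          unfolding RS_def
        proof (rule Riemann_Stieltjes_estimate[OF pr \<sigma> \<sigma>'])
          show "continuous_on {?q 0..?q (Suc n)} (\<lambda>s. V s \<omega>)"
            unfolding grid_0[OF t'(1)] grid_end[OF t'(2)] using t' by (intro continuous_on_subset[OF VT[OF elim(3)]]) auto
          show "norm (pr (\<sigma>' s) y) \<le> K * norm y" if "s \<in> {?q 0..?q (Suc n)}" for s y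
            using that t' unfolding grid_0[OF t'(1)] grid_end[OF t'(2)] by (intro K(2)) auto
          fix j s assume s: "s \<in> {?q j..?q (Suc j)}"
          have "\<bar>V (?q (Suc j)) \<omega>\<bar> \<le> sqrt (g \<omega>)" "\<bar>V s \<omega>\<bar> \<le> sqrt (g \<omega>)"
            using gb(1)[of j] gb(1)[of "Suc j"] s t' by (auto intro!: Vg)
          then show "norm (V (?q (Suc j)) \<omega> - V s \<omega>) \<le> 2 * sqrt (g \<omega>)" by simp
        qed (use gb K in auto)
        then have "norm (simple_integral W (Suc n) (grid T T n) (\<xi> n) t \<omega> - Z t \<omega>) \<le> K * (2 * sqrt (g \<omega>)) * t"
          unfolding grid_0[OF t'(1)] grid_end[OF t'(2)] elim(1)[rule_format] pr_def
          by (subst norm_minus_commute) simp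
        also have "\<dots> \<le> K * (2 * sqrt (g \<omega>)) * T" using t' K g0 by (intro mult_left_mono) auto
        also have "\<dots> = 2 * K * T * sqrt (g \<omega>)" by simp
        finally have "(norm (simple_integral W (Suc n) (grid T T n) (\<xi> n) t \<omega> - Z t \<omega>))\<^sup>2 \<le> (2 * K * T * sqrt (g \<omega>))\<^sup>2"
          by (intro power_mono) auto
        also have "\<dots> = (2 * K * T)\<^sup>2 * g \<omega>" using g0 by (simp add: power_mult_distrib)
        finally show ?case by (rule ennreal_leI)
      qed
      show "AE \<omega> in M. (\<lambda>n. ennreal ((norm (simple_integral W (Suc n) (grid T T n) (\<xi> n) t \<omega> - Z t \<omega>))\<^sup>2)) \<longlonglongrightarrow> 0"
        using SZ AE_space
      proof eventually_elim
        case (elim \<omega>)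
        have "(\<lambda>n. ennreal ((norm (integral {0..t} (\<lambda>s. V s \<omega> *\<^sub>R \<sigma>' s) - RS n t \<omega>))\<^sup>2))
          \<longlonglongrightarrow> ennreal ((norm (integral {0..t} (\<lambda>s. V s \<omega> *\<^sub>R \<sigma>' s) - integral {0..t} (\<lambda>s. V s \<omega> *\<^sub>R \<sigma>' s)))\<^sup>2)"
          by (intro tendsto_ennrealI tendsto_intros RS_lim elim t)
        then show ?case unfolding elim(1)[rule_format] by simp
      qed
    qed simp_all
    then show ?thesis by simp
  qed
  show "ito_integral M Filt W T (\<lambda>s \<omega>. \<sigma> s) Z"
    unfolding ito_integral_def
  proof (intro conjI ballI exI allI)
    show "(\<lambda>s \<omega>::'a. \<sigma> s) \<in> L2_prog M Filt T"
      by (intro L2_prog_continuous continuous_on_subset[OF \<sigma>cont]) simp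
    show "AE \<omega> in M. continuous_on {0..T} (\<lambda>t. Z t \<omega>)" by (intro AE_I2 Zcont)
  qed (fact ZF sp sv si)+
qed

end

section \<open>Attaining a prescribed covariance\<close>

lemma integral_cos_period:
  fixes k :: int
  assumes T: "0 < T" and k: "k \<noteq> 0"
  shows "((\<lambda>s. cos (of_int k * pi * s / T)) has_integral 0) {0..T}"
proof -
  define a where "a = of_int k * pi / T"
  have a: "a \<noteq> 0" using T k by (simp add: a_def)
  have "((\<lambda>s. cos (a * s)) has_integral (sin (a * T) / a - sin (a * 0) / a)) {0..T}"
  proof (rule fundamental_theorem_of_calculus)
    fix s
    have "((\<lambda>s. sin (a * s) / a) has_real_derivative cos (a * s)) (at s within {0..T})"
      using a by (auto intro!: derivative_eq_intros)
    then show "((\<lambda>s. sin (a * s) / a) has_vector_derivative cos (a * s)) (at s within {0..T})"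
      by (simp add: has_real_derivative_iff_has_vector_derivative)
  qed (use T in simp)
  moreover have "sin (a * T) = 0" using T by (simp add: a_def sin_zero_iff_int2)
  moreover have "(\<lambda>s. cos (of_int k * pi * s / T)) = (\<lambda>s. cos (a * s))" by (simp add: a_def)
  ultimately show ?thesis by simp
qed

text \<open>Product formula for cosines, with vanishing integrals over whole numbers of half
  periods. Since the frequencies start at 1, the sum frequency \<open>i + j + 2\<close> is never
  zero.\<close>

lemma cosine_orthonormal:
  fixes i j :: nat
  assumes T: "0 < T"
  shows "((\<lambda>s. (sqrt (2 / T) * cos (real (Suc i) * pi * s / T)) * (sqrt (2 / T) * cos (real (Suc j) * pi * s / T)))
    has_integral (if i = j then 1 else 0)) {0..T}"
proof -
  let ?c = "\<lambda>k::int. \<lambda>s. cos (of_int k * pi * s / T)"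
  have c: "(?c k has_integral (if k = 0 then T else 0)) {0..T}" for k
  proof (cases "k = 0")
    case True
    have "((\<lambda>s::real. 1::real) has_integral T) {0..T}"
      using has_integral_const_real[of "1::real" 0 T] T by simp
    with True show ?thesis by simp
  next
    case False
    with integral_cos_period[OF T False] show ?thesis by simp
  qed
  have sq: "sqrt (2 / T) * sqrt (2 / T) = 2 / T" using T by simp
  have "(sqrt (2 / T) * cos (real (Suc i) * pi * s / T)) * (sqrt (2 / T) * cos (real (Suc j) * pi * s / T))
    = (?c (int i - int j) s + ?c (int i + int j + 2) s) * (1 / T)" for s
  proof -
    have "cos x * cos y = (cos (x - y) + cos (x + y)) / 2" for x y :: real by (rule cos_times_cos)
    moreover have "real (Suc i) * pi * s / T - real (Suc j) * pi * s / T = of_int (int i - int j) * pi * s / T"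
      "real (Suc i) * pi * s / T + real (Suc j) * pi * s / T = of_int (int i + int j + 2) * pi * s / T"
      by (simp_all add: diff_divide_distrib [symmetric] add_divide_distrib [symmetric] algebra_simps)
    ultimately have cc: "cos (real (Suc i) * pi * s / T) * cos (real (Suc j) * pi * s / T)
        = (?c (int i - int j) s + ?c (int i + int j + 2) s) / 2" by simp
    have rr: "(r * x) * (r * y) = (r * r) * (x * y)" for r x y :: real by simp
    have "2 / T * (z / 2) = z * (1 / T)" for z by simp
    then show ?thesis unfolding rr sq cc .
  qed
  moreover have "((\<lambda>s. (?c (int i - int j) s + ?c (int i + int j + 2) s) * (1 / T)) has_integral
      ((if int i - int j = 0 then T else 0) + (if int i + int j + 2 = 0 then T else 0)) * (1 / T)) {0..T}"
    by (intro has_integral_mult_left has_integral_add c)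
  ultimately show ?thesis using T by (simp only:) (auto split: if_splits)
qed

context brownian
begin

section \<open>Reachable laws versus Gaussian laws\<close>

lemma gauss_law_distr:
  fixes Y :: "'a \<Rightarrow> real^'d" and q :: "real^'d \<Rightarrow> real"
  assumes Y: "Y \<in> borel_measurable M"
    and char: "\<And>w. (CLINT \<omega>|M. iexp (w \<bullet> Y \<omega>)) = iexp (w \<bullet> \<alpha>) * exp (- q w / 2)"
    and q: "\<And>w. q w = w \<bullet> (S *v w)"
  shows "normal_law \<alpha> S (distr M borel Y)"
  unfolding normal_law_def
proof (intro conjI allI)
  note [measurable] = Y
  show "prob_space (distr M borel Y)" by (rule prob_space_distr) (rule Y)
  fix v
  have "(CLINT y|distr M borel Y. iexp (v \<bullet> y)) = (CLINT \<omega>|M. iexp (v \<bullet> Y \<omega>))"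
    by (rule integral_distr) measurable
  also have "\<dots> = exp (\<i> * complex_of_real (v \<bullet> \<alpha>) - complex_of_real (v \<bullet> (S *v v) / 2))"
    unfolding char q by (simp only: exp_of_real [symmetric] exp_add [symmetric]) simp
  finally show "(CLINT y|distr M borel Y. iexp (v \<bullet> y))
    = exp (\<i> * complex_of_real (v \<bullet> \<alpha>) - complex_of_real (v \<bullet> (S *v v) / 2))" .
qed simp

lemma reach_laws_gauss:
  fixes A1 A2 C :: "real^'d^'d" and B2 D2 :: "real^'n^'d"
  assumes T: "0 < T" and \<mu>: "\<mu> \<in> reach_laws M Filt W T A1 A2 B2 C D2 x"
  shows "\<mu> \<in> gauss_laws"
proof -
  obtain u X where u: "u \<in> L2_prog M Filt T" and sol: "mf_solution M Filt W T A1 A2 B2 C D2 x u X"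
    and \<mu>_eq: "\<mu> = distr M borel (X T)"
    using \<mu> unfolding reach_laws_def by blast
  define \<phi> where "\<phi> s = C *v expectation (X s) + D2 *v expectation (u s)" for s
  note sc = solution_char[OF T u sol, folded \<phi>_def]
  obtain \<alpha> where \<alpha>: "\<And>w. (CLINT \<omega>|M. iexp (w \<bullet> X T \<omega>))
      = iexp (w \<bullet> \<alpha>) * exp (- (LBINT s. (indicat_real {0<..T} s * (w \<bullet> (mexp A1 (T - s) *v \<phi> s)))\<^sup>2) / 2)"
    using sc(3) by blast
  define \<phi>0 where "\<phi>0 s = indicat_real {0..T} s *\<^sub>R \<phi> s" for s
  have \<phi>0: "sq_integrable lborel \<phi>0"
    unfolding \<phi>0_def [abs_def] by (rule sq_integrable_deterministic[OF sc(1) less_imp_le[OF T]])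
  then have [measurable]: "\<phi>0 \<in> borel_measurable borel" by (simp add: sq_integrable_def)
  define y where "y s = indicat_real {0<..T} s *\<^sub>R (mexp A1 (T - s) *v \<phi>0 s)" for s
  have mcont: "continuous_on UNIV (\<lambda>s. mexp A1 (T - s))" by (intro continuous_intros)
  obtain K where K: "0 < K" "\<And>s v. s \<in> {0..T} \<Longrightarrow> norm (mexp A1 (T - s) *v v) \<le> K * norm v"
    by (rule Riemann_Stieltjes_bound[OF bounded_bilinear_matrix_vector_mult mcont, of T]) blast
  have mm: "(\<lambda>s. mexp A1 (T - s) *v \<phi>0 s) \<in> borel_measurable borel"
    by (rule borel_measurable_continuous_Pair[OF borel_measurable_continuous_onI[OF mcont]])
       (auto intro!: continuous_on_matrix_vector_mult continuous_intros)
  have y: "sq_integrable lborel y"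
    unfolding sq_integrable_def
  proof
    show ym: "y \<in> borel_measurable lborel"
      unfolding y_def by (intro borel_measurable_scaleR borel_measurable_indicator) (use mm in simp_all)
    show "integrable lborel (\<lambda>s. (norm (y s))\<^sup>2)"
    proof (rule Bochner_Integration.integrable_bound)
      show "integrable lborel (\<lambda>s. K\<^sup>2 * (norm (\<phi>0 s))\<^sup>2)" using \<phi>0 by (simp add: sq_integrable_def)
      have "(norm (y s))\<^sup>2 \<le> K\<^sup>2 * (norm (\<phi>0 s))\<^sup>2" for s
      proof (cases "s \<in> {0<..T}")
        case True
        then have "norm (y s) \<le> K * norm (\<phi>0 s)" unfolding y_def by (simp add: K)
        from power_mono[OF this norm_ge_zero, of 2] show ?thesis by (simp add: power_mult_distrib)
      qed (simp add: y_def)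
      then show "AE s in lborel. norm ((norm (y s))\<^sup>2) \<le> norm (K\<^sup>2 * (norm (\<phi>0 s))\<^sup>2)" by simp
    qed (use ym in measurable)
  qed
  \<comment> \<open>The Gram matrix of the components of \<open>y\<close> in L2; its quadratic form
    is the variance in the characteristic function.\<close>
  define S where "S = (\<chi> i j. LBINT s. y s $ i * y s $ j)"
  have int: "integrable lborel (\<lambda>s. y s $ i * y s $ j)" for i j
    using sq_integrable_inner[OF sq_integrable_inner_const[OF y, of "axis i 1"] sq_integrable_inner_const[OF y, of "axis j 1"]]
    by (simp add: inner_axis')
  have q: "(LBINT s. (indicat_real {0<..T} s * (w \<bullet> (mexp A1 (T - s) *v \<phi> s)))\<^sup>2) = w \<bullet> (S *v w)" for w
  proof -
    have "indicat_real {0<..T} s * (w \<bullet> (mexp A1 (T - s) *v \<phi> s)) = w \<bullet> y s" for s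
      by (auto simp: y_def \<phi>0_def split: split_indicator)
    then have "(LBINT s. (indicat_real {0<..T} s * (w \<bullet> (mexp A1 (T - s) *v \<phi> s)))\<^sup>2)
      = (LBINT s. \<Sum>i\<in>UNIV. \<Sum>j\<in>UNIV. (w $ i * w $ j) * (y s $ i * y s $ j))"
      by (simp add: inner_vec_def power2_eq_square sum_product mult_ac)
    also have "\<dots> = (\<Sum>i\<in>UNIV. \<Sum>j\<in>UNIV. (w $ i * w $ j) * (LBINT s. y s $ i * y s $ j))"
      using int by (simp add: Bochner_Integration.integral_sum)
    also have "\<dots> = w \<bullet> (S *v w)"
      by (simp add: inner_vec_def matrix_vector_mult_def S_def sum_distrib_left mult_ac)
    finally show ?thesis .
  qed
  have "transpose S = S"
    by (simp add: S_def transpose_def vec_eq_iff mult.commute)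
  moreover have "0 \<le> v \<bullet> (S *v v)" for v
    unfolding q [symmetric] by (rule Bochner_Integration.integral_nonneg) simp
  ultimately have "pos_semidef S" by (simp add: pos_semidef_def)
  moreover have "normal_law \<alpha> S \<mu>"
    unfolding \<mu>_eq by (rule gauss_law_distr[OF sc(2) \<alpha> q])
  ultimately show ?thesis unfolding gauss_laws_def by blast
qed

lemma gauss_law_reachable:
  fixes A1 A2 C :: "real^'d^'d" and B2 D2 :: "real^'n^'d"
  assumes T: "0 < T" and rk: "rank D2 = CARD('d)" and \<mu>: "\<mu> \<in> gauss_laws"
  shows "\<exists>x. \<mu> \<in> reach_laws M Filt W T A1 A2 B2 C D2 x"
proof -
  obtain \<alpha> S where S: "pos_semidef S" and law: "normal_law \<alpha> S \<mu>"
    using \<mu> unfolding gauss_laws_def by blast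
  obtain n :: nat and \<tau> where \<tau>: "\<forall>v. v \<bullet> (S *v v) = (\<Sum>i<n. (v \<bullet> \<tau> i)\<^sup>2)"
    using pos_semidef_decompose[OF S] by (elim exE)
  have "surj ((*v) D2)" using rk by (simp add: full_rank_surjective)
  \<comment> \<open>The right inverse of \<open>D2\<close> is what allows the control to realise any
    prescribed diffusion coefficient.\<close>
  then obtain R where R: "D2 ** R = mat 1" using matrix_right_invertible_surjective by blast
  define e where "e i s = sqrt (2 / T) * cos (real (Suc i) * pi * s / T)" for i :: nat and s
  define e' where "e' i s = - (sqrt (2 / T) * (real (Suc i) * pi / T) * sin (real (Suc i) * pi * s / T))" for i :: nat and s
  define \<sigma> where "\<sigma> s = (\<Sum>i<n. e i s *\<^sub>R \<tau> i)" for s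
  define \<sigma>' where "\<sigma>' s = (\<Sum>i<n. e' i s *\<^sub>R \<tau> i)" for s
  have e: "(e i has_real_derivative e' i s) (at s)" for i s
    unfolding e_def e'_def using T by (auto intro!: derivative_eq_intros)
  have \<sigma>: "(\<sigma> has_vector_derivative \<sigma>' s) (at s)" for s
    unfolding \<sigma>_def \<sigma>'_def
    by (intro has_vector_derivative_sum) (use has_vector_derivative_scaleR[OF e has_vector_derivative_const] in simp)
  have \<sigma>': "continuous_on UNIV \<sigma>'" unfolding \<sigma>'_def e'_def by (intro continuous_intros) (use T in auto)
  have \<sigma>cont: "continuous_on UNIV \<sigma>" unfolding \<sigma>_def e_def by (intro continuous_intros) (use T in auto)
  define E where "E s = mexp A1 (s - T)" for s
  have E: "(E has_vector_derivative A1 ** E s) (at s)" for s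
  proof -
    have "((\<lambda>s. s - T) has_vector_derivative 1) (at s)" by (auto intro!: derivative_eq_intros)
    from vector_diff_chain_at[OF this has_vector_derivative_mexp]
    show ?thesis unfolding E_def by (simp add: o_def)
  qed
  have Econt: "continuous_on UNIV E" unfolding E_def by (intro continuous_intros)
  note mv = bounded_bilinear_matrix_vector_mult
  define \<phi> where "\<phi> s = E s *v \<sigma> s" for s
  define \<phi>' where "\<phi>' s = E s *v \<sigma>' s + (A1 ** E s) *v \<sigma> s" for s
  have \<phi>: "(\<phi> has_vector_derivative \<phi>' s) (at s)" for s
    unfolding \<phi>_def \<phi>'_def by (rule bounded_bilinear.has_vector_derivative[OF mv E \<sigma>])
  have \<phi>': "continuous_on UNIV \<phi>'"
    unfolding \<phi>'_def
    by (intro continuous_on_add continuous_on_matrix_vector_mult Econt \<sigma>cont \<sigma>' continuous_on_const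
        bounded_bilinear.continuous_on[OF bounded_bilinear_matrix_matrix_mult])
  have \<phi>cont: "continuous_on UNIV \<phi>"
    unfolding \<phi>_def by (intro continuous_on_matrix_vector_mult Econt \<sigma>cont)
  obtain V where V: "\<And>t. 0 \<le> t \<Longrightarrow> V t \<in> borel_measurable (Filt t)"
      "\<And>\<omega>. \<omega> \<in> space M \<Longrightarrow> continuous_on {0..} (\<lambda>t. V t \<omega>)"
      "\<And>\<omega>. \<omega> \<in> space M \<Longrightarrow> V 0 \<omega> = 0" "AE \<omega> in M. \<forall>t. V t \<omega> = W t \<omega>"
    using continuous_version by blast
  define P where "P t \<omega> = integral {0..t} (\<lambda>s. V s \<omega> *\<^sub>R \<sigma>' s)" for t \<omega>
  define Q where "Q t \<omega> = integral {0..t} (\<lambda>s. V s \<omega> *\<^sub>R \<phi>' s)" for t \<omega>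
  \<comment> \<open>\<open>Z\<close> and \<open>I\<close> are the stochastic integrals of \<sigma>
    and \<phi> in pathwise form; \<open>P\<close> and \<open>Q\<close> are kept apart because they
    are differentiable in time.\<close>
  define Z where "Z t \<omega> = V t \<omega> *\<^sub>R \<sigma> t - P t \<omega>" for t \<omega>
  define I where "I t \<omega> = V t \<omega> *\<^sub>R \<phi> t - Q t \<omega>" for t \<omega>
  have Z: "ito_integral M Filt W T (\<lambda>s \<omega>. \<sigma> s) Z"
    "\<And>\<omega>. \<omega> \<in> space M \<Longrightarrow> continuous_on {0..T} (\<lambda>t. Z t \<omega>)"
    "(\<integral>\<^sup>+\<omega>. (SUP t\<in>{0..T}. ennreal ((norm (Z t \<omega>))\<^sup>2)) \<partial>M) < \<infinity>"
    unfolding Z_def [abs_def] P_def by (rule ito_integral_by_parts[OF T \<sigma> \<sigma>' V]; assumption)+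
  have I: "ito_integral M Filt W T (\<lambda>s \<omega>. \<phi> s) I"
    unfolding I_def [abs_def] Q_def by (rule ito_integral_by_parts[OF T \<phi> \<phi>' V])
  \<comment> \<open>Closed-loop matrix: inserting the control
    \<open>R *v (\<phi> s - C *v m s)\<close> into the mean equation leaves a linear equation with
    matrix \<open>K\<close> and forcing \<open>f\<close>.\<close>
  define K where "K = A1 + A2 - B2 ** R ** C"
  define f where "f s = (B2 ** R) *v \<phi> s" for s
  have fcont: "continuous_on UNIV f" unfolding f_def by (intro continuous_intros \<phi>cont)
  have kf: "continuous_on {0..T} (\<lambda>s. mexp K (- s) *v f s)"
    by (intro continuous_intros continuous_on_subset[OF fcont]) auto
  define F where "F t = integral {0..t} (\<lambda>s. mexp K (- s) *v f s)" for t
  \<comment> \<open>Chosen so that the mean ends at \<alpha>; the resulting \<open>m 0\<close>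
    becomes the initial point.\<close>
  define c where "c = mexp K (- T) *v \<alpha> - F T"
  define m where "m t = mexp K t *v (c + F t)" for t
  have mT: "m T = \<alpha>"
    unfolding m_def c_def by (simp add: matrix_vector_mul_assoc mexp_inverse)
  have m_der: "(m has_vector_derivative K *v m t + f t) (at t within {0..T})" if t: "t \<in> {0..T}" for t
  proof -
    have "((\<lambda>t. c + F t) has_vector_derivative mexp K (- t) *v f t) (at t within {0..T})"
      unfolding F_def using integral_has_vector_derivative[OF kf t] by (auto intro!: derivative_eq_intros)
    from bounded_bilinear.has_vector_derivative[OF mv has_vector_derivative_mexp[of K] this]
    show ?thesis unfolding m_def by (simp add: matrix_vector_mul_assoc mexp_inverse add.commute)
  qed
  have mcont: "continuous_on {0..T} m"
    using m_der by (intro continuous_on_vector_derivative) auto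
  define v where "v s = R *v (\<phi> s - C *v m s)" for s
  have vcont: "continuous_on {0..T} v"
    unfolding v_def by (intro continuous_intros mcont continuous_on_subset[OF \<phi>cont]) auto
  have m_eq: "K *v m s + f s = A1 *v m s + A2 *v m s + B2 *v v s" for s
    unfolding K_def f_def v_def
    by (simp add: bounded_bilinear.diff_left[OF mv] bounded_bilinear.add_left[OF mv]
        bounded_bilinear.diff_right[OF mv] matrix_vector_mul_assoc matrix_mul_assoc)
  define u where "u = (\<lambda>s (\<omega>::'a). v s)"
  \<comment> \<open>\<open>E\<close> solves the homogeneous equation and
    \<open>E s *v \<sigma> s\<close> is \<open>\<phi> s\<close>, so the noise part of the solution
    is \<open>E\<close> applied to the integral of \<sigma>; its mean is zero.\<close>
  define X where "X t \<omega> = m t + E t *v Z t \<omega>" for t \<omega>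
  have uL2: "u \<in> L2_prog M Filt T" unfolding u_def by (rule L2_prog_continuous[OF vcont])
  have Eu: "expectation (u s) = v s" for s by (simp add: u_def prob_space)
  have Zsq: "sq_integrable M (Z t)" "expectation (Z t) = 0" if "t \<in> {0..T}" for t
    using ito_integral_sq_integrable[OF Z(1) that] ito_integral_deterministic_mean[OF Z(1) _ that] T by auto
  have EX: "expectation (X t) = m t" if t: "t \<in> {0..T}" for t
  proof -
    have i: "integrable M (Z t)" by (rule sq_integrable_integrable[OF Zsq(1)[OF t]])
    have "integrable M (\<lambda>\<omega>. E t *v Z t \<omega>)"
      by (rule integrable_bounded_linear[OF matrix_vector_mul_bounded_linear i])
    moreover have "expectation (\<lambda>\<omega>. E t *v Z t \<omega>) = E t *v expectation (Z t)"
      by (rule integral_bounded_linear[OF matrix_vector_mul_bounded_linear i])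
    ultimately show ?thesis unfolding X_def by (simp add: prob_space Zsq(2)[OF t])
  qed
  have sol: "mf_solution M Filt W T A1 A2 B2 C D2 (m 0) u X"
    unfolding mf_solution_def
  proof (intro conjI ballI exI)
    fix t assume t: "t \<in> {0..T}"
    have "Z t \<in> borel_measurable (Filt t)" using Z(1) t by (simp add: ito_integral_def)
    then have "(\<lambda>\<omega>. E t *v Z t \<omega>) \<in> borel_measurable (Filt t)"
      by (rule measurable_compose[OF _ borel_measurable_continuous_onI[OF continuous_on_matrix_vector_mult[OF continuous_on_const continuous_on_id]]])
    then show "X t \<in> borel_measurable (Filt t)"
      unfolding X_def by (intro borel_measurable_add borel_measurable_const)
  next
    show "AE \<omega> in M. continuous_on {0..T} (\<lambda>t. X t \<omega>)"
      unfolding X_def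
      by (intro AE_I2 continuous_on_add mcont continuous_on_matrix_vector_mult Z(2) continuous_on_subset[OF Econt]) auto
  next
    have bm: "bounded (m ` {0..T})" by (intro compact_imp_bounded compact_continuous_image mcont) simp
    then obtain B where B: "\<And>s. s \<in> {0..T} \<Longrightarrow> norm (m s) \<le> B"
      unfolding bounded_iff by (auto simp only: ball_simps)
    obtain L where L: "0 < L" "\<And>s v. s \<in> {0..T} \<Longrightarrow> norm (E s *v v) \<le> L * norm v"
      by (rule Riemann_Stieltjes_bound[OF mv Econt, of T]) blast
    have "ennreal ((norm (X t \<omega>))\<^sup>2) \<le> ennreal (2 * B\<^sup>2) + ennreal (2 * L\<^sup>2) * (SUP t\<in>{0..T}. ennreal ((norm (Z t \<omega>))\<^sup>2))"
      if t: "t \<in> {0..T}" for t \<omega>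
    proof -
      have "(norm (m t))\<^sup>2 \<le> B\<^sup>2" by (rule power_mono[OF B[OF t] norm_ge_zero])
      moreover have "(norm (E t *v Z t \<omega>))\<^sup>2 \<le> L\<^sup>2 * (norm (Z t \<omega>))\<^sup>2"
        using power_mono[OF L(2)[OF t] norm_ge_zero] by (simp only: power_mult_distrib)
      ultimately have "(norm (X t \<omega>))\<^sup>2 \<le> 2 * B\<^sup>2 + (2 * L\<^sup>2) * (norm (Z t \<omega>))\<^sup>2"
        using norm_add_square_le[of "m t" "E t *v Z t \<omega>"] unfolding X_def by simp
      moreover have "ennreal a \<le> ennreal b + ennreal c * ennreal d"
        if "a \<le> b + c * d" "0 \<le> b" "0 \<le> c" "0 \<le> d" for a b c d
        using ennreal_leI[OF that(1)] that by (simp add: ennreal_plus ennreal_mult)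
      ultimately have "ennreal ((norm (X t \<omega>))\<^sup>2) \<le> ennreal (2 * B\<^sup>2) + ennreal (2 * L\<^sup>2) * ennreal ((norm (Z t \<omega>))\<^sup>2)"
        by simp
      also have "\<dots> \<le> ennreal (2 * B\<^sup>2) + ennreal (2 * L\<^sup>2) * (SUP t\<in>{0..T}. ennreal ((norm (Z t \<omega>))\<^sup>2))"
        by (rule add_left_mono, rule mult_left_mono, rule SUP_upper[OF t], simp)
      finally show ?thesis .
    qed
    then show "(\<integral>\<^sup>+\<omega>. (SUP t\<in>{0..T}. ennreal ((norm (X t \<omega>))\<^sup>2)) \<partial>M) < \<infinity>"
      by (intro nn_integral_Sup_bound[OF T ito_integral_measurable[OF Z(1)] Z(2,3)] SUP_least)
  next
    have "\<phi> s = C *v expectation (X s) + D2 *v expectation (u s)" if "s \<in> {0..T}" for s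
      unfolding Eu EX[OF that] v_def by (simp add: matrix_vector_mul_assoc R)
    from ito_integral_cong[OF this I]
    show "ito_integral M Filt W T (\<lambda>s \<omega>. C *v expectation (X s) + D2 *v expectation (u s)) I" .
  next
    show "AE \<omega> in M. \<forall>t\<in>{0..T}. X t \<omega> = m 0 +
      (LBINT s:{0..t}. A1 *v X s \<omega> + A2 *v expectation (X s) + B2 *v expectation (u s)) + I t \<omega>"
    proof (intro AE_I2 ballI)
      fix \<omega> t assume \<omega>: "\<omega> \<in> space M" and t: "t \<in> {0..T}"
      have VT: "continuous_on {0..T} (\<lambda>t. V t \<omega>)" by (rule continuous_on_subset[OF V(2)[OF \<omega>]]) auto
      define g where "g s = A1 *v X s \<omega> + A2 *v m s + B2 *v v s" for s
      have gcont: "continuous_on {0..T} g"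
        unfolding g_def X_def
        by (intro continuous_on_add continuous_on_matrix_vector_mult continuous_on_const mcont vcont Z(2)[OF \<omega>]
            continuous_on_subset[OF Econt]) auto
      have P: "((\<lambda>t. P t \<omega>) has_vector_derivative V s \<omega> *\<^sub>R \<sigma>' s) (at s within {0..T})" if "s \<in> {0..T}" for s
        unfolding P_def
        by (rule integral_has_vector_derivative[OF _ that], intro continuous_on_scaleR VT continuous_on_subset[OF \<sigma>']) simp
      have Q: "((\<lambda>t. Q t \<omega>) has_vector_derivative V s \<omega> *\<^sub>R \<phi>' s) (at s within {0..T})" if "s \<in> {0..T}" for s
        unfolding Q_def
        by (rule integral_has_vector_derivative[OF _ that], intro continuous_on_scaleR VT continuous_on_subset[OF \<phi>']) simp
      \<comment> \<open>This is \<open>X - I\<close>: the terms with \<open>V\<close> cancel because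
        \<open>E s *v \<sigma> s\<close> is \<open>\<phi> s\<close>. What is left is differentiable,
        and the integral equation becomes the fundamental theorem of calculus on each path.\<close>
      define h where "h s = m s - E s *v P s \<omega> + Q s \<omega>" for s
      have h: "(h has_vector_derivative g s) (at s within {0..T})" if s: "s \<in> {0..T}" for s
      proof -
        have "(h has_vector_derivative (K *v m s + f s) - (E s *v (V s \<omega> *\<^sub>R \<sigma>' s) + (A1 ** E s) *v P s \<omega>) + V s \<omega> *\<^sub>R \<phi>' s) (at s within {0..T})"
          unfolding h_def
          by (intro has_vector_derivative_add has_vector_derivative_diff m_der P Q s
              bounded_bilinear.has_vector_derivative[OF mv] has_vector_derivative_at_within[OF E])
        \<comment> \<open>By the product rule for \<phi>, the terms with \<open>\<sigma>'\<close>
          cancel and the rest combines with \<open>P\<close> into \<open>A1\<close> applied to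
          \<open>E s *v Z s \<omega>\<close>.\<close>
        moreover have "(K *v m s + f s) - (E s *v (V s \<omega> *\<^sub>R \<sigma>' s) + (A1 ** E s) *v P s \<omega>) + V s \<omega> *\<^sub>R \<phi>' s = g s"
          unfolding m_eq g_def X_def Z_def \<phi>'_def
          by (simp add: matrix_vector_right_distrib bounded_bilinear.diff_right[OF mv]
              bounded_bilinear.scaleR_right[OF mv] matrix_vector_mul_assoc scaleR_add_right)
        ultimately show ?thesis by simp
      qed
      have "(g has_integral h t - h 0) {0..t}"
      proof (rule fundamental_theorem_of_calculus)
        show "(h has_vector_derivative g s) (at s within {0..t})" if "s \<in> {0..t}" for s
          using that t by (intro has_vector_derivative_within_subset[OF h]) auto
      qed (use t in simp)
      moreover have "set_integrable lborel {0..t} g"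
        using t by (intro borel_integrable_atLeastAtMost' continuous_on_subset[OF gcont]) auto
      ultimately have "(LBINT s:{0..t}. g s) = h t - h 0"
        by (simp add: set_borel_integral_eq_integral integral_unique)
      moreover have "h 0 = m 0" by (simp add: h_def P_def Q_def)
      moreover have "(LBINT s:{0..t}. A1 *v X s \<omega> + A2 *v expectation (X s) + B2 *v expectation (u s)) = (LBINT s:{0..t}. g s)"
        using t by (intro set_lebesgue_integral_cong) (auto simp: g_def Eu EX)
      moreover have "X t \<omega> = h t + I t \<omega>"
        unfolding X_def Z_def h_def I_def \<phi>_def
        by (simp add: bounded_bilinear.diff_right[OF mv] bounded_bilinear.scaleR_right[OF mv])
      ultimately show "X t \<omega> = m 0 +
        (LBINT s:{0..t}. A1 *v X s \<omega> + A2 *v expectation (X s) + B2 *v expectation (u s)) + I t \<omega>" by simp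
    qed
  qed
  have TT: "T \<in> {0..T}" "0 \<le> T" using T by auto
  have ZT: "Z T \<in> borel_measurable M" by (rule ito_integral_measurable[OF Z(1) TT(1)])
  have XT: "X T = (\<lambda>\<omega>. \<alpha> + Z T \<omega>)" by (simp add: X_def mT E_def fun_eq_iff)
  have cov: "(LBINT s. (indicat_real {0<..T} s * (w \<bullet> \<sigma> s))\<^sup>2) = w \<bullet> (S *v w)" for w
  proof -
    have sq: "(w \<bullet> \<sigma> s)\<^sup>2 = (\<Sum>i<n. \<Sum>j<n. ((w \<bullet> \<tau> i) * (w \<bullet> \<tau> j)) * (e i s * e j s))" for s
      unfolding \<sigma>_def inner_sum_right power2_eq_square sum_product by (simp add: mult_ac)
    \<comment> \<open>Orthonormality of the cosines removes the mixed terms, leaving the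
      decomposition of \<open>S\<close>.\<close>
    have "((\<lambda>s. (w \<bullet> \<sigma> s)\<^sup>2) has_integral (\<Sum>i<n. \<Sum>j<n. ((w \<bullet> \<tau> i) * (w \<bullet> \<tau> j)) * (if i = j then 1 else 0))) {0..T}"
      unfolding sq e_def by (intro has_integral_sum has_integral_mult_right cosine_orthonormal T) auto
    moreover have "(\<Sum>i<n. \<Sum>j<n. ((w \<bullet> \<tau> i) * (w \<bullet> \<tau> j)) * (if i = j then 1 else 0)) = w \<bullet> (S *v w)"
    proof -
      have "(\<Sum>i<n. \<Sum>j<n. ((w \<bullet> \<tau> i) * (w \<bullet> \<tau> j)) * (if i = j then 1 else 0))
          = (\<Sum>i<n. \<Sum>j<n. if i = j then (w \<bullet> \<tau> i) * (w \<bullet> \<tau> j) else 0)"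
        by (intro sum.cong refl) simp
      also have "\<dots> = (\<Sum>i<n. (w \<bullet> \<tau> i)\<^sup>2)"
        by (intro sum.cong refl) (simp add: power2_eq_square)
      finally show ?thesis using \<tau> by simp
    qed
    moreover have "set_integrable lborel {0..T} (\<lambda>s. (w \<bullet> \<sigma> s)\<^sup>2)"
      by (intro borel_integrable_atLeastAtMost' continuous_intros continuous_on_subset[OF \<sigma>cont]) auto
    ultimately have "(LBINT s:{0..T}. (w \<bullet> \<sigma> s)\<^sup>2) = w \<bullet> (S *v w)"
      by (simp add: set_borel_integral_eq_integral integral_unique)
    moreover have "(LBINT s. (indicat_real {0<..T} s * (w \<bullet> \<sigma> s))\<^sup>2) = (LBINT s:{0..T}. (w \<bullet> \<sigma> s)\<^sup>2)"
      unfolding set_lebesgue_integral_def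
    proof (rule integral_cong_AE)
      have [measurable]: "\<sigma> \<in> borel_measurable borel" by (rule borel_measurable_continuous_onI[OF \<sigma>cont])
      show "(\<lambda>s. (indicat_real {0<..T} s * (w \<bullet> \<sigma> s))\<^sup>2) \<in> borel_measurable lborel" by measurable
      show "(\<lambda>s. indicat_real {0..T} s *\<^sub>R (w \<bullet> \<sigma> s)\<^sup>2) \<in> borel_measurable lborel" by measurable
      show "AE s in lborel. (indicat_real {0<..T} s * (w \<bullet> \<sigma> s))\<^sup>2 = indicat_real {0..T} s *\<^sub>R (w \<bullet> \<sigma> s)\<^sup>2"
        using AE_lborel_singleton[of "0::real"] by eventually_elim (auto split: split_indicator)
    qed
    ultimately show ?thesis by simp
  qed
  have char: "(CLINT \<omega>|M. iexp (w \<bullet> X T \<omega>)) = iexp (w \<bullet> \<alpha>) * exp (- (LBINT s. (indicat_real {0<..T} s * (w \<bullet> \<sigma> s))\<^sup>2) / 2)" for w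
  proof -
    have "iexp (w \<bullet> X T \<omega>) = iexp (w \<bullet> \<alpha>) * iexp (w \<bullet> Z T \<omega>)" for \<omega>
      by (simp add: XT inner_add_right exp_add distrib_left)
    then have "(CLINT \<omega>|M. iexp (w \<bullet> X T \<omega>)) = iexp (w \<bullet> \<alpha>) * (CLINT \<omega>|M. iexp (w \<bullet> Z T \<omega>))"
      by (simp only: integral_mult_right_zero)
    then show ?thesis
      using ito_integral_deterministic_char[OF Z(1) TT(2), of "{()}" "\<lambda>_. T" "\<lambda>_. w"] TT by simp
  qed
  have XM: "X T \<in> borel_measurable M" unfolding XT using ZT by simp
  have law': "normal_law \<alpha> S (distr M borel (X T))"
    by (rule gauss_law_distr[OF XM char cov])
  have "\<mu> = distr M borel (X T)"
    using law law' unfolding normal_law_def by (intro char_unique_vec) (auto simp only:)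
  then show ?thesis unfolding reach_laws_def using uL2 sol by blast
qed

text \<open>The law of a standard normal multiple of \<open>w\<close>, with a covariance of rank at
  most one. For nonzero \<open>w\<close> its variance in the direction \<open>w\<close> is positive,
  and such a law exists explicitly.\<close>

lemma degenerate_gauss_law:
  fixes w :: "real^'d"
  obtains \<mu> where "\<mu> \<in> gauss_laws" "(CLINT y|\<mu>. iexp (w \<bullet> y)) = exp (- ((w \<bullet> w)\<^sup>2) / 2)"
proof -
  define \<mu> where "\<mu> = distr std_normal_distribution borel (\<lambda>r. r *\<^sub>R w)"
  interpret N: real_distribution std_normal_distribution by (rule real_dist_normal_dist)
  have char: "(CLINT y|\<mu>. iexp (v \<bullet> y)) = exp (- ((v \<bullet> w)\<^sup>2) / 2)" for v
  proof -
    have "(CLINT y|\<mu>. iexp (v \<bullet> y)) = (CLINT r|std_normal_distribution. iexp (v \<bullet> (r *\<^sub>R w)))"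
      unfolding \<mu>_def by (rule integral_distr) measurable
    also have "\<dots> = char std_normal_distribution (v \<bullet> w)"
      by (simp add: char_def mult.commute)
    finally show ?thesis unfolding char_std_normal_distribution .
  qed
  define S where "S = (\<chi> i j. w $ i * w $ j)"
  have Sv: "S *v v = (v \<bullet> w) *\<^sub>R w" for v
    by (simp add: S_def matrix_vector_mult_def inner_vec_def vec_eq_iff sum_distrib_left mult_ac)
  then have q: "v \<bullet> (S *v v) = (v \<bullet> w)\<^sup>2" for v by (simp add: power2_eq_square)
  have "transpose S = S" by (simp add: S_def transpose_def vec_eq_iff mult.commute)
  then have "pos_semidef S" by (simp add: pos_semidef_def q)
  moreover have "normal_law 0 S \<mu>"
    unfolding normal_law_def
  proof (intro conjI allI)
    show "prob_space \<mu>" unfolding \<mu>_def by (rule N.prob_space_distr) measurable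
    show "(CLINT y|\<mu>. iexp (v \<bullet> y)) = exp (\<i> * complex_of_real (v \<bullet> 0) - complex_of_real (v \<bullet> (S *v v) / 2))" for v
      unfolding char q by (simp only: exp_of_real [symmetric]) simp
  qed (simp add: \<mu>_def)
  ultimately have "\<mu> \<in> gauss_laws" unfolding gauss_laws_def by blast
  then show thesis using char[of w] by (rule that)
qed

lemma unreachable_gauss_law:
  fixes A1 A2 C :: "real^'d^'d" and B2 D2 :: "real^'n^'d"
  assumes T: "0 < T" and range: "range ((*v) C) \<subseteq> range ((*v) D2)"
    and rk: "rank (kalman_matrix A1 D2) \<noteq> CARD('d)"
  shows "\<exists>\<mu>\<in>gauss_laws. \<forall>x. \<mu> \<notin> reach_laws M Filt W T A1 A2 B2 C D2 x"
proof -
  obtain w where w: "w \<noteq> 0" "\<And>k v. w \<bullet> (matpow A1 k *v (D2 *v v)) = 0"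
    using rank_kalman_less[OF rk] by blast
  obtain \<mu> where \<mu>: "\<mu> \<in> gauss_laws" "(CLINT y|\<mu>. iexp (w \<bullet> y)) = exp (- ((w \<bullet> w)\<^sup>2) / 2)"
    by (rule degenerate_gauss_law)
  have "\<mu> \<notin> reach_laws M Filt W T A1 A2 B2 C D2 x" for x
  proof
    assume "\<mu> \<in> reach_laws M Filt W T A1 A2 B2 C D2 x"
    then obtain u X where u: "u \<in> L2_prog M Filt T" and sol: "mf_solution M Filt W T A1 A2 B2 C D2 x u X"
      and \<mu>_eq: "\<mu> = distr M borel (X T)" unfolding reach_laws_def by blast
    note sc = solution_char[OF T u sol]
    note [measurable] = sc(2)
    have "w \<bullet> (mexp A1 (T - s) *v (C *v expectation (X s) + D2 *v expectation (u s))) = 0" for s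
    proof -
      \<comment> \<open>The range condition absorbs the feedback of the mean through
        \<open>C\<close> into the control term, so that \<open>w\<close> annihilates the transported
        diffusion coefficient.\<close>
      obtain z where "C *v expectation (X s) = D2 *v z" using range by (metis range_subsetD imageE)
      then have "C *v expectation (X s) + D2 *v expectation (u s) = D2 *v (z + expectation (u s))"
        by (simp add: matrix_vector_right_distrib)
      then show ?thesis by (simp only:) (rule inner_mexp_eq_0[OF w(2)])
    qed
    with sc(3) obtain \<alpha> where "(CLINT \<omega>|M. iexp (w \<bullet> X T \<omega>)) = iexp (w \<bullet> \<alpha>)" by auto
    moreover have "(CLINT y|\<mu>. iexp (w \<bullet> y)) = (CLINT \<omega>|M. iexp (w \<bullet> X T \<omega>))"
      unfolding \<mu>_eq by (rule integral_distr) measurable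
    ultimately have "complex_of_real (exp (- ((w \<bullet> w)\<^sup>2) / 2)) = iexp (w \<bullet> \<alpha>)" using \<mu>(2) by simp
    \<comment> \<open>Comparing moduli removes the unknown shift \<alpha>: the right side lies on
      the unit circle, the left side strictly inside unless \<open>w = 0\<close>.\<close>
    then have "norm (complex_of_real (exp (- ((w \<bullet> w)\<^sup>2) / 2))) = norm (iexp (w \<bullet> \<alpha>))" by (rule arg_cong)
    then have "exp (- ((w \<bullet> w)\<^sup>2) / 2) = 1" by (simp only: norm_of_real abs_exp_cancel norm_exp_i_times)
    then show False using w(1) by simp
  qed
  with \<mu>(1) show ?thesis by blast
qed

end

theorem theorem5p2:
  fixes M F0 :: "'a measure"
    and W :: "real \<Rightarrow> 'a \<Rightarrow> real"
    and T :: real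
    and A1 A2 C :: "real^'d^'d"
    and B2 D2 :: "real^'n^'d"
  assumes "T > 0"
    and "brownian_motion M W"
    and "subalgebra M F0"
    and "independent_of_process M F0 W"
    and "\<forall>\<mu>\<in>(wasserstein_space_2 :: (real^'d) measure set). supports_law M F0 \<mu>"
  shows "(range ((*v) C) \<subseteq> range ((*v) D2) \<and>
            ETCNL M (brownian_filtration M F0 W) W T A1 A2 B2 C D2
          \<longrightarrow> rank (kalman_matrix A1 D2) = CARD('d))
       \<and> (rank D2 = CARD('d) \<longrightarrow>
            ETCNL M (brownian_filtration M F0 W) W T A1 A2 B2 C D2)"
proof -
  interpret brownian M F0 W
    using assms(2-4) by (intro brownian.intro brownian_axioms.intro) (simp_all add: brownian_motion_def)
  have "rank (kalman_matrix A1 D2) = CARD('d)"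
    if "range ((*v) C) \<subseteq> range ((*v) D2)"
      and "ETCNL M (brownian_filtration M F0 W) W T A1 A2 B2 C D2"
  proof (rule ccontr)
    assume "rank (kalman_matrix A1 D2) \<noteq> CARD('d)"
    from unreachable_gauss_law[OF assms(1) that(1) this, of A2 B2] that(2)
    show False unfolding ETCNL_def by blast
  qed
  moreover have "ETCNL M (brownian_filtration M F0 W) W T A1 A2 B2 C D2"
    if "rank D2 = CARD('d)"
    unfolding ETCNL_def
  proof (intro equalityI subsetI)
    fix \<mu> assume "\<mu> \<in> (\<Union>x. reach_laws M (brownian_filtration M F0 W) W T A1 A2 B2 C D2 x)"
    then show "\<mu> \<in> gauss_laws" using reach_laws_gauss[OF assms(1)] by blast
  next
    fix \<mu> :: "(real^'d) measure" assume "\<mu> \<in> gauss_laws"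
    then have "\<exists>x. \<mu> \<in> reach_laws M (brownian_filtration M F0 W) W T A1 A2 B2 C D2 x"
      by (rule gauss_law_reachable[OF assms(1) that])
    then show "\<mu> \<in> (\<Union>x. reach_laws M (brownian_filtration M F0 W) W T A1 A2 B2 C D2 x)"
      by (elim exE) (rule UN_I[OF UNIV_I])
  qed
  ultimately show ?thesis by blast
qed

end
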